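(* Suppose the bids satisfy the standing assumption below and the kernel $K$ satisfies Assumption 2, and let $h=h_n\to 0$ with $nh_n\to\infty$. Then $$Z_n(u)=Z_n^*(u)+R_n(u),\qquad u\in[h,1-h],$$ where $$Z_n(u)=\frac{\sqrt{nh}\,(\hat v_h(u)-v(u))}{\hat q_h(u)},\qquad Z_n^*(u)=-A(u)\,\mathbb G_{n,h}(u),$$ and $\sup_{u\in[h,1-h]}|R_n(u)|=O_{a.s.}\big(n^{1/2}h^{3/2}+h^{1/2}+h^{-1/2}n^{-1/4}\ell(n)\big)$.
   Context: Standing assumption: $b_1,\dots,b_n$ are i.i.d. bids with continuous CDF $F$ whose quantile function $Q=F^{-1}$ is twice continuously differentiable on $[0,1]$ with $q=Q'>0$ on $[0,1]$. $p_1,\dots,p_M$ are fixed known nonnegative numbers ($M\ge 2$), $A_1(u)=\sum_{m=1}^M p_m u^{m-1}$ with $A_1'(u)\neq0$ on $[0,1]$, and $A(u)=A_1(u)/A_1'(u)$ (a known function). The value quantile function is $v(u)=Q(u)+A(u)q(u)$. Estimators: $b_{(1)}\le\dots\le b_{(n)}$ are the order statistics; $\hat Q(u)=b_{(\lfloor nu\rfloor+1)}$ for $u\in[0,1)$ and $\hat Q(1)=b_{(n)}$; $K_h(z)=h^{-1}K(z/h)$; $\hat q_h(u)=\int_0^1 K_h(u-z)\,d\hat Q(z)=\sum_{i=1}^{n-1}K_h(u-i/n)(b_{(i+1)}-b_{(i)})$; $\hat v_h(u)=\hat Q(u)+A(u)\hat q_h(u)$. $\mathbb G_{n,h}(u)=\sqrt{nh}\,\frac1n\sum_{i=1}^n\big[K_h(u-F(b_i))-\mathbb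 E K_h(u-F(b_i))\big]$. $\ell(n)=(\log n)^{1/2}(\log\log n)^{1/4}$. Assumption 2 (kernel): $K:\mathbb R\to\mathbb R$ is nonnegative, $\int K=1$, $R_K=\int K^2<\infty$, and $K$ is Lipschitz and supported on $[-1,1]$. Notation: for a deterministic sequence $r_n$, $X_n=O_{a.s.}(r_n)$ means there is an a.s. finite random variable $C$ with $|X_n|\le C r_n$ for all sufficiently large $n$, almost surely. *)

theory Defs
  imports "HOL-Probability.Probability"
begin

definition A1 :: "(nat \<Rightarrow> real) \<Rightarrow> nat \<Rightarrow> real \<Rightarrow> real" where
  "A1 p Mp u = (\<Sum>m = 1..Mp. p m * u ^ (m - 1))"

definition A1' :: "(nat \<Rightarrow> real) \<Rightarrow> nat \<Rightarrow> real \<Rightarrow> real" where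
  "A1' p Mp u = (\<Sum>m = 1..Mp. p m * real (m - 1) * u ^ (m - 2))"

definition Afun :: "(nat \<Rightarrow> real) \<Rightarrow> nat \<Rightarrow> real \<Rightarrow> real" where
  "Afun p Mp u = A1 p Mp u / A1' p Mp u"

definition Kh :: "(real \<Rightarrow> real) \<Rightarrow> real \<Rightarrow> real \<Rightarrow> real" where
  "Kh K h z = K (z / h) / h"

definition order_stat :: "real list \<Rightarrow> nat \<Rightarrow> real" where
  "order_stat xs i = sort xs ! (i - 1)"

definition Qhat :: "real list \<Rightarrow> real \<Rightarrow> real" where
  "Qhat xs u = (if u < 1 then order_stat xs (nat \<lfloor>real (length xs) * u\<rfloor> + 1)
                else order_stat xs (length xs))"

definition qhat :: "(real \<Rightarrow> real) \<Rightarrow> real \<Rightarrow> real list \<Rightarrow> real \<Rightarrow> real" where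
  "qhat K h xs u = (\<Sum>i = 1..length xs - 1.
      Kh K h (u - real i / real (length xs)) * (order_stat xs (i + 1) - order_stat xs i))"

definition vhat :: "(nat \<Rightarrow> real) \<Rightarrow> nat \<Rightarrow> (real \<Rightarrow> real) \<Rightarrow> real \<Rightarrow> real list \<Rightarrow> real \<Rightarrow> real" where
  "vhat p Mp K h xs u = Qhat xs u + Afun p Mp u * qhat K h xs u"

definition Gnh :: "'a measure \<Rightarrow> (real \<Rightarrow> real) \<Rightarrow> (real \<Rightarrow> real) \<Rightarrow> (nat \<Rightarrow> 'a \<Rightarrow> real)
      \<Rightarrow> real \<Rightarrow> nat \<Rightarrow> real \<Rightarrow> 'a \<Rightarrow> real" where
  "Gnh M K F b h n u \<omega> = sqrt (real n * h) * (1 / real n) *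
     (\<Sum>i<n. Kh K h (u - F (b i \<omega>)) - (\<integral>\<omega>'. Kh K h (u - F (b i \<omega>')) \<partial>M))"

definition ell :: "nat \<Rightarrow> real" where
  "ell n = sqrt (ln (real n)) * (ln (ln (real n))) powr (1/4)"

end

theory Submission
  imports Defs "HOL-Real_Asymp.Real_Asymp"
begin

text \<open>Since \<open>U_i = F(b_i)\<close> are i.i.d. uniform, the ordered bids are \<open>Q(T_1) \<le> \<dots> \<le> Q(T_n)\<close> with \<open>T_j\<close> the uniform
  order statistics. Write \<open>k_j = K_h(u - j/n)\<close>, \<open>P = \<Sum>j. k_j (T_{j+1} - T_j)\<close> and \<open>g = G_{n,h}(u) / sqrt(n h)\<close>.
  Summation by parts turns \<open>P\<close>, \<open>1 + g\<close> and \<open>1\<close> into sums over the increments of \<open>k\<close>, of total variation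
  \<open>O(1/h)\<close>, so that \<open>e = P - 1 + g\<close> is essentially such a sum over \<open>T_j + F_n(j/n) - 2 j/n\<close>. This is the
  Bahadur--Kiefer quantity, of order \<open>n^(-3/4) ell(n)\<close>. As \<open>qhat = q(u) P (1 + O(h + max_j |T_j - j/n|))\<close>, the
  theorem follows from \<open>1 + g - 1/P = (e (1 + g) - g^2) / P\<close>.

  The iterated logarithm in \<open>ell\<close> comes from the bound \<open>O(sqrt(n ln ln n))\<close> on the discrepancy of the sample,
  which follows from Bernstein's inequality by chaining over dyadic rectangles in (sample size) times (space).
  The division by \<open>qhat\<close> is delicate when \<open>n h\<close> diverges slowly, as \<open>P\<close> need not stay away from \<open>0\<close>: for
  \<open>n h \<le> n^(1/16)\<close> the rate exceeds \<open>n^(7/32)\<close>, and a crude estimate suffices because almost surely no interval of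
  length \<open>n^(-17/16)\<close> contains 64 sample points.\<close>

text \<open>All randomness sits in three almost sure statements about counts of sample points in
  intervals: discrepancy, oscillation, and absence of clumps. Once a sample path with these
  properties is fixed, the rest is deterministic and holds for every u at once, so the supremum over
  u costs nothing.

  The shape of \<open>ell\<close> comes from two scales. \<open>T_j\<close> lies within about
  sqrt(ln ln n / n) of j/n, and counts over such a distance fluctuate by n^(1/4) (ln n)^(1/2) (ln ln
  n)^(1/4). A discrepancy bound with ln n in place of ln ln n would give (ln n)^(3/4) instead, which
  is why chaining in the sample size is worth its price.

  The split at n^(1/16) works because a positive power of n exceeds every multiple of ln n, which
  makes the regular bounds available above it. Below it, \<open>P\<close> is still at least a
  multiple of n^(-17/16) / h, so the scaled remainder is at most of order (n h)^(3/2) n^(1/16) <=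
  n^(5/32), well under n^(7/32). The square g^2 is of order ln n / (n h); after scaling it fits into
  the third summand of the rate because ln n <= n^(1/4).\<close>

section \<open>Concentration of the number of uniform points in an interval\<close>

text \<open>Half-open intervals make counts over adjacent intervals add up. The index set is a
  parameter because chaining in the sample size counts within blocks of the sample.\<close>

definition pcount :: "(nat \<Rightarrow> real) \<Rightarrow> nat set \<Rightarrow> real \<Rightarrow> real \<Rightarrow> real" where
  "pcount V I s t = (\<Sum>i\<in>I. indicator {s<..t} (V i))"

lemma pcount_nonneg: "0 \<le> pcount V I s t"
  by (simp add: pcount_def sum_nonneg)

lemma pcount_mono:
  assumes "s' \<le> s" "t \<le> t'"
  shows "pcount V I s t \<le> pcount V I s' t'"
  unfolding pcount_def using assms by (intro sum_mono) (auto simp: indicator_def)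

lemma pcount_split:
  assumes "r \<le> s" "s \<le> t"
  shows "pcount V I r t = pcount V I r s + pcount V I s t"
  unfolding pcount_def sum.distrib[symmetric] using assms
  by (intro sum.cong) (auto simp: indicator_def)

lemma pcount_union:
  assumes "finite A" "finite B" "A \<inter> B = {}"
  shows "pcount V (A \<union> B) s t = pcount V A s t + pcount V B s t"
  unfolding pcount_def using assms by (rule sum.union_disjoint)

lemma exp_le_quadratic:
  fixes x :: real
  assumes "\<bar>x\<bar> \<le> 1"
  shows "exp x \<le> 1 + x + x\<^sup>2"
proof (cases "x \<ge> 0")
  case True
  then show ?thesis using assms by (intro exp_bound) auto
next
  case False
  define y where "y = - x"
  have y: "0 < y" "y \<le> 1" using False assms by (auto simp: y_def)
  have "(1 + y) * (1 - y + y\<^sup>2) = 1 + y ^ 3" by (simp add: algebra_simps power2_eq_square power3_eq_cube)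
  then have "1 \<le> (1 - y + y\<^sup>2) * (1 + y)" using y by (simp add: mult.commute)
  also have "\<dots> \<le> (1 - y + y\<^sup>2) * exp y"
    using y exp_ge_add_one_self[of y] by (intro mult_left_mono) auto
  finally have "exp (- y) \<le> 1 - y + y\<^sup>2"
    by (simp add: exp_minus field_simps)
  then show ?thesis by (simp add: y_def)
qed

locale iid_uniform = prob_space M for M :: "'a measure" +
  fixes U :: "nat \<Rightarrow> 'a \<Rightarrow> real"
  assumes indep: "indep_vars (\<lambda>_. borel) U UNIV"
    and unif: "\<And>i t. 0 \<le> t \<Longrightarrow> t \<le> 1 \<Longrightarrow> prob {\<omega> \<in> space M. U i \<omega> \<le> t} = t"
begin

lemma meas_U [measurable]: "U i \<in> borel_measurable M"
  using indep by (auto simp: indep_vars_def)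

lemma pcount_measurable [measurable]: "(\<lambda>\<omega>. pcount (\<lambda>i. U i \<omega>) I s t) \<in> borel_measurable M"
  unfolding pcount_def by measurable

lemma expectation_indicator:
  assumes "0 \<le> s" "s \<le> t" "t \<le> 1"
  shows "expectation (\<lambda>\<omega>. indicator {s<..t} (U i \<omega>)) = t - s"
proof -
  have "expectation (\<lambda>\<omega>. indicator {s<..t} (U i \<omega>) :: real)
      = expectation (indicator {\<omega> \<in> space M. U i \<omega> \<in> {s<..t}})"
    by (intro Bochner_Integration.integral_cong) (auto simp: indicator_def)
  also have "\<dots> = prob {\<omega> \<in> space M. U i \<omega> \<in> {s<..t}}" by simp
  also have "{\<omega> \<in> space M. U i \<omega> \<in> {s<..t}} = {\<omega> \<in> space M. U i \<omega> \<le> t} - {\<omega> \<in> space M. U i \<omega> \<le> s}"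
    by auto
  also have "prob \<dots> = t - s"
    using assms by (subst finite_measure_Diff) (auto simp: unif)
  finally show ?thesis .
qed

text \<open>The count is a sum of independent Bernoulli variables, and 1 + x <= exp x bounds its
  moment generating function by that of a Poisson variable with the same mean.\<close>

lemma mgf_pcount:
  assumes I: "finite I" and st: "0 \<le> s" "s \<le> t" "t \<le> 1"
  shows "integrable M (\<lambda>\<omega>. exp (\<theta> * pcount (\<lambda>i. U i \<omega>) I s t))"
    and "expectation (\<lambda>\<omega>. exp (\<theta> * pcount (\<lambda>i. U i \<omega>) I s t))
      \<le> exp (real (card I) * (t - s) * (exp \<theta> - 1))"
proof -
  define Y where "Y x = 1 + (exp \<theta> - 1) * indicator {s<..t} x" for x :: real
  have [measurable]: "Y \<in> borel_measurable borel" unfolding Y_def by measurable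
  have eq: "exp (\<theta> * pcount (\<lambda>i. U i \<omega>) I s t) = (\<Prod>i\<in>I. Y (U i \<omega>))" for \<omega>
    unfolding pcount_def sum_distrib_left exp_sum[OF I]
    by (intro prod.cong) (auto simp: Y_def indicator_def)
  have ind: "indep_vars (\<lambda>_. borel) (\<lambda>i \<omega>. Y (U i \<omega>)) I"
    by (intro indep_vars_compose2[OF indep_vars_subset[OF indep]]) auto
  have bnd: "\<bar>Y x\<bar> \<le> 1 + exp \<theta>" for x
    by (auto simp: Y_def indicator_def)
  have int: "integrable M (\<lambda>\<omega>. Y (U i \<omega>))" for i
    by (intro integrable_const_bound[where B="1 + exp \<theta>"]) (use bnd in auto)
  have int2: "integrable M (\<lambda>\<omega>. indicator {s<..t} (U i \<omega>) :: real)" for i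
    by (intro integrable_const_bound[where B=1]) (auto simp: indicator_def)
  have E: "expectation (\<lambda>\<omega>. Y (U i \<omega>)) = 1 + (exp \<theta> - 1) * (t - s)" for i
    unfolding Y_def using int2 by (simp add: expectation_indicator[OF st] prob_space)
  show "integrable M (\<lambda>\<omega>. exp (\<theta> * pcount (\<lambda>i. U i \<omega>) I s t))"
    unfolding eq using indep_vars_integrable[OF I ind] int by auto
  have "expectation (\<lambda>\<omega>. exp (\<theta> * pcount (\<lambda>i. U i \<omega>) I s t)) = (\<Prod>i\<in>I. 1 + (exp \<theta> - 1) * (t - s))"
    unfolding eq using indep_vars_lebesgue_integral[OF I ind] int by (simp add: E)
  also have "\<dots> = (1 + (exp \<theta> - 1) * (t - s)) ^ card I" by simp
  also have "\<dots> \<le> exp ((exp \<theta> - 1) * (t - s)) ^ card I"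
  proof (rule power_mono)
    have "0 \<le> (1 - (t - s)) + exp \<theta> * (t - s)"
      using st by (intro add_nonneg_nonneg mult_nonneg_nonneg) auto
    then show "0 \<le> 1 + (exp \<theta> - 1) * (t - s)" by (simp add: algebra_simps)
  qed simp
  also have "\<dots> = exp (real (card I) * (t - s) * (exp \<theta> - 1))"
    by (simp add: exp_of_nat_mult[symmetric] mult_ac)
  finally show "expectation (\<lambda>\<omega>. exp (\<theta> * pcount (\<lambda>i. U i \<omega>) I s t))
      \<le> exp (real (card I) * (t - s) * (exp \<theta> - 1))" .
qed

lemma pcount_Chernoff:
  assumes I: "finite I" and st: "0 \<le> s" "s \<le> t" "t \<le> 1" and \<theta>: "\<theta> > 0"
  shows "prob {\<omega> \<in> space M. pcount (\<lambda>i. U i \<omega>) I s t \<ge> a}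
      \<le> exp (real (card I) * (t - s) * (exp \<theta> - 1) - \<theta> * a)" (is ?upper)
    and "prob {\<omega> \<in> space M. pcount (\<lambda>i. U i \<omega>) I s t \<le> a}
      \<le> exp (real (card I) * (t - s) * (exp (- \<theta>) - 1) + \<theta> * a)" (is ?lower)
proof -
  have S: "set_lebesgue_integral M (space M) f = expectation f" for f :: "'a \<Rightarrow> real"
    unfolding set_lebesgue_integral_def by (intro Bochner_Integration.integral_cong) auto
  have SI: "set_integrable M (space M) (\<lambda>\<omega>. exp (c * pcount (\<lambda>i. U i \<omega>) I s t))" for c
    using mgf_pcount(1)[OF I st] unfolding set_integrable_def by (intro integrable_mult_indicator) auto
  have "prob {\<omega> \<in> space M. pcount (\<lambda>i. U i \<omega>) I s t \<ge> a}
      \<le> exp (-\<theta> * a) * expectation (\<lambda>\<omega>. exp (\<theta> * pcount (\<lambda>i. U i \<omega>) I s t))"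
    using Chernoff_ineq_ge[OF \<theta> SI] unfolding S by auto
  also have "\<dots> \<le> exp (-\<theta> * a) * exp (real (card I) * (t - s) * (exp \<theta> - 1))"
    using mgf_pcount(2)[OF I st] by (intro mult_left_mono) auto
  finally show ?upper by (simp add: exp_add[symmetric] algebra_simps)
  have "prob {\<omega> \<in> space M. pcount (\<lambda>i. U i \<omega>) I s t \<le> a}
      \<le> exp (\<theta> * a) * expectation (\<lambda>\<omega>. exp (- \<theta> * pcount (\<lambda>i. U i \<omega>) I s t))"
    using Chernoff_ineq_le[OF \<theta> SI] unfolding S by auto
  also have "\<dots> \<le> exp (\<theta> * a) * exp (real (card I) * (t - s) * (exp (- \<theta>) - 1))"
    using mgf_pcount(2)[OF I st, of "-\<theta>"] by (intro mult_left_mono) auto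
  finally show ?lower by (simp add: exp_add[symmetric] algebra_simps)
qed

text \<open>Parametrized by the exponent y so that union bounds can choose y directly. The deviation
  has a Gaussian part sqrt(y m) and a Poisson part y, the latter dominating when the mean m is
  small.\<close>

lemma pcount_Bernstein:
  assumes I: "finite I" and st: "0 \<le> s" "s \<le> t" "t \<le> 1" and y: "y > 0"
  defines "m \<equiv> real (card I) * (t - s)"
  shows "prob {\<omega> \<in> space M. \<bar>pcount (\<lambda>i. U i \<omega>) I s t - m\<bar> \<ge> 3 * (sqrt (y * m) + y)} \<le> 2 * exp (- 2 * y)"
proof -
  define lam where "lam = 3 * (sqrt (y * m) + y)"
  \<comment> \<open>With this choice \<theta> <= 1, so the quadratic bound on exp applies, m
    \<theta>^2 <= y, and \<theta> (sqrt(y m) + y) >= y. The factor 3 in the deviation then leaves an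
    exponent of y - 3 y = -2 y.\<close>
  define \<theta> where "\<theta> = sqrt (y / (m + y))"
  have m: "m \<ge> 0" unfolding m_def using st by simp
  have \<theta>: "\<theta> > 0" "\<theta> \<le> 1" using y m by (auto simp: \<theta>_def)
  have \<theta>2: "\<theta>\<^sup>2 * m \<le> y" using y m by (simp add: \<theta>_def field_simps)
  have "y = \<theta> * (sqrt y * sqrt (m + y))"
    using y m by (simp add: \<theta>_def real_sqrt_divide)
  also have "\<dots> \<le> \<theta> * (sqrt y * (sqrt m + sqrt y))"
    using y m \<theta> sqrt_add_le_add_sqrt[of m y] by (intro mult_left_mono) auto
  also have "\<dots> = \<theta> * (sqrt (y * m) + y)"
    using y by (simp add: real_sqrt_mult algebra_simps)
  finally have lam: "3 * y \<le> \<theta> * lam" unfolding lam_def by (simp only: mult.left_commute[of \<theta> 3])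
  have "prob {\<omega> \<in> space M. pcount (\<lambda>i. U i \<omega>) I s t \<ge> m + lam}
      \<le> exp (m * (exp \<theta> - 1) - \<theta> * (m + lam))"
    unfolding m_def by (rule pcount_Chernoff[OF I st \<theta>(1)])
  also have "\<dots> \<le> exp (- 2 * y)"
  proof -
    have "m * (exp \<theta> - 1 - \<theta>) \<le> m * \<theta>\<^sup>2"
      using exp_le_quadratic[of \<theta>] \<theta> m by (intro mult_left_mono) auto
    then show ?thesis using \<theta>2 lam by (simp add: algebra_simps)
  qed
  finally have 1: "prob {\<omega> \<in> space M. pcount (\<lambda>i. U i \<omega>) I s t \<ge> m + lam} \<le> exp (- 2 * y)" .
  have "prob {\<omega> \<in> space M. pcount (\<lambda>i. U i \<omega>) I s t \<le> m - lam}
      \<le> exp (m * (exp (-\<theta>) - 1) + \<theta> * (m - lam))"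
    unfolding m_def by (rule pcount_Chernoff[OF I st \<theta>(1)])
  also have "\<dots> \<le> exp (- 2 * y)"
  proof -
    have "m * (exp (-\<theta>) - 1 + \<theta>) \<le> m * \<theta>\<^sup>2"
      using exp_le_quadratic[of "-\<theta>"] \<theta> m by (intro mult_left_mono) auto
    then show ?thesis using \<theta>2 lam by (simp add: algebra_simps)
  qed
  finally have 2: "prob {\<omega> \<in> space M. pcount (\<lambda>i. U i \<omega>) I s t \<le> m - lam} \<le> exp (- 2 * y)" .
  have "{\<omega> \<in> space M. \<bar>pcount (\<lambda>i. U i \<omega>) I s t - m\<bar> \<ge> lam} =
     {\<omega> \<in> space M. pcount (\<lambda>i. U i \<omega>) I s t \<ge> m + lam} \<union> {\<omega> \<in> space M. pcount (\<lambda>i. U i \<omega>) I s t \<le> m - lam}"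
    by (auto simp: abs_if)
  also have "prob \<dots> \<le> exp (- 2 * y) + exp (- 2 * y)"
    by (rule order_trans[OF measure_Un_le add_mono[OF 1 2]]) auto
  finally show ?thesis by (simp add: lam_def)
qed

end

section \<open>Almost sure regularity of a uniform sample\<close>

lemma (in prob_space) AE_eventually_finite_union:
  fixes s :: "nat \<Rightarrow> real"
  assumes fin: "\<And>n. finite (X n)" and meas: "\<And>n x. x \<in> X n \<Longrightarrow> E n x \<in> events"
    and bound: "\<forall>\<^sub>F n in sequentially. (\<Sum>x\<in>X n. prob (E n x)) \<le> s n"
    and sum: "summable s"
  shows "AE \<omega> in M. \<forall>\<^sub>F n in sequentially. \<forall>x\<in>X n. \<omega> \<notin> E n x"
proof -
  define A where "A n = (\<Union>x\<in>X n. E n x)" for n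
  have A: "A n \<in> events" for n unfolding A_def using fin meas by auto
  have le: "prob (A n) \<le> (\<Sum>x\<in>X n. prob (E n x))" for n
    unfolding A_def using fin meas by (intro finite_measure_subadditive_finite) auto
  have "summable (\<lambda>n. prob (A n))"
  proof (rule summable_comparison_test_ev[OF _ sum])
    show "\<forall>\<^sub>F n in sequentially. norm (prob (A n)) \<le> s n"
      using bound by eventually_elim (use le in \<open>auto intro: order_trans\<close>)
  qed
  then have "AE \<omega> in M. \<forall>\<^sub>F n in sequentially. \<omega> \<in> space M - A n"
    by (intro borel_cantelli_AE1 A) (auto simp: emeasure_eq_measure)
  then show ?thesis
    by eventually_elim (auto elim!: eventually_mono simp: A_def)
qed

text \<open>Counts are monotone in the interval, so (s, t] is squeezed between two grid intervals
  whose lengths, in units of 1/n, differ from x by at most 2. The additive terms amount to 2 + 12 l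
  <= 14 l, which fixes the constant.\<close>

lemma oscillation_from_grid:
  fixes n :: nat
  assumes l: "l \<ge> 1" and n: "n > 0"
    and grid: "\<And>i j. i \<le> j \<Longrightarrow> j \<le> n \<Longrightarrow>
      \<bar>pcount V I (real i / real n) (real j / real n) - real (j - i)\<bar> \<le> 3 * (sqrt (2 * l * real (j - i)) + 2 * l)"
    and st: "0 \<le> s" "s \<le> t" "t \<le> 1"
  shows "\<bar>pcount V I s t - real n * (t - s)\<bar> \<le> 14 * (sqrt (real n * (t - s) * l) + l)"
proof -
  define x where "x = real n * (t - s)"
  have x: "x \<ge> 0" using st by (simp add: x_def)
  have sq: "sqrt (2 * l * d) \<le> 2 * sqrt (x * l) + 2 * l" if "0 \<le> d" "d \<le> x + 2" for d
  proof (rule real_le_lsqrt)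
    have "2 * l * d \<le> 2 * l * (x + 2)" using that l by (intro mult_left_mono) auto
    also have "\<dots> \<le> 4 * (x * l) + 4 * l * l" 
    proof -
      have "l * 1 \<le> l * l" using l by (intro mult_left_mono) auto
      moreover have "0 \<le> x * l" using l x by simp
      ultimately show ?thesis by (simp add: algebra_simps)
    qed
    also have "\<dots> \<le> 4 * (sqrt (x * l))\<^sup>2 + 4 * l\<^sup>2 + 8 * l * sqrt (x * l)"
      using l x by (simp add: power2_eq_square)
    also have "\<dots> = (2 * sqrt (x * l) + 2 * l)\<^sup>2" by (simp add: power2_eq_square algebra_simps)
    finally show "2 * l * d \<le> (2 * sqrt (x * l) + 2 * l)\<^sup>2" .
  qed (use l x that in auto)
  have "pcount V I s t \<le> x + 14 * (sqrt (x * l) + l)"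
  proof -
    define i j where "i = nat \<lfloor>real n * s\<rfloor>" and "j = nat \<lceil>real n * t\<rceil>"
    have i: "real i \<le> real n * s" "real n * s < real i + 1" using st by (auto simp: i_def)
    have j: "real n * t \<le> real j" "real j < real n * t + 1" using st by (auto simp: j_def, linarith+)
    have "real n * s \<le> real n * t" "real n * t \<le> real n" using st n by (auto simp: mult_left_mono)
    then have "real i \<le> real j" "real j < real n + 1" using i j by linarith+
    then have ij: "i \<le> j" "j \<le> n" by linarith+
    have d: "real (j - i) \<le> x + 2" using i j ij by (simp add: x_def of_nat_diff algebra_simps)
    have "pcount V I s t \<le> pcount V I (real i / real n) (real j / real n)"
      using i j n by (intro pcount_mono) (auto simp: field_simps)
    also have "\<dots> \<le> real (j - i) + 3 * (sqrt (2 * l * real (j - i)) + 2 * l)"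
      using grid[OF ij] by linarith
    also have "\<dots> \<le> (x + 2) + 3 * ((2 * sqrt (x * l) + 2 * l) + 2 * l)"
      using sq[OF of_nat_0_le_iff d] d by (intro add_mono mult_left_mono) auto
    also have "\<dots> \<le> x + 14 * (sqrt (x * l) + l)"
    proof -
      have "sqrt (x * l) \<ge> 0" using l x by simp
      then show ?thesis using l by argo
    qed
    finally show ?thesis .
  qed
  moreover have "x - 14 * (sqrt (x * l) + l) \<le> pcount V I s t"
  proof -
    define i j where "i = nat \<lceil>real n * s\<rceil>" and "j = nat \<lfloor>real n * t\<rfloor>"
    have i: "real n * s \<le> real i" "real i < real n * s + 1" using st by (auto simp: i_def, linarith+)
    have j: "real j \<le> real n * t" "real n * t < real j + 1" using st by (auto simp: j_def)
    have s0: "sqrt (x * l) \<ge> 0" using l x by simp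
    show ?thesis
    proof (cases "i \<le> j")
      case True
      have "real n * t \<le> real n" using st n by (auto simp: mult_left_mono)
      then have jn: "j \<le> n" using j by linarith
      have d: "real (j - i) \<le> x + 2" "x - 2 \<le> real (j - i)" using i j True by (simp_all add: x_def of_nat_diff algebra_simps)
      have "x - 14 * (sqrt (x * l) + l) \<le> (x - 2) - 3 * ((2 * sqrt (x * l) + 2 * l) + 2 * l)"
        using l s0 by argo
      also have "\<dots> \<le> real (j - i) - 3 * (sqrt (2 * l * real (j - i)) + 2 * l)"
        using sq[OF of_nat_0_le_iff d(1)] d(2) by (intro diff_mono mult_left_mono add_mono) auto
      also have "\<dots> \<le> pcount V I (real i / real n) (real j / real n)"
        using grid[OF True jn] by linarith
      also have "\<dots> \<le> pcount V I s t"
        using i j n by (intro pcount_mono) (auto simp: field_simps)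
      finally show ?thesis .
    next
      \<comment> \<open>No grid interval fits inside (s, t], so x <= 2 and the lower bound is
        negative.\<close>
      case False
      then have "real j + 1 \<le> real i" by linarith
      then have "x \<le> 2" using i j by (simp add: x_def algebra_simps)
      then show ?thesis using pcount_nonneg[of V I s t] l s0 by argo
    qed
  qed
  ultimately show ?thesis unfolding x_def by linarith
qed

text \<open>The binary expansion of n leads from 0 to n by adding powers of two in decreasing order,
  so each level is used at most once. The induction is on how many levels below the top are allowed,
  for n divisible by the lowest allowed power.\<close>

lemma dyadic_chaining:
  fixes f :: "nat \<Rightarrow> real"
  assumes step: "\<And>l c. l \<le> k \<Longrightarrow> c < 2 ^ (k - l) \<Longrightarrow> \<bar>f ((c + 1) * 2 ^ l) - f (c * 2 ^ l)\<bar> \<le> B l"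
    and B: "\<And>l. B l \<ge> 0" and n: "n \<le> 2 ^ k"
  shows "\<bar>f n - f 0\<bar> \<le> (\<Sum>l\<le>k. B l)"
proof -
  have "\<bar>f n - f 0\<bar> \<le> (\<Sum>l\<in>{k-d..k}. B l)" if "d \<le> k" "2 ^ (k - d) dvd n" "n \<le> 2 ^ k" for d n
    using that
  proof (induction d arbitrary: n)
    case 0
    then obtain c where "n = 2 ^ k * c" by auto
    then have "n = 0 \<or> n = 2 ^ k" using 0 by (cases "c = 0") (auto simp: dvd_def)
    then show ?case using step[of k 0] B[of k] by auto
  next
    case (Suc d)
    define l where "l = k - Suc d"
    have kd: "k - d = Suc l" using Suc.prems by (simp add: l_def)
    have set: "{l..k} = insert l {Suc l..k}" using Suc.prems by (auto simp: l_def)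
    obtain c where c: "n = 2 ^ l * c" using Suc.prems by (auto simp: l_def)
    show ?case
    proof (cases "even c")
      case True
      then have "2 ^ (k - d) dvd n" unfolding kd c by (auto simp: mult_dvd_mono)
      then have "\<bar>f n - f 0\<bar> \<le> (\<Sum>l\<in>{Suc l..k}. B l)" using Suc.IH[of n] Suc.prems kd by simp
      then show ?thesis using B[of l] unfolding l_def[symmetric] set by simp
    next
      \<comment> \<open>The lowest binary digit of c is set: n' removes it, is divisible by the next
        power of two, and differs from n by one increment of level l.\<close>
      case False
      then obtain e where e: "c = 2 * e + 1" by (auto elim: oddE)
      define n' where "n' = 2 ^ l * (2 * e)"
      have "2 ^ (k - d) dvd n'" unfolding kd n'_def by simp
      moreover have "n' \<le> 2 ^ k" using Suc.prems(3) unfolding c e n'_def by simp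
      ultimately have 1: "\<bar>f n' - f 0\<bar> \<le> (\<Sum>l\<in>{Suc l..k}. B l)" using Suc.IH[of n'] Suc.prems kd by simp
      have lk: "l \<le> k" by (simp add: l_def)
      have "2 ^ l * (2 * e) < (2::nat) ^ l * 2 ^ (k - l)"
      proof -
        have "2 ^ l * (2 * e) < (2::nat) ^ l * (2 * e + 1)" by simp
        also have "\<dots> \<le> 2 ^ k" using Suc.prems(3) unfolding c e .
        also have "\<dots> = 2 ^ l * 2 ^ (k - l)" using lk by (simp add: power_add[symmetric])
        finally show ?thesis .
      qed
      then have "2 * e < 2 ^ (k - l)" by simp
      from step[OF lk this] have "\<bar>f n - f n'\<bar> \<le> B l"
        unfolding c e n'_def by (simp add: mult.commute add.commute)
      then show ?thesis using 1 unfolding l_def[symmetric] set by simp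
    qed
  qed
  from this[of k n] n show ?thesis by (simp add: atMost_atLeast0)
qed

context iid_uniform
begin

text \<open>About n^2 grid intervals are tested with exponent y = 2 ln n, so each fails with
  probability at most 2 n^(-4), and the total n^(-2) is summable.\<close>

lemma AE_oscillation:
  "AE \<omega> in M. \<forall>\<^sub>F n in sequentially. \<forall>s t. 0 \<le> s \<longrightarrow> s \<le> t \<longrightarrow> t \<le> 1 \<longrightarrow>
     \<bar>pcount (\<lambda>i. U i \<omega>) {..<n} s t - real n * (t - s)\<bar> \<le> 14 * (sqrt (real n * (t - s) * ln (real n)) + ln (real n))"
proof -
  define X where "X n = {(i, j). i \<le> j \<and> j \<le> n}" for n :: nat
  define E where "E n x = (case x of (i, j) \<Rightarrow> {\<omega> \<in> space M.
     \<bar>pcount (\<lambda>i. U i \<omega>) {..<n} (real i / real n) (real j / real n) - real (j - i)\<bar>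
       \<ge> 3 * (sqrt (2 * ln (real n) * real (j - i)) + 2 * ln (real n))})" for n :: nat and x
  have sub: "X n \<subseteq> {..n} \<times> {..n}" for n unfolding X_def by auto
  have fin: "finite (X n)" for n by (rule finite_subset[OF sub]) simp
  have cX: "real (card (X n)) \<le> 4 * real n ^ 2" if "n \<ge> 1" for n
  proof -
    have "card (X n) \<le> (n + 1) * (n + 1)" using card_mono[OF _ sub] by (simp add: card_cartesian_product)
    also have "\<dots> \<le> (2 * n) * (2 * n)" using that by (intro mult_mono) auto
    finally have "real (card (X n)) \<le> real ((2 * n) * (2 * n))" by (simp only: of_nat_le_iff)
    then show ?thesis by (simp add: power2_eq_square)
  qed
  have PE: "prob (E n x) \<le> 2 * exp (- 2 * (2 * ln (real n)))" if "x \<in> X n" "n \<ge> 3" for n x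
  proof -
    obtain i j where x: "x = (i, j)" by force
    have ij: "i \<le> j" "j \<le> n" using that by (auto simp: X_def x)
    have "real n * (real j / real n - real i / real n) = real (j - i)"
      using that ij by (simp add: field_simps of_nat_diff)
    then show ?thesis
      using pcount_Bernstein[of "{..<n}" "real i / real n" "real j / real n" "2 * ln (real n)"] that ij
      by (simp add: E_def x divide_right_mono)
  qed
  have "AE \<omega> in M. \<forall>\<^sub>F n in sequentially. \<forall>x\<in>X n. \<omega> \<notin> E n x"
  proof (rule AE_eventually_finite_union[OF fin])
    show "E n x \<in> events" for n x unfolding E_def by (cases x) simp
    show "\<forall>\<^sub>F n in sequentially. (\<Sum>x\<in>X n. prob (E n x)) \<le> 8 * inverse (real n ^ 2)"
      using eventually_ge_at_top[of 3]
    proof eventually_elim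
      case (elim n)
      have "(\<Sum>x\<in>X n. prob (E n x)) \<le> real (card (X n)) * (2 * exp (- 2 * (2 * ln (real n))))"
        using PE elim by (intro sum_bounded_above) auto
      also have "exp (- 2 * (2 * ln (real n))) = inverse (real n ^ 4)"
      proof -
        have "- 2 * (2 * ln (real n)) = - (real 4 * ln (real n))" by simp
        also have "exp \<dots> = inverse (real n ^ 4)"
          using elim unfolding exp_minus exp_of_nat_mult by simp
        finally show ?thesis .
      qed
      also have "real (card (X n)) * (2 * inverse (real n ^ 4)) \<le> (4 * real n ^ 2) * (2 * inverse (real n ^ 4))"
        using cX[of n] elim by (intro mult_right_mono) auto
      also have "\<dots> = 8 * inverse (real n ^ 2)" using elim by (simp add: field_simps power2_eq_square power4_eq_xxxx)
      finally show ?case .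
    qed
    show "summable (\<lambda>n. 8 * inverse (real n ^ 2))"
      by (intro summable_mult inverse_power_summable) auto
  qed
  then show ?thesis using AE_space
  proof eventually_elim
    case (elim \<omega>)
    from elim(1) eventually_ge_at_top[of 3] show ?case
    proof eventually_elim
      case (elim n)
      note bad = elim
      have "exp 1 \<le> real n" using bad exp_le by linarith
      then have l: "ln (real n) \<ge> 1" using bad by (subst ln_ge_iff) auto
      have grid: "\<bar>pcount (\<lambda>i. U i \<omega>) {..<n} (real i / real n) (real j / real n) - real (j - i)\<bar>
          \<le> 3 * (sqrt (2 * ln (real n) * real (j - i)) + 2 * ln (real n))" if "i \<le> j" "j \<le> n" for i j
        using bad(1) that \<open>\<omega> \<in> space M\<close> unfolding X_def E_def by force
      show ?case using oscillation_from_grid[OF l _ grid] bad by auto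
    qed
  qed
qed

text \<open>Windows of length 2 \<sigma> starting at the multiples of \<sigma> contain every
  interval of length at most \<sigma>. Since 1 / \<sigma> = n^(17/16) <= n^2, indices up to n^2 are
  enough; the windows are clipped at 1 to stay in the range of the uniform law.\<close>

lemma AE_no_clumps:
  "AE \<omega> in M. \<forall>\<^sub>F n in sequentially. \<forall>s t. 0 \<le> s \<longrightarrow> s \<le> t \<longrightarrow> t \<le> 1 \<longrightarrow> t - s \<le> real n powr (-17/16) \<longrightarrow>
     pcount (\<lambda>i. U i \<omega>) {..<n} s t < 64"
proof -
  define \<sigma> where "\<sigma> n = real n powr (-17/16)" for n :: nat
  define s0 where "s0 n i = min 1 (real i * \<sigma> n)" for n i :: nat
  define t0 where "t0 n i = min 1 ((real i + 2) * \<sigma> n)" for n i :: nat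
  define E where "E n i = {\<omega> \<in> space M. pcount (\<lambda>i. U i \<omega>) {..<n} (s0 n i) (t0 n i) \<ge> 64}" for n i :: nat
  have \<sigma>: "\<sigma> n \<ge> 0" for n by (simp add: \<sigma>_def)
  have st0: "0 \<le> s0 n i" "s0 n i \<le> t0 n i" "t0 n i \<le> 1" "t0 n i - s0 n i \<le> 2 * \<sigma> n" for n i
    using \<sigma>[of n] by (auto simp: s0_def t0_def algebra_simps min_def)
  have PE: "prob (E n i) \<le> exp 2 * inverse (real n ^ 4)" if "n \<ge> 3" for n i
  proof -
    \<comment> \<open>A window has mean count at most 2 n^(-1/16), so exp \<theta> = n^(1/16) keeps
      the first part of the exponent below 2, while 64 \<theta> = 4 ln n gives the decay n^(-4) that
      pays for n^2 windows.\<close>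
    define \<theta> where "\<theta> = ln (real n) / 16"
    have \<theta>: "\<theta> > 0" using that by (simp add: \<theta>_def)
    have e\<theta>: "exp \<theta> = real n powr (1/16)" using that by (simp add: \<theta>_def powr_def)
    have "prob (E n i) \<le> exp (real n * (t0 n i - s0 n i) * (exp \<theta> - 1) - \<theta> * 64)"
      unfolding E_def using pcount_Chernoff(1)[OF finite_lessThan[of n] st0(1-3)[of n i] \<theta>, of 64] by simp
    also have "real n * (t0 n i - s0 n i) * (exp \<theta> - 1) \<le> real n * (2 * \<sigma> n) * exp \<theta>"
      using st0[of n i] \<theta> \<sigma>[of n] by (intro mult_mono) auto
    also have "\<dots> = 2 * (real n powr 1 * real n powr (-17/16) * real n powr (1/16))"
      using that by (simp add: e\<theta> \<sigma>_def)
    also have "\<dots> = 2" using that by (simp only: powr_add[symmetric]) simp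
    finally have "prob (E n i) \<le> exp (2 - \<theta> * 64)" by simp
    also have "\<theta> * 64 = real 4 * ln (real n)" by (simp add: \<theta>_def)
    also have "exp (2 - real 4 * ln (real n)) = exp 2 * inverse (real n ^ 4)"
      using that unfolding exp_diff exp_of_nat_mult by (simp add: divide_inverse)
    finally show ?thesis .
  qed
  have "AE \<omega> in M. \<forall>\<^sub>F n in sequentially. \<forall>i\<in>{..n^2}. \<omega> \<notin> E n i"
  proof (rule AE_eventually_finite_union)
    show "E n i \<in> events" for n i unfolding E_def by simp
    show "\<forall>\<^sub>F n in sequentially. (\<Sum>i\<in>{..n^2}. prob (E n i)) \<le> 2 * exp 2 * inverse (real n ^ 2)"
      using eventually_ge_at_top[of 3]
    proof eventually_elim
      case (elim n)
      have "(\<Sum>i\<in>{..n^2}. prob (E n i)) \<le> real (card {..n^2}) * (exp 2 * inverse (real n ^ 4))"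
        using PE elim by (intro sum_bounded_above) auto
      also have "\<dots> \<le> (2 * real n ^ 2) * (exp 2 * inverse (real n ^ 4))"
        using elim one_le_power[of "real n" 2] by (intro mult_right_mono) auto
      also have "\<dots> = 2 * exp 2 * inverse (real n ^ 2)" using elim by (simp add: field_simps power2_eq_square power4_eq_xxxx)
      finally show ?case .
    qed
    show "summable (\<lambda>n. 2 * exp 2 * inverse (real n ^ 2) :: real)"
      by (intro summable_mult inverse_power_summable) auto
  qed auto
  then show ?thesis using AE_space
  proof eventually_elim
    case (elim \<omega>)
    from elim(1) eventually_ge_at_top[of 3] show ?case
    proof eventually_elim
      case (elim n)
      note good = elim
      have \<sigma>0: "\<sigma> n > 0" using good by (simp add: \<sigma>_def)
      show ?case
      proof (intro allI impI)
        fix s t :: real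
        assume st: "0 \<le> s" "s \<le> t" "t \<le> 1" "t - s \<le> real n powr (-17/16)"
        define i where "i = nat \<lfloor>s / \<sigma> n\<rfloor>"
        have i: "real i \<le> s / \<sigma> n" "s / \<sigma> n < real i + 1" using st \<sigma>0 by (auto simp: i_def)
        have "s / \<sigma> n \<le> 1 / \<sigma> n" using st \<sigma>0 by (intro divide_right_mono) auto
        also have "\<dots> = real n powr (17/16)" unfolding \<sigma>_def using powr_minus_divide[of "real n" "-17/16"] by simp
        also have "\<dots> \<le> real n powr 2" using good by (intro powr_mono) auto
        also have "\<dots> = real (n ^ 2)" using good by (simp add: powr_realpow)
        finally have "real i \<le> real (n ^ 2)" using i by linarith
        then have "i \<le> n ^ 2" by (simp only: of_nat_le_iff)
        then have "pcount (\<lambda>i. U i \<omega>) {..<n} (s0 n i) (t0 n i) < 64"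
          using good \<open>\<omega> \<in> space M\<close> by (auto simp: E_def not_le)
        moreover have "pcount (\<lambda>i. U i \<omega>) {..<n} s t \<le> pcount (\<lambda>i. U i \<omega>) {..<n} (s0 n i) (t0 n i)"
        proof (rule pcount_mono)
          have a: "real i * \<sigma> n \<le> s" "s < (real i + 1) * \<sigma> n" using i \<sigma>0 by (auto simp: field_simps)
          show "s0 n i \<le> s" using a by (simp add: s0_def)
          show "t \<le> t0 n i" using a st by (simp add: t0_def \<sigma>_def algebra_simps)
        qed
        ultimately show "pcount (\<lambda>i. U i \<omega>) {..<n} s t < 64" by linarith
      qed
    qed
  qed
qed

end

section \<open>The iterated-logarithm bound on the discrepancy, by chaining over dyadic
  rectangles\<close>

lemma geometric_series_weighted_bound:
  fixes r :: real
  assumes "0 \<le> r" "r < 1"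
  shows "(\<Sum>l\<le>k. (1 + real (k - l)) * r ^ (k - l)) \<le> 1 / (1 - r)\<^sup>2"
proof -
  have "(\<Sum>l\<le>k. (1 + real (k - l)) * r ^ (k - l)) = (\<Sum>a\<le>k. (1 + real a) * r ^ a)"
    by (rule sum.reindex_bij_witness[of _ "\<lambda>a. k - a" "\<lambda>a. k - a"]) auto
  also have "\<dots> = (\<Sum>a<Suc k. of_nat (Suc a) * r ^ a)"
    by (intro sum.cong) auto
  also have "\<dots> \<le> 1 / (1 - r)\<^sup>2"
  proof -
    have sums: "(\<lambda>a. of_nat (Suc a) * r ^ a) sums (1 / (1 - r)\<^sup>2)"
      using geometric_deriv_sums[of r] assms by simp
    show ?thesis unfolding sums_unique[OF sums]
      using assms by (intro sum_le_suminf sums_summable[OF sums]) auto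
  qed
  finally show ?thesis .
qed

context
  fixes V :: "nat \<Rightarrow> real" and k :: nat and B :: "nat \<Rightarrow> nat \<Rightarrow> real"
  assumes B: "\<And>l j. B l j \<ge> 0"
    and rect: "\<And>l c j d. l \<le> k \<Longrightarrow> c < 2 ^ (k - l) \<Longrightarrow> j \<le> k \<Longrightarrow> d < 2 ^ (k - j) \<Longrightarrow>
      \<bar>pcount V {c * 2 ^ l..<(c + 1) * 2 ^ l} (real (d * 2 ^ j) / 2 ^ k) (real ((d + 1) * 2 ^ j) / 2 ^ k)
        - 2 ^ l * 2 ^ j / 2 ^ k\<bar> \<le> B l j"
begin

text \<open>Chaining is applied twice: first in the sample size with the endpoint fixed, which
  leaves counts over a dyadic block of indices, and then in the endpoint for each such
  block.\<close>

lemma chaining_dyadic_point: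
  assumes n: "n \<le> 2 ^ k" and i: "i \<le> 2 ^ k"
  shows "\<bar>pcount V {..<n} 0 (real i / 2 ^ k) - real n * (real i / 2 ^ k)\<bar> \<le> (\<Sum>l\<le>k. \<Sum>j\<le>k. B l j)"
proof -
  define f where "f n = pcount V {..<n} 0 (real i / 2 ^ k) - real n * (real i / 2 ^ k)" for n
  have "\<bar>f n - f 0\<bar> \<le> (\<Sum>l\<le>k. \<Sum>j\<le>k. B l j)"
  proof (rule dyadic_chaining[OF _ _ n])
    fix l c :: nat assume lc: "l \<le> k" "c < 2 ^ (k - l)"
    let ?I = "{c * 2 ^ l..<(c + 1) * 2 ^ l}"
    define g where "g i = pcount V ?I 0 (real i / 2 ^ k) - 2 ^ l * (real i / 2 ^ k)" for i
    have "{..<(c + 1) * 2 ^ l} = {..<c * 2 ^ l} \<union> ?I" by auto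
    moreover have disj: "{..<c * 2 ^ l} \<inter> ?I = {}" by auto
    ultimately have "pcount V {..<(c + 1) * 2 ^ l} 0 (real i / 2 ^ k)
        = pcount V {..<c * 2 ^ l} 0 (real i / 2 ^ k) + pcount V ?I 0 (real i / 2 ^ k)"
      using pcount_union[of "{..<c * 2 ^ l}" ?I V] by (metis disj finite_atLeastLessThan finite_lessThan)
    then have "f ((c + 1) * 2 ^ l) - f (c * 2 ^ l) = g i"
      unfolding f_def g_def by (simp add: algebra_simps add_divide_distrib)
    also have "\<bar>g i - g 0\<bar> \<le> (\<Sum>j\<le>k. B l j)"
    proof (rule dyadic_chaining[OF _ _ i])
      fix j d :: nat assume jd: "j \<le> k" "d < 2 ^ (k - j)"
      have "pcount V ?I 0 (real ((d + 1) * 2 ^ j) / 2 ^ k) = pcount V ?I 0 (real (d * 2 ^ j) / 2 ^ k)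
         + pcount V ?I (real (d * 2 ^ j) / 2 ^ k) (real ((d + 1) * 2 ^ j) / 2 ^ k)"
        by (intro pcount_split divide_right_mono) auto
      then have "g ((d + 1) * 2 ^ j) - g (d * 2 ^ j)
        = pcount V ?I (real (d * 2 ^ j) / 2 ^ k) (real ((d + 1) * 2 ^ j) / 2 ^ k) - 2 ^ l * 2 ^ j / 2 ^ k"
        unfolding g_def by (simp add: algebra_simps add_divide_distrib)
      then show "\<bar>g ((d + 1) * 2 ^ j) - g (d * 2 ^ j)\<bar> \<le> B l j"
        using rect[OF lc jd] by simp
    qed (rule B)
    moreover have "g 0 = 0" by (simp add: g_def pcount_def)
    ultimately show "\<bar>f ((c + 1) * 2 ^ l) - f (c * 2 ^ l)\<bar> \<le> (\<Sum>j\<le>k. B l j)"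
      using \<open>f ((c + 1) * 2 ^ l) - f (c * 2 ^ l) = g i\<close> by simp
  qed (simp add: B sum_nonneg)
  moreover have "f 0 = 0" by (simp add: f_def pcount_def)
  ultimately show ?thesis by (simp add: f_def)
qed

text \<open>Rounding x down or up to a multiple of 2^(-k) changes n x by at most 1, because n <=
  2^k; monotonicity of the count does the rest.\<close>

lemma chaining_point:
  assumes n: "n \<le> 2 ^ k" and x: "0 \<le> x" "x \<le> 1"
  shows "\<bar>pcount V {..<n} 0 x - real n * x\<bar> \<le> (\<Sum>l\<le>k. \<Sum>j\<le>k. B l j) + 1"
proof -
  define S where "S = (\<Sum>l\<le>k. \<Sum>j\<le>k. B l j)"
  define i j where "i = nat \<lfloor>2 ^ k * x\<rfloor>" and "j = nat \<lceil>2 ^ k * x\<rceil>"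
  have i: "real i \<le> 2 ^ k * x" "2 ^ k * x < real i + 1" using x by (auto simp: i_def)
  have "0 \<le> 2 ^ k * x" using x by simp
  then have j: "2 ^ k * x \<le> real j" "real j < 2 ^ k * x + 1" unfolding j_def by linarith+
  have le: "2 ^ k * x \<le> 2 ^ k" using x by simp
  have "real i \<le> 2 ^ k" "real j < 2 ^ k + 1" using i j le by linarith+
  then have ij: "i \<le> 2 ^ k" "j \<le> 2 ^ k"
    by (metis of_nat_le_iff of_nat_numeral of_nat_power,
        metis Suc_eq_plus1 less_Suc_eq_le of_nat_less_iff of_nat_Suc of_nat_numeral of_nat_power add.commute)
  have i': "real i / 2 ^ k \<le> x" "x \<le> real i / 2 ^ k + 1 / 2 ^ k" using i by (auto simp: field_simps)
  have j': "x \<le> real j / 2 ^ k" "real j / 2 ^ k \<le> x + 1 / 2 ^ k" using j by (auto simp: field_simps)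
  have "real n \<le> real (2 ^ k)" using n by (simp only: of_nat_le_iff)
  then have n1: "real n * (1 / 2 ^ k) \<le> 1" by simp
  have "pcount V {..<n} 0 x \<le> pcount V {..<n} 0 (real j / 2 ^ k)" using j' by (intro pcount_mono) auto
  also have "\<dots> \<le> real n * (real j / 2 ^ k) + S"
    using chaining_dyadic_point[OF n ij(2)] unfolding S_def by linarith
  also have "real n * (real j / 2 ^ k) \<le> real n * (x + 1 / 2 ^ k)" using j' by (intro mult_left_mono) auto
  finally have 1: "pcount V {..<n} 0 x \<le> real n * x + S + 1" using n1 unfolding distrib_left by linarith
  have "real n * (x - 1 / 2 ^ k) \<le> real n * (real i / 2 ^ k)" using i' by (intro mult_left_mono) auto
  also have "\<dots> \<le> pcount V {..<n} 0 (real i / 2 ^ k) + S"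
    using chaining_dyadic_point[OF n ij(1)] unfolding S_def by linarith
  also have "pcount V {..<n} 0 (real i / 2 ^ k) \<le> pcount V {..<n} 0 x" using i' by (intro pcount_mono) auto
  finally have 2: "real n * x - S - 1 \<le> pcount V {..<n} 0 x" using n1 unfolding right_diff_distrib by linarith
  show ?thesis using 1 2 unfolding S_def by linarith
qed

end

text \<open>The weight of a dyadic rectangle \<open>2^l\<close> times \<open>2^(j-k)\<close> is the exponent in its tail bound: the term
  \<open>ln k\<close> makes the failure probabilities summable in \<open>k\<close>, and the two depths pay for the number
  \<open>2^(k-l) * 2^(k-j)\<close> of such rectangles.\<close>

definition chain_weight :: "nat \<Rightarrow> nat \<Rightarrow> nat \<Rightarrow> real" where
  "chain_weight k l j = ln (real k) + real (k - l) + real (k - j)"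

definition chain_bound :: "nat \<Rightarrow> nat \<Rightarrow> nat \<Rightarrow> real" where
  "chain_bound k l j = 3 * (sqrt (chain_weight k l j * (2 ^ l * 2 ^ j / 2 ^ k)) + chain_weight k l j)"

text \<open>The Gaussian parts decay geometrically in both depths k - l and k - j, so the double sum
  is a constant times its coarsest term sqrt(2^k ln k). The Poisson parts total at most 9 k (k +
  1)^2, which 2^(k/2) absorbs.\<close>

lemma chain_bound_sum:
  "\<exists>C. \<forall>\<^sub>F k in sequentially. (\<Sum>l\<le>k. \<Sum>j\<le>k. chain_bound k l j) + 1 \<le> C * sqrt (2 ^ k * ln (real k))"
proof -
  define r :: real where "r = sqrt (1/2)"
  have r: "0 \<le> r" "r < 1" by (auto simp: r_def)
  define H where "H = 1 / (1 - r)\<^sup>2"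
  have H: "H \<ge> 0" by (simp add: H_def)
  have ev: "\<forall>\<^sub>F k in sequentially. 9 * real k * (real k + 1)\<^sup>2 + 1 \<le> 2 powr (real k / 2)"
    by real_asymp
  have "\<forall>\<^sub>F k in sequentially. (\<Sum>l\<le>k. \<Sum>j\<le>k. chain_bound k l j) + 1 \<le> (3 * H\<^sup>2 + 1) * sqrt (2 ^ k * ln (real k))"
    using ev eventually_ge_at_top[of 3]
  proof eventually_elim
    case (elim k)
    have "exp 1 \<le> real k" using elim exp_le by linarith
    then have lk: "ln (real k) \<ge> 1" using elim by (subst ln_ge_iff) auto
    define sq where "sq = sqrt (2 ^ k * ln (real k))"
    define w where "w l = (1 + real (k - l)) * r ^ (k - l)" for l
    have w0: "w l \<ge> 0" for l using r by (simp add: w_def)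
    have w: "(\<Sum>l\<le>k. w l) \<le> H" unfolding w_def H_def using r by (intro geometric_series_weighted_bound) auto
    have "chain_bound k l j \<le> 3 * sq * (w l * w j) + 9 * real k" if "l \<le> k" "j \<le> k" for l j
    proof -
      define a b where "a = real (k - l)" and "b = real (k - j)"
      have ab: "a \<ge> 0" "b \<ge> 0" by (auto simp: a_def b_def)
      have pw: "2 ^ l * 2 ^ j / 2 ^ k = 2 ^ k * (r ^ (k - l) * r ^ (k - j))\<^sup>2"
      proof -
        have "(r ^ (k - l) * r ^ (k - j))\<^sup>2 = (1/2) ^ (k - l) * (1/2) ^ (k - j)"
          by (simp add: r_def power_mult_distrib power_mult[symmetric] real_sqrt_power[symmetric] mult.commute[of _ 2])
             (simp add: power_mult real_sqrt_power)
        moreover have "(2::real) ^ l = 2 ^ k * (1/2) ^ (k - l)" "(2::real) ^ j = 2 ^ k * (1/2) ^ (k - j)"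
          using that by (simp_all add: power_diff power_one_over)
        ultimately show ?thesis by simp
      qed
      \<comment> \<open>Bounding the sum of the three weights by a product with squared factors lets
        the square root separate into a function of l times a function of j.\<close>
      have "ln (real k) + a + b \<le> ln (real k) * ((1 + a) * (1 + b))\<^sup>2"
      proof -
        have "1 + a + b \<le> (1 + a) * (1 + b)" using ab by (simp add: algebra_simps)
        also have "\<dots> \<le> ((1 + a) * (1 + b))\<^sup>2" using ab by (intro self_le_power mult_ge1_I) auto
        finally have "ln (real k) * (1 + a + b) \<le> ln (real k) * ((1 + a) * (1 + b))\<^sup>2" using lk by (intro mult_left_mono) auto
        moreover have "1 * (a + b) \<le> ln (real k) * (a + b)" using ab lk by (intro mult_right_mono) auto
        ultimately show ?thesis by (simp add: algebra_simps)
      qed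
      then have "sqrt (chain_weight k l j * (2 ^ l * 2 ^ j / 2 ^ k))
          \<le> sqrt (ln (real k) * ((1 + a) * (1 + b))\<^sup>2 * (2 ^ k * (r ^ (k - l) * r ^ (k - j))\<^sup>2))"
        unfolding pw by (intro real_sqrt_le_mono mult_right_mono) (auto simp: chain_weight_def a_def b_def)
      also have "\<dots> = sqrt ((2 ^ k * ln (real k)) * (w l * w j)\<^sup>2)"
        by (intro arg_cong[of _ _ sqrt]) (simp add: w_def a_def b_def power_mult_distrib)
      also have "\<dots> = sq * (w l * w j)" using w0 by (simp add: real_sqrt_mult sq_def)
      finally have 1: "sqrt (chain_weight k l j * (2 ^ l * 2 ^ j / 2 ^ k)) \<le> sq * (w l * w j)" .
      have "ln (real k) \<le> real k" using elim ln_less_self[of "real k"] by linarith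
      then have "chain_weight k l j \<le> 3 * real k" unfolding chain_weight_def using that by simp
      with 1 show ?thesis by (simp add: chain_bound_def)
    qed
    then have "(\<Sum>l\<le>k. \<Sum>j\<le>k. chain_bound k l j) \<le> (\<Sum>l\<le>k. \<Sum>j\<le>k. 3 * sq * (w l * w j) + 9 * real k)"
      by (intro sum_mono) auto
    also have "\<dots> = 3 * sq * ((\<Sum>l\<le>k. w l) * (\<Sum>j\<le>k. w j)) + 9 * real k * (real k + 1)\<^sup>2"
      by (simp add: sum.distrib sum_product sum_distrib_left power2_eq_square algebra_simps)
    also have "(\<Sum>l\<le>k. w l) * (\<Sum>j\<le>k. w j) \<le> H * H"
      using w w0 H by (intro mult_mono) (auto intro: sum_nonneg)
    finally have "(\<Sum>l\<le>k. \<Sum>j\<le>k. chain_bound k l j) + 1 \<le> 3 * sq * (H * H) + (9 * real k * (real k + 1)\<^sup>2 + 1)"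
      using lk by (simp add: sq_def mult_left_mono)
    also have "\<dots> \<le> 3 * sq * (H * H) + sq"
    proof -
      have "2 powr (real k / 2) = sqrt (2 ^ k)" by (simp add: powr_half_sqrt[symmetric] powr_realpow[symmetric] powr_powr)
      also have "\<dots> \<le> sq" unfolding sq_def using lk by simp
      finally show ?thesis using elim by linarith
    qed
    finally show ?case by (simp add: sq_def power2_eq_square algebra_simps)
  qed
  then show ?thesis by blast
qed

context iid_uniform
begin

text \<open>Chaining in time as well as in space replaces a maximal inequality over the sample sizes
  \<open>n \<le> 2^k\<close>.\<close>

lemma AE_dyadic_discrepancy:
  "\<exists>C. AE \<omega> in M. \<forall>\<^sub>F k in sequentially. \<forall>n\<le>2 ^ k. \<forall>x\<in>{0..1}.
     \<bar>pcount (\<lambda>i. U i \<omega>) {..<n} 0 x - real n * x\<bar> \<le> C * sqrt (2 ^ k * ln (real k))"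
proof -
  obtain C where C: "\<forall>\<^sub>F k in sequentially. (\<Sum>l\<le>k. \<Sum>j\<le>k. chain_bound k l j) + 1 \<le> C * sqrt (2 ^ k * ln (real k))"
    using chain_bound_sum by blast
  define X where "X k = (SIGMA p:{..k}\<times>{..k}. {..<(2::nat) ^ (k - fst p)} \<times> {..<(2::nat) ^ (k - snd p)})" for k :: nat
  define E where "E k x = (case x of ((l, j), (c, d)) \<Rightarrow> {\<omega> \<in> space M.
     \<bar>pcount (\<lambda>i. U i \<omega>) {c * 2 ^ l..<(c + 1) * 2 ^ l} (real (d * 2 ^ j) / 2 ^ k) (real ((d + 1) * 2 ^ j) / 2 ^ k)
        - 2 ^ l * 2 ^ j / 2 ^ k\<bar> \<ge> chain_bound k l j})" for k :: nat and x
  have PE: "prob (E k ((l, j), (c, d))) \<le> 2 * inverse (real k ^ 2) * ((1/4) ^ (k - l) * (1/4) ^ (k - j))"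
    if "k \<ge> 3" "l \<le> k" "j \<le> k" "d < 2 ^ (k - j)" for k l j c d
  proof -
    have "exp 1 \<le> real k" using that exp_le by linarith
    then have lk: "ln (real k) \<ge> 1" using that by (subst ln_ge_iff) auto
    have y: "chain_weight k l j > 0" using lk by (simp add: chain_weight_def add_pos_nonneg)
    have "(d + 1) * 2 ^ j \<le> 2 ^ (k - j) * 2 ^ j" using that by (intro mult_right_mono) auto
    also have "\<dots> = 2 ^ k" using that by (simp add: power_add[symmetric])
    finally have "real ((d + 1) * 2 ^ j) \<le> real (2 ^ k)" by (simp only: of_nat_le_iff)
    then have d1: "real ((d + 1) * 2 ^ j) / 2 ^ k \<le> 1" by simp
    have len: "real ((d + 1) * 2 ^ j) / 2 ^ k - real (d * 2 ^ j) / 2 ^ k = 2 ^ j / 2 ^ k"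
      by (simp add: algebra_simps add_divide_distrib)
    have "prob (E k ((l, j), (c, d))) \<le> 2 * exp (- 2 * chain_weight k l j)"
      using pcount_Bernstein[of "{c * 2 ^ l..<(c + 1) * 2 ^ l}" "real (d * 2 ^ j) / 2 ^ k"
          "real ((d + 1) * 2 ^ j) / 2 ^ k" "chain_weight k l j"] d1 y
      unfolding len by (simp add: E_def chain_bound_def divide_right_mono)
    also have "exp (- 2 * chain_weight k l j) = inverse (exp (real 2 * ln (real k))) * (exp (-2) ^ (k - l) * exp (-2) ^ (k - j))"
      by (simp add: chain_weight_def exp_minus[symmetric] exp_add[symmetric] exp_of_nat_mult[symmetric] algebra_simps)
    also have "exp (real 2 * ln (real k)) = real k ^ 2"
      using that unfolding exp_of_nat_mult by simp
    \<comment> \<open>Each exp (-2) is at most 1/4; against the 2^(k-l) * 2^(k-j) rectangles this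
      still leaves a factor 1/2 per level.\<close>
    also have "inverse (real k ^ 2) * (exp (-2) ^ (k - l) * exp (-2) ^ (k - j))
         \<le> inverse (real k ^ 2) * ((1/4) ^ (k - l) * (1/4) ^ (k - j))"
    proof -
      have "(2::real) ^ 2 \<le> exp 1 ^ 2" using exp_ge_add_one_self[of "1::real"] by (intro power_mono) auto
      then have "(4::real) \<le> exp 2" by (simp add: exp_of_nat_mult[symmetric])
      then have "exp (-2) \<le> (1/4::real)" by (simp add: exp_minus field_simps)
      then show ?thesis by (intro mult_left_mono mult_mono power_mono) auto
    qed
    finally show ?thesis by simp
  qed
  have "AE \<omega> in M. \<forall>\<^sub>F k in sequentially. \<forall>x\<in>X k. \<omega> \<notin> E k x"
  proof (rule AE_eventually_finite_union)
    show "finite (X k)" for k unfolding X_def by auto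
    show "E k x \<in> events" for k x unfolding E_def by (auto split: prod.splits)
    show "\<forall>\<^sub>F k in sequentially. (\<Sum>x\<in>X k. prob (E k x)) \<le> 8 * inverse (real k ^ 2)"
      using eventually_ge_at_top[of 3]
    proof eventually_elim
      case (elim k)
      have geo: "(\<Sum>l\<le>k. (1/2::real) ^ (k - l)) \<le> 2"
      proof -
        have "(\<Sum>l\<le>k. (1/2::real) ^ (k - l)) = (\<Sum>a<Suc k. (1/2) ^ a)"
          by (rule sum.reindex_bij_witness[of _ "\<lambda>a. k - a" "\<lambda>a. k - a"]) auto
        also have "\<dots> \<le> 2" by (subst geometric_sum) (auto simp: field_simps)
        finally show ?thesis .
      qed
      have rows: "(\<Sum>y\<in>{..<(2::nat) ^ (k - l)} \<times> {..<(2::nat) ^ (k - j)}. prob (E k ((l, j), y)))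
           \<le> 2 * inverse (real k ^ 2) * ((1/2) ^ (k - l) * (1/2) ^ (k - j))" if lj: "l \<le> k" "j \<le> k" for l j
      proof -
        have "(\<Sum>y\<in>{..<(2::nat) ^ (k - l)} \<times> {..<(2::nat) ^ (k - j)}. prob (E k ((l, j), y)))
          \<le> real (card ({..<(2::nat) ^ (k - l)} \<times> {..<(2::nat) ^ (k - j)})) * (2 * inverse (real k ^ 2) * ((1/4) ^ (k - l) * (1/4) ^ (k - j)))"
          using PE[OF elim, of l j] lj by (intro sum_bounded_above) auto
        also have "\<dots> = 2 * inverse (real k ^ 2) * ((2 ^ (k - l) * (1/4) ^ (k - l)) * (2 ^ (k - j) * (1/4) ^ (k - j)))"
          by (simp add: card_cartesian_product)
        also have "\<dots> = 2 * inverse (real k ^ 2) * ((1/2) ^ (k - l) * (1/2) ^ (k - j))"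
          unfolding power_mult_distrib[symmetric] by simp
        finally show ?thesis .
      qed
      have "(\<Sum>x\<in>X k. prob (E k x)) = (\<Sum>(p, y)\<in>X k. prob (E k (p, y)))"
        by (simp add: case_prod_unfold)
      also have "\<dots> = (\<Sum>p\<in>{..k}\<times>{..k}. \<Sum>y\<in>{..<(2::nat) ^ (k - fst p)} \<times> {..<(2::nat) ^ (k - snd p)}. prob (E k (p, y)))"
        unfolding X_def by (subst sum.Sigma[symmetric]) auto
      also have "\<dots> \<le> (\<Sum>p\<in>{..k}\<times>{..k}. 2 * inverse (real k ^ 2) * ((1/2) ^ (k - fst p) * (1/2) ^ (k - snd p)))"
      proof (rule sum_mono)
        fix p assume "p \<in> {..k}\<times>{..k}"
        then show "(\<Sum>y\<in>{..<(2::nat) ^ (k - fst p)} \<times> {..<(2::nat) ^ (k - snd p)}. prob (E k (p, y)))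
            \<le> 2 * inverse (real k ^ 2) * ((1/2) ^ (k - fst p) * (1/2) ^ (k - snd p))"
          using rows[of "fst p" "snd p"] by (cases p) (simp only: fst_conv snd_conv mem_Times_iff atMost_iff)
      qed
      also have "\<dots> = 2 * inverse (real k ^ 2) * ((\<Sum>l\<le>k. (1/2) ^ (k - l)) * (\<Sum>j\<le>k. (1/2) ^ (k - j)))"
        unfolding sum_product sum.cartesian_product by (simp only: case_prod_unfold sum_distrib_left)
      also have "\<dots> \<le> 2 * inverse (real k ^ 2) * (2 * 2)"
        using geo by (intro mult_left_mono mult_mono) (auto intro: sum_nonneg)
      finally show ?case by simp
    qed
    show "summable (\<lambda>n. 8 * inverse (real n ^ 2))"
      by (intro summable_mult inverse_power_summable) auto
  qed
  then have "AE \<omega> in M. \<forall>\<^sub>F k in sequentially. \<forall>n\<le>2 ^ k. \<forall>x\<in>{0..1}.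
     \<bar>pcount (\<lambda>i. U i \<omega>) {..<n} 0 x - real n * x\<bar> \<le> C * sqrt (2 ^ k * ln (real k))"
    using AE_space
  proof eventually_elim
    case (elim \<omega>)
    from elim(1) C eventually_ge_at_top[of 3] show ?case
    proof eventually_elim
      case (elim k)
      note good = elim
      have B: "chain_bound k l j \<ge> 0" for l j
        using good by (simp add: chain_bound_def chain_weight_def)
      have rect: "\<bar>pcount (\<lambda>i. U i \<omega>) {c * 2 ^ l..<(c + 1) * 2 ^ l} (real (d * 2 ^ j) / 2 ^ k) (real ((d + 1) * 2 ^ j) / 2 ^ k)
        - 2 ^ l * 2 ^ j / 2 ^ k\<bar> \<le> chain_bound k l j"
        if "l \<le> k" "c < 2 ^ (k - l)" "j \<le> k" "d < 2 ^ (k - j)" for l c j d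
      proof -
        have "((l, j), (c, d)) \<in> X k" using that by (simp add: X_def)
        then have "\<omega> \<notin> E k ((l, j), (c, d))" using good by blast
        then show ?thesis using \<open>\<omega> \<in> space M\<close> by (simp add: E_def)
      qed
      show ?case
        using chaining_point[OF B rect] good by fastforce
    qed
  qed
  then show ?thesis by blast
qed

text \<open>For 2^k <= n < 2^(k+1) the dyadic bound is used at k + 1. This costs only constants:
  2^(k+1) <= 2 n, and k + 1 <= (ln n)^2 gives ln (k + 1) <= 2 ln ln n. Replacing C by |C| + 1 makes
  the constant positive.\<close>

lemma AE_discrepancy:
  "\<exists>C>0. AE \<omega> in M. \<forall>\<^sub>F n in sequentially. \<forall>x\<in>{0..1}.
     \<bar>pcount (\<lambda>i. U i \<omega>) {..<n} 0 x - real n * x\<bar> \<le> C * sqrt (real n * ln (ln (real n)))"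
proof -
  obtain C where C: "AE \<omega> in M. \<forall>\<^sub>F k in sequentially. \<forall>n\<le>2 ^ k. \<forall>x\<in>{0..1}.
     \<bar>pcount (\<lambda>i. U i \<omega>) {..<n} 0 x - real n * x\<bar> \<le> C * sqrt (2 ^ k * ln (real k))"
    using AE_dyadic_discrepancy by blast
  define C' where "C' = 2 * (\<bar>C\<bar> + 1)"
  have lnln: "ln (real (Suc k)) \<le> 2 * ln (ln (real n))" if "2 ^ k \<le> n" "ln (real n) \<ge> 3" for k n
  proof -
    have "(2::real) / 3 \<le> ln 2" by (rule ln2_ge_two_thirds)
    then have "real k * (2 / 3) \<le> real k * ln 2" by (intro mult_left_mono) auto
    also have "\<dots> = ln (real (2 ^ k))" by (simp add: ln_realpow)
    also have "\<dots> \<le> ln (real n)" using that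
      by (metis ln_le_cancel_iff of_nat_0_less_iff of_nat_le_iff order_less_le_trans zero_less_numeral zero_less_power)
    finally have "real (Suc k) \<le> 3/2 * ln (real n) + 1" by simp
    also have "\<dots> \<le> 3 * ln (real n)" using that by simp
    also have "\<dots> \<le> ln (real n) * ln (real n)" using that by (intro mult_right_mono) auto
    finally have "ln (real (Suc k)) \<le> ln (ln (real n) * ln (real n))" using that by (subst ln_le_cancel_iff) auto
    also have "\<dots> = 2 * ln (ln (real n))" using that by (subst ln_mult) auto
    finally show ?thesis .
  qed
  have ev3: "\<forall>\<^sub>F n in sequentially. ln (real n) \<ge> 3" by real_asymp
  from C have "AE \<omega> in M. \<forall>\<^sub>F n in sequentially. \<forall>x\<in>{0..1}.
     \<bar>pcount (\<lambda>i. U i \<omega>) {..<n} 0 x - real n * x\<bar> \<le> C' * sqrt (real n * ln (ln (real n)))"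
  proof eventually_elim
    case (elim \<omega>)
    then obtain k0 where k0: "\<And>k n x. k \<ge> k0 \<Longrightarrow> n \<le> 2 ^ k \<Longrightarrow> x \<in> {0..1} \<Longrightarrow>
       \<bar>pcount (\<lambda>i. U i \<omega>) {..<n} 0 x - real n * x\<bar> \<le> C * sqrt (2 ^ k * ln (real k))"
      unfolding eventually_sequentially by blast
    from ev3 eventually_ge_at_top[of "2 ^ k0"] show ?case
    proof eventually_elim
      case (elim n)
      have "1 \<le> n" using elim(2) by (metis one_le_numeral one_le_power order_trans)
      then obtain k where k: "2 ^ k \<le> n" "n < 2 ^ (k + 1)" using ex_power_ivl1[of 2 n] by auto
      have "(2::nat) ^ k0 < 2 ^ (k + 1)" using elim(2) k by linarith
      then have kk: "k + 1 \<ge> k0" using power_less_imp_less_exp[of "2::nat" k0 "k + 1"] by simp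
      have "real (2 ^ k) \<le> real n" using k(1) by (simp only: of_nat_le_iff)
      then have p: "2 ^ (k + 1) \<le> 2 * real n" by simp
      have "C * sqrt (2 ^ (k + 1) * ln (real (k + 1))) \<le> C' * sqrt (real n * ln (ln (real n)))"
      proof -
        have "2 ^ (k + 1) * ln (real (k + 1)) \<le> (2 * real n) * (2 * ln (ln (real n)))"
          using p lnln[OF k(1) elim(1)] by (intro mult_mono) auto
        also have "\<dots> = 2\<^sup>2 * (real n * ln (ln (real n)))" by simp
        finally have "sqrt (2 ^ (k + 1) * ln (real (k + 1))) \<le> 2 * sqrt (real n * ln (ln (real n)))"
          using real_sqrt_le_mono by (metis real_sqrt_mult real_sqrt_abs abs_numeral)
        moreover have "0 \<le> sqrt (2 ^ (k + 1) * ln (real (k + 1)))" by simp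
        ultimately have "C * sqrt (2 ^ (k + 1) * ln (real (k + 1))) \<le> (\<bar>C\<bar> + 1) * (2 * sqrt (real n * ln (ln (real n))))"
          by (intro mult_mono) auto
        then show ?thesis by (simp only: C'_def mult_ac)
      qed
      then show ?case using k0[OF kk less_imp_le[OF k(2)]] by (blast intro: order_trans)
    qed
  qed
  moreover have "C' > 0" by (simp add: C'_def)
  ultimately show ?thesis by blast
qed

end

section \<open>Order statistics and kernel weights\<close>

text \<open>In a sorted list the positions with entry at most x form an initial segment. This Galois
  connection reduces every statement about order statistics, ties included, to counts.\<close>

lemma order_stat_le_iff:
  assumes "1 \<le> i" "i \<le> length xs"
  shows "order_stat xs i \<le> x \<longleftrightarrow> i \<le> length (filter (\<lambda>y. y \<le> x) xs)"
proof -
  define ys where "ys = sort xs"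
  define c where "c = length (filter (\<lambda>y. y \<le> x) xs)"
  define S where "S = {j. j < length ys \<and> ys ! j \<le> x}"
  have srt: "sorted ys" and len: "length ys = length xs" by (auto simp: ys_def)
  have fin: "finite S" unfolding S_def by auto
  have "mset (filter (\<lambda>y. y \<le> x) ys) = mset (filter (\<lambda>y. y \<le> x) xs)"
    by (simp add: ys_def)
  then have "c = length (filter (\<lambda>y. y \<le> x) ys)"
    unfolding c_def by (metis size_mset)
  then have c: "c = card S" by (simp add: length_filter_conv_card S_def)
  have "i - 1 \<in> S \<longleftrightarrow> i \<le> card S"
  proof
    assume "i - 1 \<in> S"
    then have i: "i - 1 < length ys" "ys ! (i - 1) \<le> x" by (auto simp: S_def)
    have "{..<i} \<subseteq> S"
    proof
      fix j assume "j \<in> {..<i}"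
      then have "j \<le> i - 1" by simp
      then show "j \<in> S" using sorted_nth_mono[OF srt _ i(1), of j] i by (simp add: S_def)
    qed
    then show "i \<le> card S" using card_mono[OF fin, of "{..<i}"] by simp
  next
    assume i: "i \<le> card S"
    show "i - 1 \<in> S"
    proof (rule ccontr)
      assume "i - 1 \<notin> S"
      then have "x < ys ! (i - 1)" using assms len by (auto simp: S_def)
      have "S \<subseteq> {..<i - 1}"
      proof
        fix j assume j: "j \<in> S"
        then have "\<not> i - 1 \<le> j"
          using sorted_nth_mono[OF srt, of "i - 1" j] \<open>x < ys ! (i - 1)\<close> by (auto simp: S_def)
        then show "j \<in> {..<i - 1}" by simp
      qed
      then have "card S \<le> i - 1" using card_mono[of "{..<i - 1}" S] by simp
      then show False using i assms by linarith
    qed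
  qed
  then show ?thesis
    using assms len c by (auto simp: S_def order_stat_def ys_def[symmetric] c_def[symmetric])
qed

lemma Abel_summation:
  fixes k f :: "nat \<Rightarrow> real"
  shows "(\<Sum>j=1..n. k (j - 1) * (f j - f (j - 1)))
    = (\<Sum>j=1..n. (k (j - 1) - k j) * f j) + k n * f n - k 0 * f 0"
  by (induction n) (auto simp: algebra_simps)

lemma card_nat_open_interval:
  assumes "0 \<le> a" "a \<le> b"
  shows "finite {j::nat. a < real j \<and> real j < b}" "real (card {j::nat. a < real j \<and> real j < b}) \<le> b - a + 1"
proof -
  have sub: "{j::nat. a < real j \<and> real j < b} \<subseteq> {nat \<lfloor>a\<rfloor><..nat \<lfloor>b\<rfloor>}"
  proof (intro subsetI, simp, intro conjI)
    fix j assume "a < real j \<and> real j < b"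
    then show "nat \<lfloor>a\<rfloor> < j" "j \<le> nat \<lfloor>b\<rfloor>" using assms by linarith+
  qed
  then show "finite {j::nat. a < real j \<and> real j < b}" by (rule finite_subset) simp
  have "real (card {j::nat. a < real j \<and> real j < b}) \<le> real (nat \<lfloor>b\<rfloor> - nat \<lfloor>a\<rfloor>)"
    using card_mono[OF _ sub] by simp
  also have "\<dots> \<le> b - a + 1" using assms by linarith
  finally show "real (card {j::nat. a < real j \<and> real j < b}) \<le> b - a + 1" .
qed

text \<open>As V is strictly positive, the half-open interval from 0 to x counts every sample point
  up to x, so \<open>N\<close> below is n times the empirical distribution function.\<close>

locale ordered_sample =
  fixes n :: nat and V :: "nat \<Rightarrow> real"
  assumes n_pos: "n > 0" and V_range: "\<And>i. 0 < V i" "\<And>i. V i \<le> 1"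
begin

definition N :: "real \<Rightarrow> real" where "N x = pcount V {..<n} 0 x"
definition T :: "nat \<Rightarrow> real" where "T i = order_stat (map V [0..<n]) i"

lemma N_eq: "N x = real (length (filter (\<lambda>y. y \<le> x) (map V [0..<n])))"
proof -
  have "{i. i < n \<and> (map V [0..<n]) ! i \<le> x} = {i\<in>{..<n}. V i \<le> x}" by auto
  moreover have "N x = (\<Sum>i<n. if V i \<le> x then 1 else 0)"
    unfolding N_def pcount_def using V_range by (intro sum.cong) (auto simp: indicator_def)
  ultimately show ?thesis by (simp add: length_filter_conv_card sum.If_cases Int_def)
qed

lemma T_le_iff:
  assumes "1 \<le> i" "i \<le> n"
  shows "T i \<le> x \<longleftrightarrow> real i \<le> N x"
  using order_stat_le_iff[of i "map V [0..<n]" x] assms by (simp add: T_def N_eq)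

lemma N_T: "1 \<le> i \<Longrightarrow> i \<le> n \<Longrightarrow> real i \<le> N (T i)"
  using T_le_iff by blast

lemma N_less:
  assumes "1 \<le> i" "i \<le> n" "x < T i"
  shows "N x \<le> real i - 1"
proof -
  have "\<not> real i \<le> N x" using T_le_iff[OF assms(1,2)] assms(3) by force
  then have "Suc (length (filter (\<lambda>y. y \<le> x) (map V [0..<n]))) \<le> i"
    unfolding N_eq of_nat_le_iff by simp
  then have "real (Suc (length (filter (\<lambda>y. y \<le> x) (map V [0..<n])))) \<le> real i"
    by (simp only: of_nat_le_iff)
  then show ?thesis unfolding N_eq by simp
qed

lemma N_diff: "0 \<le> s \<Longrightarrow> s \<le> t \<Longrightarrow> pcount V {..<n} s t = N t - N s"
  unfolding N_def using pcount_split[of 0 s t] by simp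

lemma T_mem: "1 \<le> i \<Longrightarrow> i \<le> n \<Longrightarrow> T i \<in> V ` {..<n}"
proof -
  assume "1 \<le> i" "i \<le> n"
  then have "sort (map V [0..<n]) ! (i - 1) \<in> set (sort (map V [0..<n]))"
    by (intro nth_mem) auto
  then show ?thesis by (auto simp: T_def order_stat_def)
qed

lemma T_range: "1 \<le> i \<Longrightarrow> i \<le> n \<Longrightarrow> 0 < T i \<and> T i \<le> 1"
  using T_mem V_range by fastforce

lemma T_mono: "1 \<le> i \<Longrightarrow> i \<le> j \<Longrightarrow> j \<le> n \<Longrightarrow> T i \<le> T j"
  unfolding T_def order_stat_def by (rule sorted_nth_mono) auto

text \<open>Because s lies strictly below \<open>T i\<close>, the point \<open>T i\<close> itself is
  counted; this accounts for the final 1.\<close>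

lemma points_between:
  assumes "1 \<le> i" "i \<le> j" "j \<le> n" "0 \<le> s" "s < T i"
  shows "real j - real i + 1 \<le> pcount V {..<n} s (T j)"
  using N_T[of j] N_less[of i s] T_mono[of i j] assms by (simp add: N_diff)

end

text \<open>The deterministic content of the almost sure bounds at one sample size: l stands for ln
  n and d for a multiple of sqrt(n ln ln n).\<close>

locale regular_sample = ordered_sample +
  fixes l d :: real
  assumes l_ge: "1 \<le> l" and d_nonneg: "0 \<le> d"
    and disc: "\<And>x. 0 \<le> x \<Longrightarrow> x \<le> 1 \<Longrightarrow> \<bar>N x - real n * x\<bar> \<le> d"
    and osc: "\<And>s t. 0 \<le> s \<Longrightarrow> s \<le> t \<Longrightarrow> t \<le> 1 \<Longrightarrow>
      \<bar>pcount V {..<n} s t - real n * (t - s)\<bar> \<le> 14 * (sqrt (real n * (t - s) * l) + l)"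
begin

lemma T_close:
  assumes i: "1 \<le> i" "i \<le> n"
  shows "\<bar>T i - real i / real n\<bar> \<le> d / real n"
proof -
  have r: "0 < T i" "T i \<le> 1" using T_range[OF i] by auto
  have "real i \<le> real n * T i + d" using N_T[OF i] disc[of "T i"] r by linarith
  moreover have "real n * T i \<le> real i + d"
  proof -
    \<comment> \<open>A point 1/n below \<open>T i\<close>, kept nonnegative, replaces the left
      limit. The loss n * (1/n) = 1 is made up by N s <= i - 1, so the bound is again d.\<close>
    define s where "s = max 0 (T i - 1 / real n)"
    have "0 \<le> s" "s < T i" using r n_pos by (auto simp: s_def)
    then have s: "0 \<le> s" "s < T i" "s \<le> 1" using r by auto
    have "real n * (T i - 1 / real n) \<le> real n * s" by (intro mult_left_mono) (auto simp: s_def)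
    moreover have "real n * (T i - 1 / real n) = real n * T i - 1" using n_pos by (simp add: right_diff_distrib)
    ultimately show ?thesis using N_less[OF i s(2)] disc[OF s(1,3)] by linarith
  qed
  ultimately have "\<bar>real n * T i - real i\<bar> \<le> d" by linarith
  moreover have "real n * T i - real i = real n * (T i - real i / real n)" using n_pos by (simp add: right_diff_distrib)
  ultimately have "real n * \<bar>T i - real i / real n\<bar> \<le> d" by (simp add: abs_mult)
  then show ?thesis using n_pos by (simp add: pos_le_divide_eq mult.commute)
qed

lemma osc_sym:
  assumes "0 \<le> s" "s \<le> 1" "0 \<le> t" "t \<le> 1" and x: "real n * \<bar>t - s\<bar> \<le> x"
  shows "\<bar>(N t - N s) - real n * (t - s)\<bar> \<le> 14 * (sqrt (x * l) + l)"
proof -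
  have "sqrt (real n * \<bar>t - s\<bar> * l) \<le> sqrt (x * l)"
    using x l_ge by (intro real_sqrt_le_mono mult_right_mono) auto
  moreover have "\<bar>(N t - N s) - real n * (t - s)\<bar> \<le> 14 * (sqrt (real n * \<bar>t - s\<bar> * l) + l)"
  proof (cases "s \<le> t")
    case True
    then show ?thesis using osc[of s t] N_diff[of s t] assms by simp
  next
    case False
    have "(N t - N s) - real n * (t - s) = - ((N s - N t) - real n * (s - t))" by (simp add: algebra_simps)
    then show ?thesis using False osc[of t s] N_diff[of t s] assms by simp
  qed
  ultimately show ?thesis by argo
qed

text \<open>A Bahadur--Kiefer bound: the quantile deviation \<open>T i - i/n\<close> is minus the empirical
  deviation at \<open>i/n\<close>, up to the oscillation of the empirical process over the distance
  \<open>\<bar>T i - i/n\<bar>\<close>.\<close>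

lemma Bahadur_Kiefer:
  assumes i: "1 \<le> i" "i \<le> n"
  shows "\<bar>T i + N (real i / real n) / real n - 2 * (real i / real n)\<bar>
    \<le> (14 * (sqrt ((d + 1) * l) + l) + 1) / real n"
proof -
  define x where "x = real i / real n"
  define B where "B = 14 * (sqrt ((d + 1) * l) + l)"
  have x: "0 \<le> x" "x \<le> 1" using i by (auto simp: x_def)
  have nx: "real n * x = real i" using n_pos by (simp add: x_def)
  have r: "0 < T i" "T i \<le> 1" using T_range[OF i] by auto
  have "real n * \<bar>T i - x\<bar> \<le> real n * (d / real n)"
    using T_close[OF i] by (intro mult_left_mono) (auto simp: x_def)
  then have close: "real n * \<bar>T i - x\<bar> \<le> d" using n_pos by simp
  have "\<bar>(N (T i) - N x) - real n * (T i - x)\<bar> \<le> B"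
    unfolding B_def using close by (intro osc_sym) (use r x in auto)
  then have 1: "2 * real i - real n * T i - N x \<le> B"
    using N_T[OF i] nx by (simp add: right_diff_distrib)
  \<comment> \<open>With ties \<open>N (T i)\<close> may exceed i, so the opposite inequality is
    taken from a point s just below \<open>T i\<close>, where the count is at most i - 1; the shift
    by at most 1/n turns d into d + 1.\<close>
  define s where "s = max 0 (T i - 1 / real n)"
  have "0 \<le> s" "s < T i" "T i - 1 / real n \<le> s" using r n_pos by (auto simp: s_def)
  then have s: "0 \<le> s" "s < T i" "s \<le> 1" "T i - 1 / real n \<le> s" using r by auto
  have ns: "real n * (T i - s) \<le> 1"
  proof -
    have "real n * (T i - s) \<le> real n * (1 / real n)" using s by (intro mult_left_mono) auto
    then show ?thesis using n_pos by simp
  qed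
  have "real n * \<bar>s - x\<bar> \<le> real n * (\<bar>T i - x\<bar> + (T i - s))" using s by (intro mult_left_mono) auto
  then have "real n * \<bar>s - x\<bar> \<le> d + 1" using close ns by (simp add: distrib_left)
  then have "\<bar>(N s - N x) - real n * (s - x)\<bar> \<le> B"
    unfolding B_def by (intro osc_sym) (use s x in auto)
  then have 2: "real n * T i + N x - 2 * real i \<le> B + 1"
    using N_less[OF i s(2)] nx ns by (simp add: right_diff_distrib)
  have "\<bar>real n * T i + N x - 2 * real i\<bar> \<le> B + 1" using 1 2 by linarith
  moreover have "real n * T i + N x - 2 * real i = real n * (T i + N x / real n - 2 * x)"
    using n_pos nx by (simp add: distrib_left right_diff_distrib)
  ultimately have "real n * \<bar>T i + N x / real n - 2 * x\<bar> \<le> B + 1" by (simp add: abs_mult)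
  then show ?thesis using n_pos by (simp add: x_def B_def field_simps)
qed

end

section \<open>Kernel weights on the grid: summation by parts, total variation,
  discretization\<close>

locale kernel_window =
  fixes n :: nat and K :: "real \<Rightarrow> real" and L h u :: real
  assumes n_pos: "n > 0" and L_pos: "L > 0"
    and K_lip: "\<And>x y. \<bar>K x - K y\<bar> \<le> L * \<bar>x - y\<bar>"
    and K_nonneg: "\<And>x. K x \<ge> 0"
    and K_supp: "\<And>x. \<bar>x\<bar> \<ge> 1 \<Longrightarrow> K x = 0"
    and h_pos: "h > 0" and u_ge: "h \<le> u" and u_le: "u \<le> 1 - h" and nh: "1 \<le> real n * h"
begin

definition k :: "nat \<Rightarrow> real" where "k j = Kh K h (u - real j / real n)"

lemma Kh_nonneg: "Kh K h x \<ge> 0" using K_nonneg h_pos by (simp add: Kh_def)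

lemma Kh_lip: "\<bar>Kh K h x - Kh K h y\<bar> \<le> L / h\<^sup>2 * \<bar>x - y\<bar>"
proof -
  have "\<bar>K (x / h) - K (y / h)\<bar> \<le> L * \<bar>x / h - y / h\<bar>" by (rule K_lip)
  also have "x / h - y / h = (x - y) / h" by (simp add: diff_divide_distrib)
  finally have "\<bar>K (x / h) - K (y / h)\<bar> \<le> L * \<bar>x - y\<bar> / h" using h_pos by (simp add: abs_divide)
  then have "\<bar>K (x / h) - K (y / h)\<bar> / h \<le> L * \<bar>x - y\<bar> / h / h" using h_pos by (intro divide_right_mono) auto
  then show ?thesis using h_pos by (simp add: Kh_def diff_divide_distrib[symmetric] abs_divide power2_eq_square)
qed

lemma Kh_supp: "\<bar>x\<bar> \<ge> h \<Longrightarrow> Kh K h x = 0"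
  using K_supp[of "x / h"] h_pos by (simp add: Kh_def abs_divide)

lemma k_nonneg: "k j \<ge> 0" by (simp add: k_def Kh_nonneg)

lemma k_supp: "k j \<noteq> 0 \<Longrightarrow> \<bar>u - real j / real n\<bar> < h"
  unfolding k_def by (meson Kh_supp not_le)

text \<open>For u in [h, 1 - h] both ends of the unit interval lie outside the open kernel window.
  This removes the boundary terms from every summation by parts.\<close>

lemma k_0: "k 0 = 0" and k_n: "k n = 0"
  using u_ge u_le h_pos n_pos by (auto simp: k_def intro!: Kh_supp)

lemma h_ge_inverse: "1 / real n \<le> h"
  using nh n_pos by (simp add: field_simps)

lemma k_diff:
  assumes "1 \<le> j"
  shows "\<bar>k (j - 1) - k j\<bar> \<le> L / (real n * h\<^sup>2)"
proof -
  have "\<bar>k (j - 1) - k j\<bar> \<le> L / h\<^sup>2 * \<bar>(u - real (j - 1) / real n) - (u - real j / real n)\<bar>"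
    unfolding k_def by (rule Kh_lip)
  also have "(u - real (j - 1) / real n) - (u - real j / real n) = 1 / real n"
    using assms by (simp add: of_nat_diff diff_divide_distrib)
  finally show ?thesis by (simp add: field_simps)
qed

lemma k_diff_supp:
  assumes "1 \<le> j" "k (j - 1) - k j \<noteq> 0"
  shows "real n * (u - h) < real j" "real j < real n * (u + h) + 1" "\<bar>real j / real n - u\<bar> \<le> 2 * h"
proof -
  have "k (j - 1) \<noteq> 0 \<or> k j \<noteq> 0" using assms by auto
  then have "\<bar>u - real (j - 1) / real n\<bar> < h \<or> \<bar>u - real j / real n\<bar> < h" using k_supp by blast
  moreover have "real (j - 1) / real n = real j / real n - 1 / real n"
    using assms by (simp add: of_nat_diff diff_divide_distrib)
  moreover have "0 < 1 / real n" using n_pos by simp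
  ultimately have *: "u - h < real j / real n" "real j / real n < u + h + 1 / real n"
    by linarith+
  show "real n * (u - h) < real j" "real j < real n * (u + h) + 1" using * n_pos by (auto simp: field_simps)
  show "\<bar>real j / real n - u\<bar> \<le> 2 * h" using * h_ge_inverse h_pos by linarith
qed

text \<open>At most 2 n h + 2 <= 4 n h indices have a nonzero increment, and each increment is at
  most L / (n h^2) by the Lipschitz bound.\<close>

lemma k_variation: "(\<Sum>j=1..n. \<bar>k (j - 1) - k j\<bar>) \<le> 4 * L / h"
proof -
  define S where "S = {j::nat. real n * (u - h) < real j \<and> real j < real n * (u + h) + 1}"
  have ord: "0 \<le> real n * (u - h)" "real n * (u - h) \<le> real n * (u + h) + 1"
    using u_ge h_pos by (auto intro!: add_increasing2 mult_left_mono)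
  have fin: "finite S" unfolding S_def by (rule card_nat_open_interval[OF ord])
  have "real (card S) \<le> real n * (u + h) + 1 - real n * (u - h) + 1"
    unfolding S_def by (rule card_nat_open_interval[OF ord])
  also have "\<dots> = 2 * (real n * h) + 2" by (simp add: algebra_simps)
  also have "\<dots> \<le> 4 * (real n * h)" using nh by linarith
  finally have card: "real (card S) \<le> 4 * (real n * h)" .
  have "(\<Sum>j=1..n. \<bar>k (j - 1) - k j\<bar>) = (\<Sum>j\<in>{1..n} \<inter> S. \<bar>k (j - 1) - k j\<bar>)"
    by (intro sum.mono_neutral_right) (use k_diff_supp in \<open>auto simp: S_def\<close>)
  also have "\<dots> \<le> real (card ({1..n} \<inter> S)) * (L / (real n * h\<^sup>2))"
    by (intro sum_bounded_above k_diff) auto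
  also have "\<dots> \<le> 4 * (real n * h) * (L / (real n * h\<^sup>2))"
    using card card_mono[OF fin, of "{1..n} \<inter> S"] L_pos
    by (intro mult_right_mono) (auto intro: order_trans)
  also have "\<dots> = 4 * L / h" using n_pos h_pos by (simp add: field_simps power2_eq_square)
  finally show ?thesis .
qed

lemma weighted_sum_bound:
  assumes "\<And>j. 1 \<le> j \<Longrightarrow> j \<le> n \<Longrightarrow> k (j - 1) - k j \<noteq> 0 \<Longrightarrow> \<bar>a j\<bar> \<le> b" "b \<ge> 0"
  shows "\<bar>\<Sum>j=1..n. (k (j - 1) - k j) * a j\<bar> \<le> 4 * L / h * b"
proof -
  have "\<bar>\<Sum>j=1..n. (k (j - 1) - k j) * a j\<bar> \<le> (\<Sum>j=1..n. \<bar>(k (j - 1) - k j) * a j\<bar>)" by (rule sum_abs)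
  also have "\<dots> \<le> (\<Sum>j=1..n. \<bar>k (j - 1) - k j\<bar> * b)"
  proof (rule sum_mono)
    fix j assume "j \<in> {1..n}"
    then show "\<bar>(k (j - 1) - k j) * a j\<bar> \<le> \<bar>k (j - 1) - k j\<bar> * b"
      using assms by (cases "k (j - 1) - k j = 0") (auto simp: abs_mult intro: mult_left_mono)
  qed
  also have "\<dots> = (\<Sum>j=1..n. \<bar>k (j - 1) - k j\<bar>) * b" by (rule sum_distrib_right[symmetric])
  also have "\<dots> \<le> 4 * L / h * b" using k_variation assms(2) by (rule mult_right_mono)
  finally show ?thesis .
qed

text \<open>The discretized kernel at x uses the left end of the grid cell of x, so it can be
  nonzero up to 1/n beyond u + h. The cap at 1 keeps the window where interval counts are
  controlled.\<close>

definition upper_end :: real where "upper_end = min 1 (u + h + 1 / real n)"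

lemma upper_end: "u - h \<le> upper_end" "upper_end \<le> 1" "upper_end - (u - h) \<le> 3 * h"
  using h_pos u_le h_ge_inverse n_pos by (auto simp: upper_end_def min_def)

text \<open>The grid cells partition (0, 1], so the sum equals the kernel at the left end of the
  cell of x, at distance at most 1/n. Summed over the sample, the step function becomes a weighted
  sum of increments of \<open>N\<close>.\<close>

lemma kernel_discretization:
  assumes x: "0 < x" "x \<le> 1"
  shows "\<bar>Kh K h (u - x) - (\<Sum>j=1..n. k (j - 1) * indicator {real (j - 1) / real n<..real j / real n} x)\<bar>
    \<le> L / (real n * h\<^sup>2) * indicator {u - h<..upper_end} x"
proof -
  define i where "i = nat \<lceil>real n * x\<rceil>"
  have "0 < real n * x" "real n * x \<le> real n" using x n_pos by auto
  then have i: "1 \<le> i" "i \<le> n" "real n * x \<le> real i" "real i - 1 < real n * x"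
    unfolding i_def by linarith+
  have xi: "real (i - 1) / real n < x" "x \<le> real i / real n"
    using i n_pos by (auto simp: field_simps of_nat_diff)
  have i1: "real (i - 1) / real n = real i / real n - 1 / real n"
    using i by (simp add: of_nat_diff diff_divide_distrib)
  have "(\<Sum>j=1..n. k (j - 1) * indicator {real (j - 1) / real n<..real j / real n} x) = (\<Sum>j\<in>{i}. k (j - 1))"
  proof (rule sum.mono_neutral_cong_right)
    show "\<forall>j\<in>{1..n} - {i}. k (j - 1) * indicator {real (j - 1) / real n<..real j / real n} x = 0"
    proof
      fix j assume j: "j \<in> {1..n} - {i}"
      have "x \<notin> {real (j - 1) / real n<..real j / real n}"
      proof
        assume "x \<in> {real (j - 1) / real n<..real j / real n}"
        then have "real (j - 1) < real n * x" "real n * x \<le> real j" using n_pos by (auto simp: field_simps)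
        then have "real (j - 1) < real i" "real i - 1 < real j" using i by linarith+
        then show False using j i by auto
      qed
      then show "k (j - 1) * indicator {real (j - 1) / real n<..real j / real n} x = 0" by simp
    qed
  qed (use i xi in auto)
  then have eq: "Kh K h (u - x) - (\<Sum>j=1..n. k (j - 1) * indicator {real (j - 1) / real n<..real j / real n} x)
      = Kh K h (u - x) - Kh K h (u - real (i - 1) / real n)" (is "?lhs = ?rhs") by (simp add: k_def)
  show ?thesis
  proof (cases "x \<in> {u - h<..upper_end}")
    case True
    have "\<bar>?rhs\<bar> \<le> L / h\<^sup>2 * \<bar>(u - x) - (u - real (i - 1) / real n)\<bar>" by (rule Kh_lip)
    also have "\<dots> \<le> L / h\<^sup>2 * (1 / real n)"
      using xi i1 L_pos by (intro mult_left_mono) auto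
    finally show ?thesis unfolding eq using True by (simp add: field_simps)
  next
    case False
    then have "x \<le> u - h \<or> u + h + 1 / real n < x" using x by (auto simp: upper_end_def)
    then have "Kh K h (u - x) = 0" "Kh K h (u - real (i - 1) / real n) = 0"
      using xi i1 h_pos n_pos zero_less_divide_1_iff[of "real n"] by (auto intro!: Kh_supp simp: abs_if)
    then show ?thesis unfolding eq using False by simp
  qed
qed

text \<open>A left Riemann sum over [0, 1] for the integral of the kernel. It is the exact centre of
  the Abel sums for \<open>P\<close> and for the discretized \<open>kde\<close>, before it is
  replaced by 1.\<close>

definition rho :: real where "rho = (\<Sum>j=1..n. k (j - 1) / real n)"

lemma rho_Abel: "rho = (\<Sum>j=1..n. (k (j - 1) - k j) * (real j / real n))"
proof -
  have "(\<Sum>j=1..n. k (j - 1) * (real j / real n - real (j - 1) / real n)) = rho"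
    unfolding rho_def by (intro sum.cong) (auto simp: of_nat_diff diff_divide_distrib)
  then show ?thesis using Abel_summation[of k "\<lambda>j. real j / real n" n] by (simp add: k_0 k_n)
qed

text \<open>Constants may therefore be subtracted freely inside Abel sums; recentring the empirical
  deviation at u rests on this.\<close>

lemma k_diff_sum: "(\<Sum>j=1..n. k (j - 1) - k j) = 0"
  using Abel_summation[of k "\<lambda>_. 1" n] by (simp add: k_0 k_n)

end

section \<open>The remainder for a fixed sample size\<close>

text \<open>The shifted sum has one more summand, at j = 1. It involves \<open>f 0\<close>, in the
  application the order statistic of index 0, and is removed by the weight
  \<open>k 0 = 0\<close>.\<close>

lemma sum_shift_weights:
  fixes k f :: "nat \<Rightarrow> real"
  assumes "k 0 = 0" "n > 0"
  shows "(\<Sum>j=1..n - 1. k j * (f (j + 1) - f j)) = (\<Sum>j=1..n. k (j - 1) * (f j - f (j - 1)))"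
proof -
  obtain m where m: "n = Suc m" using assms(2) gr0_implies_Suc by blast
  have "(\<Sum>j=1..m. k j * (f (j + 1) - f j)) = (\<Sum>j=1..Suc m. k (j - 1) * (f j - f (j - 1)))"
    using assms(1) by (induction m) auto
  then show ?thesis by (simp add: m)
qed

locale sample_window = regular_sample n V l d + kernel_window n K L h u
  for n V l d K L h u
begin

definition kde :: real where "kde = (\<Sum>i<n. Kh K h (u - V i)) / real n"
definition P :: real where "P = (\<Sum>j=1..n - 1. k j * (T (j + 1) - T j))"

lemma T_step: "1 \<le> j \<Longrightarrow> j \<le> n - 1 \<Longrightarrow> 0 \<le> T j \<and> T j \<le> T (j + 1) \<and> T (j + 1) \<le> 1"
  using T_range[of j] T_range[of "j + 1"] T_mono[of j "j + 1"] n_pos by fastforce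

lemma P_Abel: "P = (\<Sum>j=1..n. (k (j - 1) - k j) * T j)"
  unfolding P_def sum_shift_weights[of k, OF k_0 n_pos] Abel_summation by (simp add: k_0 k_n)

lemma window_count:
  "pcount V {..<n} (u - h) upper_end \<le> 3 * (real n * h) + 14 * (sqrt (3 * (real n * h) * l) + l)"
proof -
  have x: "real n * (upper_end - (u - h)) \<le> 3 * (real n * h)"
    using mult_left_mono[OF upper_end(3), of "real n"] by (simp add: algebra_simps)
  have "pcount V {..<n} (u - h) upper_end
      \<le> real n * (upper_end - (u - h)) + 14 * (sqrt (real n * (upper_end - (u - h)) * l) + l)"
    using osc[of "u - h" upper_end] upper_end u_ge by linarith
  also have "\<dots> \<le> 3 * (real n * h) + 14 * (sqrt (3 * (real n * h) * l) + l)"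
    using x l_ge by (intro add_mono mult_left_mono real_sqrt_le_mono mult_right_mono) auto
  finally show ?thesis .
qed

lemma K_le: "K x \<le> 2 * L"
proof (cases "\<bar>x\<bar> \<ge> 1")
  case True
  then show ?thesis using K_supp L_pos by simp
next
  case False
  have "\<bar>K x - K 1\<bar> \<le> L * \<bar>x - 1\<bar>" by (rule K_lip)
  also have "\<dots> \<le> L * 2" using False L_pos by (intro mult_left_mono) auto
  finally show ?thesis using K_supp[of 1] by simp
qed

lemma kde_nonneg: "kde \<ge> 0"
  unfolding kde_def by (intro divide_nonneg_nonneg sum_nonneg Kh_nonneg) auto

text \<open>Here n h may be far below l, and a window can then hold of order l points, so the bound
  grows with l instead of staying near 1.\<close>

lemma kde_crude: "kde \<le> 146 * L * l"
proof -
  define w where "w = real n * h"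
  have w: "1 \<le> w" using nh by (simp add: w_def)
  have pt: "Kh K h (u - x) \<le> 2 * L / h * indicator {u - h<..upper_end} x" if "x \<le> 1" for x
  proof (cases "\<bar>u - x\<bar> < h")
    case True
    moreover have "0 < 1 / real n" using n_pos by simp
    ultimately have "u - h < x" "x \<le> u + h + 1 / real n" by linarith+
    then have "x \<in> {u - h<..upper_end}" using that by (simp add: upper_end_def)
    then show ?thesis using K_le h_pos by (simp add: Kh_def divide_right_mono)
  next
    case False
    then show ?thesis using Kh_supp[of "u - x"] L_pos h_pos by simp
  qed
  have "sqrt (3 * w * l) \<le> 2 * (w + l)"
  proof (rule real_le_lsqrt)
    have "0 \<le> w * l" using w l_ge by simp
    then have "3 * w * l \<le> 4 * w\<^sup>2 + 8 * (w * l) + 4 * l\<^sup>2"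
      using zero_le_power2[of w] zero_le_power2[of l] by linarith
    then show "3 * w * l \<le> (2 * (w + l))\<^sup>2" by (simp add: power2_eq_square algebra_simps)
  qed (use w l_ge in auto)
  \<comment> \<open>Inserting 2 (w + l) for the square root gives 3 + 28 = 31 for w and 28 + 14 = 42
    for l.\<close>
  then have "pcount V {..<n} (u - h) upper_end \<le> 31 * w + 42 * l"
    using window_count unfolding w_def[symmetric] by argo
  also have "\<dots> \<le> 73 * (w * l)"
  proof -
    have "w * 1 \<le> w * l" "1 * l \<le> w * l" using w l_ge by (auto intro: mult_left_mono mult_right_mono)
    then show ?thesis by linarith
  qed
  finally have cnt: "pcount V {..<n} (u - h) upper_end \<le> 73 * (w * l)" .
  have "(\<Sum>i<n. Kh K h (u - V i)) \<le> (\<Sum>i<n. 2 * L / h * indicator {u - h<..upper_end} (V i))"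
    using V_range by (intro sum_mono pt) auto
  also have "\<dots> = 2 * L / h * pcount V {..<n} (u - h) upper_end" by (simp add: pcount_def sum_distrib_left)
  also have "\<dots> \<le> 2 * L / h * (73 * (w * l))" using cnt L_pos h_pos by (intro mult_left_mono) auto
  finally have "kde \<le> 2 * L / h * (73 * (w * l)) / real n"
    unfolding kde_def by (intro divide_right_mono) auto
  also have "\<dots> = 146 * L * l" using n_pos h_pos by (simp add: w_def)
  finally show ?thesis .
qed

context
  assumes l_le: "l \<le> real n * h" and rho: "\<bar>rho - 1\<bar> \<le> 3 * L / (real n * h)"
begin

text \<open>Only sample points in the window contribute, each with error at most L / (n h^2). Since
  l <= n h, their number is at most 3 + 28 + 14 = 45 times n h.\<close>

lemma kde_discretization:
  "\<bar>kde - (\<Sum>j=1..n. (k (j - 1) - k j) * (N (real j / real n) / real n))\<bar> \<le> 45 * L / (real n * h)"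
proof -
  define D where "D x = (\<Sum>j=1..n. k (j - 1) * indicator {real (j - 1) / real n<..real j / real n} x)" for x
  have "(\<Sum>i<n. D (V i)) = (\<Sum>j=1..n. k (j - 1) * pcount V {..<n} (real (j - 1) / real n) (real j / real n))"
    unfolding D_def pcount_def sum_distrib_left by (rule sum.swap)
  also have "\<dots> = (\<Sum>j=1..n. k (j - 1) * (N (real j / real n) - N (real (j - 1) / real n)))"
    by (intro sum.cong refl arg_cong2[of _ _ _ _ "(*)"] N_diff) (auto simp: divide_right_mono)
  also have "\<dots> = (\<Sum>j=1..n. (k (j - 1) - k j) * N (real j / real n))"
    using Abel_summation[of k "\<lambda>j. N (real j / real n)" n] by (simp add: k_0 k_n)
  finally have D: "(\<Sum>i<n. D (V i)) / real n = (\<Sum>j=1..n. (k (j - 1) - k j) * (N (real j / real n) / real n))"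
    by (simp add: sum_divide_distrib)
  have "sqrt (3 * (real n * h) * l) \<le> 2 * (real n * h)"
  proof (rule real_le_lsqrt)
    have "3 * (real n * h) * l \<le> 4 * (real n * h) * (real n * h)" using l_le nh l_ge h_pos by (intro mult_mono) auto
    then show "3 * (real n * h) * l \<le> (2 * (real n * h))\<^sup>2" by (simp add: power2_eq_square)
  qed (use nh l_ge in auto)
  then have cnt: "pcount V {..<n} (u - h) upper_end \<le> 45 * (real n * h)"
    using window_count l_le by argo
  have "\<bar>(\<Sum>i<n. Kh K h (u - V i)) - (\<Sum>i<n. D (V i))\<bar> \<le> (\<Sum>i<n. \<bar>Kh K h (u - V i) - D (V i)\<bar>)"
    unfolding sum_subtractf[symmetric] by (rule sum_abs)
  also have "\<dots> \<le> (\<Sum>i<n. L / (real n * h\<^sup>2) * indicator {u - h<..upper_end} (V i))"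
    unfolding D_def using V_range by (intro sum_mono kernel_discretization) auto
  also have "\<dots> = L / (real n * h\<^sup>2) * pcount V {..<n} (u - h) upper_end" by (simp add: pcount_def sum_distrib_left)
  also have "\<dots> \<le> L / (real n * h\<^sup>2) * (45 * (real n * h))" using cnt L_pos by (intro mult_left_mono) auto
  also have "\<dots> = 45 * L / h" using n_pos h_pos by (simp add: power2_eq_square)
  finally have "\<bar>(\<Sum>i<n. Kh K h (u - V i)) - (\<Sum>i<n. D (V i))\<bar> / real n \<le> 45 * L / h / real n"
    by (intro divide_right_mono) auto
  then show ?thesis unfolding D[symmetric] kde_def diff_divide_distrib[symmetric]
    by (simp add: abs_divide mult.commute)
qed

text \<open>In \<open>P + gt - 2 * rho\<close> the Abel coefficients multiply exactly the
  Bahadur--Kiefer quantity, and they have total variation at most 4 L / h. Passing from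
  \<open>gt\<close> to \<open>kde\<close> costs 45 and from \<open>2 * rho\<close> to 2 costs 2 * 3,
  together 51.\<close>

lemma linearization_error:
  "\<bar>P - 1 + (kde - 1)\<bar> \<le> 4 * L / h * ((14 * (sqrt ((d + 1) * l) + l) + 1) / real n) + 51 * L / (real n * h)"
proof -
  define gt where "gt = (\<Sum>j=1..n. (k (j - 1) - k j) * (N (real j / real n) / real n))"
  have "P + gt - 2 * rho = (\<Sum>j=1..n. (k (j - 1) - k j) * (T j + N (real j / real n) / real n - 2 * (real j / real n)))"
    unfolding P_Abel gt_def rho_Abel by (simp add: sum_distrib_left sum.distrib[symmetric] sum_subtractf[symmetric] algebra_simps)
  also have "\<bar>\<dots>\<bar> \<le> 4 * L / h * ((14 * (sqrt ((d + 1) * l) + l) + 1) / real n)"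
    using Bahadur_Kiefer l_ge d_nonneg by (intro weighted_sum_bound) auto
  finally have "\<bar>P + gt - 2 * rho\<bar> \<le> 4 * L / h * ((14 * (sqrt ((d + 1) * l) + l) + 1) / real n)" .
  moreover have "\<bar>kde - gt\<bar> \<le> 45 * (L / (real n * h))" using kde_discretization unfolding gt_def by simp
  moreover have "\<bar>rho - 1\<bar> \<le> 3 * (L / (real n * h))" using rho by simp
  moreover have "51 * L / (real n * h) = 51 * (L / (real n * h))" by simp
  ultimately show ?thesis by argo
qed

text \<open>Recentring at u replaces the global discrepancy by the oscillation over a distance of at
  most 2 h, which is what produces sqrt(l / (n h)). The constant is 4 * 42 from the oscillation plus
  45 + 3 from discretization.\<close>

lemma kde_deviation: "\<bar>kde - 1\<bar> \<le> 216 * L * sqrt (l / (real n * h))"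
proof -
  define w where "w = real n * h"
  have w: "w > 0" "1 \<le> w" "l \<le> w" using nh l_le by (auto simp: w_def)
  define gt where "gt = (\<Sum>j=1..n. (k (j - 1) - k j) * (N (real j / real n) / real n))"
  have "gt - rho = (\<Sum>j=1..n. (k (j - 1) - k j) * (N (real j / real n) / real n - real j / real n))"
    unfolding gt_def rho_Abel sum_subtractf[symmetric] by (simp add: algebra_simps)
  also have "\<dots> = (\<Sum>j=1..n. (k (j - 1) - k j) * (N (real j / real n) / real n - real j / real n))
      - (N u / real n - u) * (\<Sum>j=1..n. k (j - 1) - k j)" unfolding k_diff_sum by simp
  also have "\<dots> = (\<Sum>j=1..n. (k (j - 1) - k j) * ((N (real j / real n) / real n - real j / real n) - (N u / real n - u)))"
    by (simp add: sum_distrib_left sum_subtractf[symmetric] algebra_simps)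
  also have "\<bar>\<dots>\<bar> \<le> 4 * L / h * (14 * (sqrt (2 * w * l) + l) / real n)"
  proof (rule weighted_sum_bound)
    fix j assume j: "1 \<le> j" "j \<le> n" "k (j - 1) - k j \<noteq> 0"
    define x where "x = real j / real n"
    have x: "0 \<le> x" "x \<le> 1" using j by (auto simp: x_def)
    have "real n * \<bar>x - u\<bar> \<le> real n * (2 * h)"
      using k_diff_supp(3)[OF j(1,3)] by (intro mult_left_mono) (auto simp: x_def)
    then have "\<bar>(N x - N u) - real n * (x - u)\<bar> \<le> 14 * (sqrt (2 * w * l) + l)"
      using x u_ge u_le h_pos by (intro osc_sym) (auto simp: w_def)
    moreover have "(N x / real n - x) - (N u / real n - u) = ((N x - N u) - real n * (x - u)) / real n"
      using n_pos by (simp add: diff_divide_distrib)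
    ultimately have "\<bar>(N x / real n - x) - (N u / real n - u)\<bar> \<le> 14 * (sqrt (2 * w * l) + l) / real n"
      by (simp add: abs_divide divide_right_mono)
    then show "\<bar>(N (real j / real n) / real n - real j / real n) - (N u / real n - u)\<bar> \<le> 14 * (sqrt (2 * w * l) + l) / real n"
      unfolding x_def .
  qed (use w l_ge in auto)
  finally have 1: "\<bar>gt - rho\<bar> \<le> 4 * L / h * (14 * (sqrt (2 * w * l) + l) / real n)" .
  have s1: "1 \<le> sqrt (w * l)" using w l_ge mult_mono[of 1 w 1 l] by simp
  have s2: "l \<le> sqrt (w * l)" using w l_ge by (intro real_le_rsqrt) (simp add: power2_eq_square mult_right_mono)
  have s3: "sqrt (2 * w * l) \<le> 2 * sqrt (w * l)"
  proof -
    have "sqrt (2 * w * l) \<le> sqrt (2\<^sup>2 * (w * l))" using w l_ge by (intro real_sqrt_le_mono) auto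
    then show ?thesis by (simp add: real_sqrt_mult)
  qed
  have "14 * (sqrt (2 * w * l) + l) \<le> 42 * sqrt (w * l)" using s2 s3 by argo
  then have "4 * L / h * (14 * (sqrt (2 * w * l) + l) / real n) \<le> 4 * L / h * (42 * sqrt (w * l) / real n)"
    using L_pos h_pos by (intro mult_left_mono divide_right_mono) auto
  also have "\<dots> = 168 * (L * (sqrt (w * l) / w))" by (simp add: w_def mult_ac)
  finally have 2: "\<bar>gt - rho\<bar> \<le> 168 * (L * (sqrt (w * l) / w))" using 1 by linarith
  have "L / w \<le> L * (sqrt (w * l) / w)" using s1 L_pos w by (simp add: divide_right_mono)
  moreover have "\<bar>kde - gt\<bar> \<le> 45 * (L / w)" using kde_discretization unfolding gt_def w_def by simp
  moreover have "\<bar>rho - 1\<bar> \<le> 3 * (L / w)" using rho unfolding w_def by simp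
  ultimately have "\<bar>kde - 1\<bar> \<le> 216 * (L * (sqrt (w * l) / w))" using 2 by argo
  also have "sqrt (w * l) / w = sqrt (l / w)"
    using w by (simp add: real_sqrt_mult real_sqrt_divide field_simps)
  finally show ?thesis by (simp add: w_def)
qed

end

section \<open>Lower bounds for \<open>P\<close> from an interval on which the kernel is bounded
  below\<close>

context
  fixes kap x0 \<delta> :: real
  assumes kap: "kap > 0" and \<delta>: "\<delta> > 0" and bump: "\<And>z. \<bar>z - x0\<bar> \<le> \<delta> \<Longrightarrow> kap \<le> K z"
begin

text \<open>The indices at which the rescaled argument of the kernel is within \<delta> of x0 form a
  block a..b with weights at least kap / h, and over a block the spacings telescope. It remains to
  bound below the length of an interval that holds about 2 n h \<delta> sample points.\<close>

lemma P_lower: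
  assumes big: "1 \<le> real n * h * \<delta>"
  obtains a b where "1 \<le> a" "a \<le> b" "b < n" "kap / h * (T (b + 1) - T a) \<le> P"
    "2 * (real n * h * \<delta>) \<le> real (b + 1) - real a + 1"
proof -
  define A where "A = real n * (u - h * x0 - h * \<delta>)"
  define B where "B = real n * (u - h * x0 + h * \<delta>)"
  have inside: "kap / h \<le> k j \<and> \<bar>u - real j / real n\<bar> < h" if "A \<le> real j" "real j \<le> B" for j
  proof -
    have "\<bar>(u - real j / real n) / h - x0\<bar> \<le> \<delta>"
    proof -
      define z where "z = u - real j / real n"
      have "u - h * x0 - h * \<delta> \<le> real j / real n" "real j / real n \<le> u - h * x0 + h * \<delta>"
        using that n_pos by (auto simp: A_def B_def field_simps)
      then have "\<bar>z - h * x0\<bar> \<le> h * \<delta>" unfolding z_def by linarith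
      moreover have "z - h * x0 = h * (z / h - x0)"
        using h_pos by (simp add: right_diff_distrib)
      ultimately have "h * \<bar>z / h - x0\<bar> \<le> h * \<delta>" using h_pos by (simp add: abs_mult)
      then show ?thesis using h_pos by (simp add: z_def)
    qed
    then have le: "kap \<le> K ((u - real j / real n) / h)" by (rule bump)
    then have 1: "kap / h \<le> k j" using h_pos by (simp add: k_def Kh_def divide_right_mono)
    moreover have "0 < kap / h" using kap h_pos by simp
    ultimately show ?thesis using k_supp[of j] by linarith
  qed
  have AB: "B - A = 2 * (real n * h * \<delta>)" by (simp add: A_def B_def algebra_simps)
  define a where "a = nat \<lceil>A\<rceil>"
  define b where "b = nat \<lfloor>B\<rfloor>"
  \<comment> \<open>\<open>nat\<close> truncates at 0, and A > -1 is what keeps a < A + 1 true after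
    truncation. Otherwise index 0 would lie in the block and carry positive weight, contradicting u
    >= h.\<close>
  have A0: "A > - 1"
  proof (rule ccontr)
    assume "\<not> A > - 1"
    have "kap \<le> K x0" using \<delta> by (intro bump) auto
    then have "\<bar>x0\<bar> < 1" using kap K_supp[of x0] by linarith
    then have "h * x0 < h * 1" using h_pos by (intro mult_strict_left_mono) auto
    moreover have "0 < h * \<delta>" using h_pos \<delta> by simp
    ultimately have "0 \<le> u - h * x0 + h * \<delta>" using u_ge by linarith
    then have "A \<le> real 0" "real 0 \<le> B" using \<open>\<not> A > - 1\<close> by (auto simp: B_def)
    then show False using inside[of 0] u_ge by auto
  qed
  have ab: "A \<le> real a" "real a < A + 1 \<or> a = 0" "real b \<le> B" "B < real b + 1"
    using A0 AB big unfolding a_def b_def by linarith+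
  have ra: "real a < A + 1" using ab(2) A0 by auto
  have ab_le: "a \<le> b" using ra ab AB big by linarith
  have ina: "\<bar>u - real a / real n\<bar> < h" using inside[of a] ab ab_le by auto
  have inb: "\<bar>u - real b / real n\<bar> < h" using inside[of b] ab ab_le by auto
  have "0 < real a / real n" "real b / real n < 1" using ina inb u_ge u_le by linarith+
  then have a1: "1 \<le> a" and bn: "b < n" using n_pos by (auto simp: field_simps)
  have "kap / h * (T (b + 1) - T a) = (\<Sum>j=a..b. kap / h * (T (j + 1) - T j))"
    unfolding sum_distrib_left[symmetric] using sum_Suc_diff[of a b T] ab_le by simp
  also have "\<dots> \<le> (\<Sum>j=a..b. k j * (T (j + 1) - T j))"
  proof (intro sum_mono mult_right_mono)
    fix j assume j: "j \<in> {a..b}"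
    then show "kap / h \<le> k j" using inside[of j] ab by auto
    show "0 \<le> T (j + 1) - T j" using T_mono[of j "j + 1"] j a1 bn by auto
  qed
  also have "\<dots> \<le> P" unfolding P_def
  proof (rule sum_mono2)
    show "{a..b} \<subseteq> {1..n - 1}" using a1 bn by auto
    show "0 \<le> k j * (T (j + 1) - T j)" if "j \<in> {1..n - 1} - {a..b}" for j
      using that T_step[of j] k_nonneg[of j] by auto
  qed simp
  finally have "kap / h * (T (b + 1) - T a) \<le> P" .
  moreover have "2 * (real n * h * \<delta>) \<le> real (b + 1) - real a + 1" using ab ra AB by simp
  ultimately show ?thesis using that a1 ab_le bn by blast
qed

text \<open>An interval of scaled length X holds at most X + 14 (sqrt(X l) + l) <= 2 X + 63 l
  points, by 14 sqrt(X l) <= X + 49 l. The assumption has 65 rather than 63 to absorb the extra 1/n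
  by which the interval is enlarged to the left of \<open>T a\<close>.\<close>

lemma P_lower_regular:
  assumes big: "65 * l \<le> real n * h * \<delta>"
  shows "kap * \<delta> / 2 \<le> P"
proof -
  have "1 \<le> real n * h * \<delta>" using big l_ge by linarith
  then obtain a b where ab: "1 \<le> a" "a \<le> b" "b < n" "kap / h * (T (b + 1) - T a) \<le> P"
    "2 * (real n * h * \<delta>) \<le> real (b + 1) - real a + 1" by (rule P_lower)
  define len where "len = T (b + 1) - T a"
  define s where "s = max 0 (T a - 1 / real n)"
  have r: "0 < T a" "T (b + 1) \<le> 1" "T a \<le> T (b + 1)" using T_range[of a] T_range[of "b + 1"] T_mono[of a "b + 1"] ab by auto
  have s: "0 \<le> s" "s < T a" "T a - 1 / real n \<le> s" using r n_pos by (auto simp: s_def)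
  define X where "X = real n * (T (b + 1) - s)"
  have X0: "X \<ge> 0" using s r by (simp add: X_def)
  have "X \<le> real n * (len + 1 / real n)" unfolding X_def len_def using s by (intro mult_left_mono) auto
  then have X1: "X \<le> real n * len + 1" using n_pos by (simp add: distrib_left)
  have "2 * (real n * h * \<delta>) \<le> pcount V {..<n} s (T (b + 1))"
    using points_between[of a "b + 1" s] ab s by linarith
  also have "\<dots> \<le> X + 14 * (sqrt (X * l) + l)"
    using osc[of s "T (b + 1)"] s r unfolding X_def by linarith
  finally have upper: "2 * (real n * h * \<delta>) \<le> X + 14 * (sqrt (X * l) + l)" .
  have "14 * sqrt (X * l) \<le> X + 49 * l"
  proof -
    have "0 \<le> (sqrt X - 7 * sqrt l)\<^sup>2" by simp
    also have "\<dots> = X - 14 * sqrt (X * l) + 49 * l"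
      using X0 l_ge by (simp add: power2_eq_square algebra_simps real_sqrt_mult)
    finally show ?thesis by simp
  qed
  then have "2 * (real n * h * \<delta>) \<le> 2 * X + 63 * l" using upper by argo
  then have "real n * h * \<delta> \<le> 2 * (real n * len)" using X1 big l_ge by linarith
  then have "real n * (h * \<delta> / 2) \<le> real n * len" by simp
  then have "h * \<delta> / 2 \<le> len" using n_pos by simp
  then have "kap / h * (h * \<delta> / 2) \<le> kap / h * len" using kap h_pos by (intro mult_left_mono) auto
  moreover have "kap / h * (h * \<delta> / 2) = kap * \<delta> / 2" using h_pos by simp
  ultimately show ?thesis using ab(4) unfolding len_def by linarith
qed

text \<open>When \<open>n * h\<close> grows more slowly than \<open>ln n\<close>, the spacings in the window are not comparable to \<open>h\<close>;
  all that remains is a lower bound that is a negative power of \<open>n\<close>.\<close>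

lemma P_lower_no_clumps:
  assumes \<sigma>: "\<sigma> > 0" and clump: "\<And>s t. 0 \<le> s \<Longrightarrow> s \<le> t \<Longrightarrow> t \<le> 1 \<Longrightarrow> t - s \<le> \<sigma> \<Longrightarrow> pcount V {..<n} s t < 64"
    and big: "32 \<le> real n * h * \<delta>"
  shows "kap * \<sigma> / (2 * h) \<le> P"
proof -
  have "1 \<le> real n * h * \<delta>" using big by linarith
  then obtain a b where ab: "1 \<le> a" "a \<le> b" "b < n" "kap / h * (T (b + 1) - T a) \<le> P"
    "2 * (real n * h * \<delta>) \<le> real (b + 1) - real a + 1" by (rule P_lower)
  have r: "0 < T a" "T (b + 1) \<le> 1" "T a \<le> T (b + 1)" using T_range[of a] T_range[of "b + 1"] T_mono[of a "b + 1"] ab by auto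
  have "\<sigma> / 2 \<le> T (b + 1) - T a"
  proof (rule ccontr)
    assume neg: "\<not> \<sigma> / 2 \<le> T (b + 1) - T a"
    \<comment> \<open>Half of \<sigma> is spent to the left of \<open>T a\<close> and less than half
      between \<open>T a\<close> and \<open>T (b + 1)\<close>, so the interval is no longer than
      \<sigma> although it holds at least 2 * 32 = 64 points.\<close>
    define s where "s = max 0 (T a - \<sigma> / 2)"
    have s: "0 \<le> s" "s < T a" "T a - \<sigma> / 2 \<le> s" using r \<sigma> by (auto simp: s_def)
    have "pcount V {..<n} s (T (b + 1)) < 64" using s r neg by (intro clump) auto
    then show False using points_between[of a "b + 1" s] ab s big by linarith
  qed
  then have "kap / h * (\<sigma> / 2) \<le> kap / h * (T (b + 1) - T a)" using kap h_pos by (intro mult_left_mono) auto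
  moreover have "kap / h * (\<sigma> / 2) = kap * \<sigma> / (2 * h)" by simp
  ultimately show ?thesis using ab(4) by linarith
qed

end

end

section \<open>From uniform spacings to spacings of the bids\<close>

locale quantile_window = sample_window n V l d K L h u
  for n V l d K L h u +
  fixes Q q :: "real \<Rightarrow> real" and qmin qmax Cq :: real
  assumes Q_deriv: "\<And>x. x \<in> {0..1} \<Longrightarrow> (Q has_real_derivative q x) (at x within {0..1})"
    and qmin: "0 < qmin" and q_ge: "\<And>x. x \<in> {0..1} \<Longrightarrow> qmin \<le> q x"
    and q_le: "\<And>x. x \<in> {0..1} \<Longrightarrow> q x \<le> qmax"
    and q_lip: "\<And>x y. x \<in> {0..1} \<Longrightarrow> y \<in> {0..1} \<Longrightarrow> \<bar>q x - q y\<bar> \<le> Cq * \<bar>x - y\<bar>"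
    and Cq: "0 \<le> Cq"
begin

lemma Q_mvt:
  assumes "0 \<le> x" "x \<le> y" "y \<le> 1"
  obtains z where "x \<le> z" "z \<le> y" "Q y - Q x = q z * (y - x)"
proof -
  have "\<exists>z\<in>{x..y}. Q y - Q x = (\<lambda>t. q z * t) (y - x)"
  proof (rule mvt_very_simple[OF assms(2)])
    fix z assume z: "x \<le> z" "z \<le> y"
    have "(Q has_real_derivative q z) (at z within {x..y})"
      by (rule DERIV_subset[OF Q_deriv]) (use z assms in auto)
    then show "(Q has_derivative (\<lambda>t. q z * t)) (at z within {x..y})"
      by (simp add: has_field_derivative_def)
  qed
  then show ?thesis using that by auto
qed

lemma Q_lip:
  assumes "x \<in> {0..1}" "y \<in> {0..1}"
  shows "\<bar>Q x - Q y\<bar> \<le> qmax * \<bar>x - y\<bar>"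
proof -
  have *: "\<bar>Q y - Q x\<bar> \<le> qmax * \<bar>y - x\<bar>" if xy: "0 \<le> x" "x \<le> y" "y \<le> 1" for x y
  proof -
    obtain z where z: "x \<le> z" "z \<le> y" "Q y - Q x = q z * (y - x)" using Q_mvt[OF xy] by blast
    have zz: "z \<in> {0..1}" using z xy by auto
    have "\<bar>Q y - Q x\<bar> = q z * \<bar>y - x\<bar>" using z(3) q_ge[OF zz] qmin by (simp add: abs_mult)
    also have "\<dots> \<le> qmax * \<bar>y - x\<bar>" using q_le[OF zz] by (intro mult_right_mono) auto
    finally show ?thesis .
  qed
  show ?thesis using *[of x y] *[of y x] assms by (cases "x \<le> y") (auto simp: abs_minus_commute)
qed

definition qh :: real where "qh = (\<Sum>j=1..n - 1. k j * (Q (T (j + 1)) - Q (T j)))"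

lemma qh_ge: "qmin * P \<le> qh"
proof -
  have "qmin * P = (\<Sum>j=1..n - 1. k j * (qmin * (T (j + 1) - T j)))"
    unfolding P_def sum_distrib_left by (simp add: mult_ac)
  also have "\<dots> \<le> qh" unfolding qh_def
  proof (intro sum_mono mult_left_mono k_nonneg)
    fix j assume j: "j \<in> {1..n - 1}"
    have r: "0 \<le> T j" "T j \<le> T (j + 1)" "T (j + 1) \<le> 1"
      using T_step[of j] j by auto
    obtain z where z: "T j \<le> z" "z \<le> T (j + 1)" "Q (T (j + 1)) - Q (T j) = q z * (T (j + 1) - T j)"
      using Q_mvt[OF r] by blast
    show "qmin * (T (j + 1) - T j) \<le> Q (T (j + 1)) - Q (T j)"
      unfolding z(3) using z r by (intro mult_right_mono q_ge) auto
  qed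
  finally show ?thesis .
qed

text \<open>Where \<open>k j\<close> is nonzero, j/n is within h of u, hence the mean value point of
  the spacing is within h + (d + 1)/n of u. Weights and spacings are nonnegative, so the error is
  relative to \<open>P\<close>, which later cancels the \<open>P\<close> in the denominator.\<close>

lemma qh_close: "\<bar>qh - q u * P\<bar> \<le> Cq * (h + (d + 1) / real n) * P"
proof -
  define r where "r = h + (d + 1) / real n"
  have "\<bar>qh - q u * P\<bar> = \<bar>\<Sum>j=1..n - 1. k j * ((Q (T (j + 1)) - Q (T j)) - q u * (T (j + 1) - T j))\<bar>"
    unfolding qh_def P_def sum_distrib_left sum_subtractf[symmetric] by (simp add: algebra_simps)
  also have "\<dots> \<le> (\<Sum>j=1..n - 1. \<bar>k j * ((Q (T (j + 1)) - Q (T j)) - q u * (T (j + 1) - T j))\<bar>)"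
    by (rule sum_abs)
  also have "\<dots> \<le> (\<Sum>j=1..n - 1. k j * (Cq * r * (T (j + 1) - T j)))"
  proof (rule sum_mono)
    fix j assume j: "j \<in> {1..n - 1}"
    have rr: "0 \<le> T j" "T j \<le> T (j + 1)" "T (j + 1) \<le> 1"
      using T_step[of j] j by auto
    show "\<bar>k j * ((Q (T (j + 1)) - Q (T j)) - q u * (T (j + 1) - T j))\<bar> \<le> k j * (Cq * r * (T (j + 1) - T j))"
    proof (cases "k j = 0")
      case False
      have sup: "\<bar>u - real j / real n\<bar> < h" using k_supp[OF False] .
      obtain z where z: "T j \<le> z" "z \<le> T (j + 1)" "Q (T (j + 1)) - Q (T j) = q z * (T (j + 1) - T j)"
        using Q_mvt[OF rr] by blast
      have c1: "\<bar>T j - real j / real n\<bar> \<le> d / real n" using j by (intro T_close) auto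
      have c2: "\<bar>T (j + 1) - real (j + 1) / real n\<bar> \<le> d / real n" using j by (intro T_close) auto
      have e: "real (j + 1) / real n = real j / real n + 1 / real n" by (simp add: add_divide_distrib)
      have f: "(d + 1) / real n = d / real n + 1 / real n" by (simp add: add_divide_distrib)
      have g: "0 < 1 / real n" using n_pos by simp
      have "\<bar>z - u\<bar> \<le> r" unfolding r_def f using z c1 c2 sup g unfolding e by linarith
      moreover have "\<bar>q z - q u\<bar> \<le> Cq * \<bar>z - u\<bar>" using z rr u_ge u_le h_pos by (intro q_lip) auto
      ultimately have "\<bar>q z - q u\<bar> \<le> Cq * r" using Cq mult_left_mono[of "\<bar>z - u\<bar>" r Cq] by linarith
      then have "\<bar>(q z - q u) * (T (j + 1) - T j)\<bar> \<le> Cq * r * (T (j + 1) - T j)"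
        using rr by (simp add: abs_mult mult_right_mono)
      then have "\<bar>(Q (T (j + 1)) - Q (T j)) - q u * (T (j + 1) - T j)\<bar> \<le> Cq * r * (T (j + 1) - T j)"
        unfolding z(3) by (simp add: algebra_simps)
      then show ?thesis using k_nonneg[of j] by (simp add: abs_mult mult_left_mono)
    qed simp
  qed
  also have "\<dots> = Cq * r * P" unfolding P_def sum_distrib_left by (simp add: mult_ac)
  finally show ?thesis by (simp add: r_def)
qed

definition ui :: nat where "ui = nat \<lfloor>real n * u\<rfloor> + 1"

lemma ui: "1 \<le> ui" "ui \<le> n" "\<bar>T ui - u\<bar> \<le> (d + 1) / real n"
proof -
  have "real n * u < real n * 1" using n_pos u_le h_pos by (intro mult_strict_left_mono) auto
  moreover have "0 \<le> real n * u" using u_ge h_pos by simp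
  ultimately have i: "ui \<le> n" "real n * u < real ui" "real ui \<le> real n * u + 1" unfolding ui_def by linarith+
  show "1 \<le> ui" by (simp add: ui_def)
  show "ui \<le> n" by fact
  have "u \<le> real ui / real n" "real ui / real n \<le> u + 1 / real n" using i n_pos by (auto simp: field_simps)
  moreover have "\<bar>T ui - real ui / real n\<bar> \<le> d / real n" using i by (intro T_close) (auto simp: ui_def)
  ultimately show "\<bar>T ui - u\<bar> \<le> (d + 1) / real n" unfolding add_divide_distrib by linarith
qed

lemma Q_ui: "\<bar>Q (T ui) - Q u\<bar> \<le> qmax * ((d + 1) / real n)" "\<bar>Q (T ui) - Q u\<bar> \<le> qmax"
proof -
  have r: "T ui \<in> {0..1}" "u \<in> {0..1}" using T_range[OF ui(1,2)] u_ge u_le h_pos by auto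
  have qm: "0 \<le> qmax" using q_ge[OF r(2)] q_le[OF r(2)] qmin by linarith
  have 1: "\<bar>Q (T ui) - Q u\<bar> \<le> qmax * \<bar>T ui - u\<bar>" using r by (rule Q_lip)
  show "\<bar>Q (T ui) - Q u\<bar> \<le> qmax * ((d + 1) / real n)"
    using 1 mult_left_mono[OF ui(3) qm] by linarith
  have "\<bar>T ui - u\<bar> \<le> 1" using r by auto
  then show "\<bar>Q (T ui) - Q u\<bar> \<le> qmax" using 1 mult_left_mono[of "\<bar>T ui - u\<bar>" 1 qmax] qm by linarith
qed

text \<open>The quantity \<open>R_n(u) / sqrt (n * h)\<close> of the theorem, with \<open>a = A(u)\<close>; note that \<open>kde - 1\<close> is
  \<open>G_{n,h}(u) / sqrt (n * h)\<close>.\<close>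

definition remainder :: "real \<Rightarrow> real" where
  "remainder a = (Q (T ui) + a * qh - (Q u + a * q u)) / qh + a * (kde - 1)"

text \<open>The remainder splits into the error of the sample quantile divided by \<open>qh\<close>,
  the comparison of \<open>kde\<close> with 1/P, and that of 1/P with
  \<open>q u / qh\<close>.\<close>

lemma remainder_regular:
  assumes a: "\<bar>a\<bar> \<le> CA" and c: "0 < c" "c \<le> P"
    and e: "\<bar>P - 1 + (kde - 1)\<bar> \<le> E" and g: "\<bar>kde - 1\<bar> \<le> G"
  shows "\<bar>remainder a\<bar> \<le> qmax * ((d + 1) / real n) / (qmin * c)
    + CA * ((G\<^sup>2 + E * (1 + G)) / c + Cq * (h + (d + 1) / real n) / (qmin * c))"
proof -
  have CA: "CA \<ge> 0" using a by linarith
  have EG: "E \<ge> 0" "G \<ge> 0" using e g by linarith+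
  have P: "P > 0" using c by linarith
  have "qmin * c \<le> qmin * P" using c qmin by simp
  then have qc: "qmin * c \<le> qh" using qh_ge by linarith
  have qc0: "0 < qmin * c" using qmin c by simp
  have qh0: "qh > 0" using qc qc0 by linarith
  have eq: "remainder a = (Q (T ui) - Q u) / qh + a * (kde - q u / qh)"
    using qh0 unfolding remainder_def by (simp add: field_simps)
  have 1: "\<bar>(Q (T ui) - Q u) / qh\<bar> \<le> qmax * ((d + 1) / real n) / (qmin * c)"
    unfolding abs_divide using Q_ui(1) qc qc0 qh0 by (intro frac_le) auto
  have 2: "\<bar>kde - 1 / P\<bar> \<le> (G\<^sup>2 + E * (1 + G)) / c"
  proof -
    define gg where "gg = kde - 1"
    define ee where "ee = P - 1 + gg"
    have "kde - 1 / P = (kde * P - 1) / P" using P by (simp add: field_simps)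
    also have "kde * P - 1 = ee * (1 + gg) - gg\<^sup>2"
      unfolding ee_def gg_def by (simp add: algebra_simps power2_eq_square)
    finally have "\<bar>kde - 1 / P\<bar> = \<bar>ee * (1 + gg) - gg\<^sup>2\<bar> / P" using P by (simp add: abs_divide)
    also have "\<dots> \<le> (G\<^sup>2 + E * (1 + G)) / c"
    proof (rule frac_le)
      have "\<bar>ee * (1 + gg) - gg\<^sup>2\<bar> \<le> \<bar>ee\<bar> * \<bar>1 + gg\<bar> + \<bar>gg\<bar>\<^sup>2"
        using abs_triangle_ineq4[of "ee * (1 + gg)" "gg\<^sup>2"] by (simp add: abs_mult)
      also have "\<dots> \<le> E * (1 + G) + G\<^sup>2"
        using e g EG unfolding ee_def gg_def by (intro add_mono mult_mono power_mono) auto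
      finally show "\<bar>ee * (1 + gg) - gg\<^sup>2\<bar> \<le> G\<^sup>2 + E * (1 + G)" by simp
    qed (use c EG in auto)
    finally show ?thesis .
  qed
  have 3: "\<bar>1 / P - q u / qh\<bar> \<le> Cq * (h + (d + 1) / real n) / (qmin * c)"
  proof -
    have "1 / P - q u / qh = (qh - q u * P) / (P * qh)" using P qh0 by (simp add: field_simps)
    then have "\<bar>1 / P - q u / qh\<bar> = \<bar>qh - q u * P\<bar> / (P * qh)" using P qh0 by (simp add: abs_divide)
    also have "\<dots> \<le> (Cq * (h + (d + 1) / real n) * P) / (P * (qmin * c))"
      using qh_close qc qc0 P by (intro frac_le) auto
    also have "\<dots> = Cq * (h + (d + 1) / real n) / (qmin * c)" using P by simp
    finally show ?thesis .
  qed
  have "\<bar>kde - q u / qh\<bar> \<le> (G\<^sup>2 + E * (1 + G)) / c + Cq * (h + (d + 1) / real n) / (qmin * c)"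
    using 2 3 by linarith
  then have "\<bar>a * (kde - q u / qh)\<bar> \<le> CA * ((G\<^sup>2 + E * (1 + G)) / c + Cq * (h + (d + 1) / real n) / (qmin * c))"
    unfolding abs_mult using a CA by (intro mult_mono) auto
  then show ?thesis unfolding eq using 1 by linarith
qed

text \<open>No cancellation between \<open>kde\<close> and \<open>q u / qh\<close> is used here:
  each piece is bounded separately, since c may be tiny.\<close>

lemma remainder_crude:
  assumes a: "\<bar>a\<bar> \<le> CA" and c: "0 < c" "c \<le> P"
  shows "\<bar>remainder a\<bar> \<le> qmax * (1 + CA) / (qmin * c) + CA * (2 + 146 * L * l)"
proof -
  have CA: "CA \<ge> 0" using a by linarith
  have "qmin * c \<le> qmin * P" using c qmin by simp
  then have qc: "qmin * c \<le> qh" using qh_ge by linarith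
  have qc0: "0 < qmin * c" using qmin c by simp
  have qh0: "qh > 0" using qc qc0 by linarith
  have uu: "u \<in> {0..1}" using u_ge u_le h_pos by auto
  have eq: "remainder a = (Q (T ui) - Q u) / qh - a * (q u / qh) + a * kde"
    using qh0 unfolding remainder_def by (simp add: field_simps)
  have 1: "\<bar>(Q (T ui) - Q u) / qh\<bar> \<le> qmax / (qmin * c)"
    unfolding abs_divide using Q_ui(2) qc qc0 qh0 by (intro frac_le) auto
  have qu: "\<bar>q u / qh\<bar> \<le> qmax / (qmin * c)"
    unfolding abs_divide using q_ge[OF uu] q_le[OF uu] qmin qc qc0 qh0 by (intro frac_le) auto
  have 2: "\<bar>a * (q u / qh)\<bar> \<le> CA * (qmax / (qmin * c))"
    unfolding abs_mult using a CA qu by (intro mult_mono) auto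
  have 3: "\<bar>a * kde\<bar> \<le> CA * (2 + 146 * L * l)"
    unfolding abs_mult using a CA kde_crude kde_nonneg by (intro mult_mono) auto
  have "\<bar>remainder a\<bar> \<le> qmax / (qmin * c) + CA * (qmax / (qmin * c)) + CA * (2 + 146 * L * l)"
    unfolding eq using 1 2 3 by linarith
  also have "\<dots> = qmax * (1 + CA) / (qmin * c) + CA * (2 + 146 * L * l)"
    by (simp add: distrib_left add_divide_distrib mult.commute)
  finally show ?thesis .
qed

end

section \<open>Comparison with the rate\<close>

definition rate :: "nat \<Rightarrow> real \<Rightarrow> real" where
  "rate n h = sqrt (real n) * h powr (3/2) + sqrt h + h powr (-1/2) * real n powr (-1/4) * ell n"

locale rate_bounds =
  fixes n :: nat and h :: real
  assumes n_pos: "n > 0" and h_pos: "h > 0" and l_ge: "1 \<le> ln (real n)" and ll_ge: "1 \<le> ln (ln (real n))"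
    and l_le_m: "ln (real n) \<le> real n powr (1/4)"
begin

text \<open>With this fourth root, sqrt(n h) = m^2 sqrt h and the third summand of the rate is ell n
  / (m sqrt h), so the comparisons need no further rules for powers of n.\<close>

definition m :: real where "m = real n powr (1/4)"

lemma m: "1 \<le> m" "m * m = sqrt (real n)" "m * m * (m * m) = real n"
proof -
  show "1 \<le> m" using l_ge l_le_m by (simp add: m_def)
  have "m * m = real n powr (1/2)" unfolding m_def by (simp add: powr_add[symmetric])
  then show 1: "m * m = sqrt (real n)" by (simp add: powr_half_sqrt)
  show "m * m * (m * m) = real n" unfolding 1 by simp
qed

lemma ell_facts: "ell n * ell n = ln (real n) * sqrt (ln (ln (real n)))" "1 \<le> ell n"
  "sqrt (ln (ln (real n))) \<le> ell n"
proof -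
  have "ln (ln (real n)) powr (1/4) * ln (ln (real n)) powr (1/4) = ln (ln (real n)) powr (1/2)"
    by (simp add: powr_add[symmetric])
  then have "ln (ln (real n)) powr (1/4) * ln (ln (real n)) powr (1/4) = sqrt (ln (ln (real n)))"
    using ll_ge by (simp add: powr_half_sqrt)
  moreover have "sqrt (ln (real n)) * sqrt (ln (real n)) = ln (real n)" using l_ge by simp
  ultimately show sq: "ell n * ell n = ln (real n) * sqrt (ln (ln (real n)))"
    unfolding ell_def by (metis mult.commute mult.left_commute)
  have e0: "0 \<le> ell n" unfolding ell_def using l_ge by simp
  have s1: "1 \<le> sqrt (ln (ln (real n)))" using ll_ge by simp
  have ll: "ln (ln (real n)) \<le> ln (real n)" using ln_less_self[of "ln (real n)"] l_ge by linarith
  have "1 * 1 \<le> ln (real n) * sqrt (ln (ln (real n)))" using l_ge s1 by (intro mult_mono) auto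
  then have "1\<^sup>2 \<le> (ell n)\<^sup>2" using sq by (simp add: power2_eq_square)
  then show "1 \<le> ell n" using e0 by (rule power2_le_imp_le)
  have "ln (ln (real n)) * 1 \<le> ln (real n) * sqrt (ln (ln (real n)))" using ll ll_ge l_ge s1 by (intro mult_mono) auto
  then have "(sqrt (ln (ln (real n))))\<^sup>2 \<le> (ell n)\<^sup>2" using sq ll_ge by (simp add: power2_eq_square)
  then show "sqrt (ln (ln (real n))) \<le> ell n" using e0 by (rule power2_le_imp_le)
qed

lemma rate_ge: "sqrt (real n) * (h * sqrt h) \<le> rate n h" "sqrt h \<le> rate n h" "ell n / (m * sqrt h) \<le> rate n h"
proof -
  have 1: "h powr (3/2) = h * sqrt h"
  proof -
    have "h powr (3/2) = h powr (1 + 1/2)" by simp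
    then show ?thesis using h_pos unfolding powr_add by (simp add: powr_half_sqrt)
  qed
  have "h powr (-(1/2)) = 1 / sqrt h"
    using h_pos unfolding powr_minus_divide by (simp add: powr_half_sqrt)
  moreover have "real n powr (-(1/4)) = 1 / m"
    unfolding powr_minus_divide m_def by simp
  ultimately have 2: "h powr (-1/2) * real n powr (-1/4) * ell n = ell n / (m * sqrt h)" by simp
  have pos: "0 \<le> sqrt (real n) * (h * sqrt h)" "0 \<le> sqrt h" "0 \<le> ell n / (m * sqrt h)"
    using h_pos m(1) ell_facts(2) by auto
  show "sqrt (real n) * (h * sqrt h) \<le> rate n h" "sqrt h \<le> rate n h" "ell n / (m * sqrt h) \<le> rate n h"
    unfolding rate_def 1 2 using pos by linarith+
qed

lemma sqrt_nh: "sqrt (real n * h) = m * m * sqrt h"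
  unfolding real_sqrt_mult m(2)[symmetric] ..

text \<open>After scaling, an error a / (n h) becomes a / (m^2 sqrt h), which is below the third
  summand of the rate as soon as a <= m * ell n.\<close>

lemma third_term: "m * ell n \<ge> a \<Longrightarrow> sqrt (real n * h) * (a / (real n * h)) \<le> rate n h"
proof -
  assume a: "m * ell n \<ge> a"
  have sh: "sqrt h * sqrt h = h" using h_pos by simp
  have "sqrt (real n * h) * (a / (real n * h)) = (m * m * sqrt h) * (a / ((m * m * (m * m)) * (sqrt h * sqrt h)))"
    unfolding sqrt_nh m(3) sh ..
  also have "\<dots> = a / (m * m * sqrt h)" using m(1) h_pos by (simp add: field_simps)
  also have "\<dots> \<le> (m * ell n) / (m * m * sqrt h)" using a m(1) h_pos by (intro divide_right_mono) auto
  also have "\<dots> = ell n / (m * sqrt h)" using m(1) by simp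
  also have "\<dots> \<le> rate n h" by (rule rate_ge)
  finally show ?thesis .
qed

lemma log_term: "sqrt (real n * h) * (ln (real n) / (real n * h)) \<le> rate n h"
proof (rule third_term)
  have "ln (real n) * 1 \<le> m * ell n" using l_le_m ell_facts(2) l_ge unfolding m_def by (intro mult_mono) auto
  then show "ln (real n) \<le> m * ell n" by simp
qed

lemma one_term: "sqrt (real n * h) * (1 / (real n * h)) \<le> rate n h"
  using mult_mono[of 1 m 1 "ell n"] m(1) ell_facts(2) by (intro third_term) auto

lemma bandwidth_term: "sqrt (real n * h) * h \<le> rate n h"
  using rate_ge(1) by (simp add: real_sqrt_mult mult_ac)

context
  fixes C0 d :: real
  assumes C0: "C0 \<ge> 0" and d: "d = C0 * sqrt (real n * ln (ln (real n)))"
begin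

lemma d_le: "d + 1 \<le> (C0 + 1) * (m * m * sqrt (ln (ln (real n))))" "0 \<le> d"
proof -
  have "1 * 1 * 1 \<le> m * m * sqrt (ln (ln (real n)))" using m(1) ll_ge by (intro mult_mono) auto
  moreover have "sqrt (real n * ln (ln (real n))) = m * m * sqrt (ln (ln (real n)))"
    unfolding real_sqrt_mult m(2) ..
  ultimately show "d + 1 \<le> (C0 + 1) * (m * m * sqrt (ln (ln (real n))))" unfolding d by (simp add: distrib_right)
  show "0 \<le> d" unfolding d using C0 ll_ge by simp
qed

text \<open>The term is of order \<open>sqrt (h * ln (ln n))\<close>, which exceeds the summand \<open>sqrt h\<close> of the rate; it is
  absorbed by the first summand if \<open>h \<ge> n powr (-1/4)\<close> and by the third one otherwise.\<close>

lemma discrepancy_term: "sqrt (real n * h) * ((d + 1) / real n) \<le> (C0 + 1) * rate n h"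
proof -
  define s where "s = sqrt (ln (ln (real n)))"
  have s: "1 \<le> s" using ll_ge by (simp add: s_def)
  have sm: "s \<le> m"
  proof -
    have "s \<le> ln (ln (real n))" using ll_ge unfolding s_def by (intro real_le_lsqrt) (auto simp: power2_eq_square)
    also have "\<dots> \<le> ln (real n)" using ln_less_self[of "ln (real n)"] l_ge by linarith
    also have "\<dots> \<le> m" using l_le_m by (simp add: m_def)
    finally show ?thesis .
  qed
  have key: "sqrt h * s \<le> rate n h"
  proof (cases "h \<ge> 1 / m")
    case True
    then have "1 \<le> h * m" using m(1) by (simp add: field_simps)
    then have "m * 1 \<le> m * (h * m)" using m(1) by (intro mult_left_mono) auto
    then have "s \<le> sqrt (real n) * h" using sm unfolding m(2)[symmetric] by (simp add: mult_ac)
    then have "sqrt h * s \<le> sqrt h * (sqrt (real n) * h)" using h_pos by (intro mult_left_mono) auto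
    also have "\<dots> \<le> rate n h" using rate_ge(1) by (simp add: mult_ac)
    finally show ?thesis .
  next
    case False
    then have "h \<le> 1 / m" by simp
    then have "h * s \<le> 1 / m * ell n" using ell_facts h_pos s m(1) unfolding s_def by (intro mult_mono) auto
    then have "h * s / sqrt h \<le> (1 / m * ell n) / sqrt h" using h_pos by (intro divide_right_mono) auto
    moreover have "h * s / sqrt h = sqrt h * s" using h_pos by (simp add: field_simps real_sqrt_mult_self)
    ultimately have "sqrt h * s \<le> ell n / (m * sqrt h)" by simp
    then show ?thesis using rate_ge(3) by linarith
  qed
  have "sqrt (real n * h) * ((d + 1) / real n) \<le> (m * m * sqrt h) * ((C0 + 1) * (m * m * s) / (m * m * (m * m)))"
    unfolding sqrt_nh m(3) using d_le h_pos m(1) by (intro mult_left_mono divide_right_mono) (auto simp: s_def)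
  also have "\<dots> = (C0 + 1) * (sqrt h * s)" using m(1) by (simp add: field_simps)
  also have "\<dots> \<le> (C0 + 1) * rate n h" using key C0 by (intro mult_left_mono) auto
  finally show ?thesis .
qed

text \<open>Since d is of order m^2 sqrt(ln ln n) and ell^2 = ln n * sqrt(ln ln n), the product d *
  ln n is of order (m * ell n)^2. This identity dictates the exponent 1/4 of ln ln n in
  \<open>ell\<close>.\<close>

lemma Bahadur_Kiefer_term:
  "sqrt (real n * h) * (1 / h * ((14 * (sqrt ((d + 1) * ln (real n)) + ln (real n)) + 1) / real n))
    \<le> (14 * sqrt (C0 + 1) + 15) * rate n h"
proof -
  define s where "s = sqrt (ln (ln (real n)))"
  have s: "1 \<le> s" using ll_ge by (simp add: s_def)
  have me: "1 \<le> m * ell n" using mult_mono[of 1 m 1 "ell n"] m(1) ell_facts(2) by simp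
  have "ln (real n) * 1 \<le> m * ell n" using l_le_m ell_facts(2) l_ge unfolding m_def by (intro mult_mono) auto
  then have l: "ln (real n) \<le> m * ell n" by simp
  have "(d + 1) * ln (real n) \<le> (C0 + 1) * (m * m * s) * ln (real n)"
    using d_le l_ge by (intro mult_right_mono) (auto simp: s_def)
  also have "\<dots> = (C0 + 1) * (m * ell n)\<^sup>2"
    using ell_facts(1) by (simp add: power2_eq_square s_def mult_ac)
  finally have "sqrt ((d + 1) * ln (real n)) \<le> sqrt ((C0 + 1) * (m * ell n)\<^sup>2)" by (rule real_sqrt_le_mono)
  also have "\<dots> = sqrt (C0 + 1) * (m * ell n)" using me by (simp add: real_sqrt_mult)
  finally have X: "14 * (sqrt ((d + 1) * ln (real n)) + ln (real n)) + 1 \<le> (14 * sqrt (C0 + 1) + 15) * (m * ell n)"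
    using l me by (simp add: algebra_simps)
  define X where "X = 14 * (sqrt ((d + 1) * ln (real n)) + ln (real n)) + 1"
  define c where "c = 14 * sqrt (C0 + 1) + 15"
  have c: "c > 0" using C0 by (simp add: c_def add_nonneg_pos)
  have "X \<le> c * (m * ell n)" using X unfolding X_def c_def .
  then have "sqrt (real n * h) * ((X / c) / (real n * h)) \<le> rate n h"
    using c by (intro third_term) (simp add: pos_divide_le_eq mult.commute)
  then have "c * (sqrt (real n * h) * ((X / c) / (real n * h))) \<le> c * rate n h" using c by (intro mult_left_mono) auto
  moreover have "c * (sqrt (real n * h) * ((X / c) / (real n * h))) = sqrt (real n * h) * (1 / h * (X / real n))"
    using c by simp
  ultimately show ?thesis by (simp add: X_def c_def)
qed

end

text \<open>Put r = n^(1/16), so m = r^4, and w = n h <= r. Writing sqrt w * Y as w Y / sqrt w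
  reduces the claim to w Y being at most a multiple of m, and the worst product is w * (w r) <=
  r^3.\<close>

lemma crude_term:
  assumes w: "1 \<le> real n * h" "real n * h \<le> real n powr (1/16)" and l: "ln (real n) \<le> real n powr (1/16)"
    and a: "a0 \<ge> 0" "a1 \<ge> 0" "a2 \<ge> 0"
  shows "sqrt (real n * h) * (a0 * (h * real n powr (17/16)) + a1 + a2 * ln (real n)) \<le> (a0 + a1 + a2) * rate n h"
proof -
  define r where "r = real n powr (1/16)"
  define w where "w = real n * h"
  have r: "1 \<le> r" using l l_ge by (simp add: r_def)
  have mr: "m = r * (r * (r * r))" unfolding m_def r_def by (simp add: powr_add[symmetric])
  have "real n powr (17/16) = real n powr (1 + 1/16)" by simp
  then have hw: "h * real n powr (17/16) = w * r" unfolding powr_add using n_pos by (simp add: w_def r_def)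
  have bnd: "w * (a0 * (w * r) + a1 + a2 * ln (real n)) \<le> (a0 + a1 + a2) * m"
  proof -
    have wr: "0 \<le> w" "w \<le> r" using w by (auto simp: w_def r_def)
    have r2: "1 \<le> r * r" "1 \<le> r * (r * r)" using r mult_mono[of 1 r 1 r] mult_mono[of 1 r 1 "r * r"] by auto
    have "w * (w * r) \<le> r * (r * r)" using wr r by (intro mult_mono) auto
    also have "\<dots> \<le> r * (r * (r * r))" using r mult_left_mono[of 1 r "r * (r * r)"] r2 by (simp add: mult_ac)
    finally have 1: "w * (w * r) \<le> m" by (simp add: mr)
    have "w * 1 \<le> r * (r * (r * r))" using wr r r2 by (intro mult_mono) auto
    then have 2: "w \<le> m" by (simp add: mr)
    have "w * ln (real n) \<le> r * r" using wr r l l_ge by (intro mult_mono) (auto simp: r_def)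
    also have "\<dots> \<le> r * (r * (r * r))" using r r2 mult_left_mono[of 1 "r * r" "r * r"] by (simp add: mult_ac)
    finally have 3: "w * ln (real n) \<le> m" by (simp add: mr)
    have "w * (a0 * (w * r) + a1 + a2 * ln (real n)) = a0 * (w * (w * r)) + a1 * w + a2 * (w * ln (real n))"
      by (simp add: algebra_simps)
    also have "\<dots> \<le> a0 * m + a1 * m + a2 * m" using 1 2 3 a by (intro add_mono mult_left_mono) auto
    finally show ?thesis by (simp add: distrib_right)
  qed
  define Y where "Y = a0 * (w * r) + a1 + a2 * ln (real n)"
  have w0: "w > 0" using w by (simp add: w_def)
  have "sqrt w * Y \<le> (a0 + a1 + a2) * (ell n / (m * sqrt h))"
  proof -
    have "sqrt w * Y = w * Y / sqrt w" using w0 by (simp add: field_simps real_sqrt_mult_self)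
    also have "\<dots> \<le> ((a0 + a1 + a2) * m) / sqrt w" using bnd w0 unfolding Y_def by (intro divide_right_mono) auto
    also have "\<dots> = (a0 + a1 + a2) * (1 / (m * sqrt h))"
      unfolding w_def sqrt_nh using m(1) by simp
    also have "\<dots> \<le> (a0 + a1 + a2) * (ell n / (m * sqrt h))"
      using a ell_facts(2) m(1) h_pos by (intro mult_left_mono divide_right_mono) auto
    finally show ?thesis .
  qed
  also have "\<dots> \<le> (a0 + a1 + a2) * rate n h" using rate_ge(3) a by (intro mult_left_mono) auto
  finally show ?thesis unfolding Y_def w_def[symmetric] using hw by simp
qed

end

text \<open>C1 serves the sizes with n h <= n^(1/16) and C2 the others; their sum is needed because
  the bandwidth may switch between the two regimes infinitely often. The existence of the locale
  parameters is part of the conclusion so that the remainder can afterwards be unfolded.\<close>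

lemma deterministic_expansion:
  fixes V :: "nat \<Rightarrow> real" and K Q q A :: "real \<Rightarrow> real" and h :: "nat \<Rightarrow> real"
  assumes V: "\<And>i. 0 < V i" "\<And>i. V i \<le> 1"
    and C0: "C0 \<ge> 0" and disc: "\<forall>\<^sub>F n in sequentially. \<forall>x\<in>{0..1}. \<bar>pcount V {..<n} 0 x - real n * x\<bar> \<le> C0 * sqrt (real n * ln (ln (real n)))"
    and osc: "\<forall>\<^sub>F n in sequentially. \<forall>s t. 0 \<le> s \<longrightarrow> s \<le> t \<longrightarrow> t \<le> 1 \<longrightarrow>
     \<bar>pcount V {..<n} s t - real n * (t - s)\<bar> \<le> 14 * (sqrt (real n * (t - s) * ln (real n)) + ln (real n))"
    and clump: "\<forall>\<^sub>F n in sequentially. \<forall>s t. 0 \<le> s \<longrightarrow> s \<le> t \<longrightarrow> t \<le> 1 \<longrightarrow> t - s \<le> real n powr (-17/16) \<longrightarrow> pcount V {..<n} s t < 64"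
    and L: "L > 0" and K_lip: "\<And>x y. \<bar>K x - K y\<bar> \<le> L * \<bar>x - y\<bar>" and K_nonneg: "\<And>x. K x \<ge> 0"
    and K_supp: "\<And>x. \<bar>x\<bar> \<ge> 1 \<Longrightarrow> K x = 0"
    and kap: "kap > 0" "\<delta> > 0" "\<And>z. \<bar>z - x0\<bar> \<le> \<delta> \<Longrightarrow> kap \<le> K z"
    and bandwidth_pos: "\<And>n. h n > 0"
    and nh_lim: "filterlim (\<lambda>n. real n * h n) at_top sequentially"
    and Q_deriv: "\<And>x. x \<in> {0..1} \<Longrightarrow> (Q has_real_derivative q x) (at x within {0..1})"
    and qmin: "0 < qmin" and q_ge: "\<And>x. x \<in> {0..1} \<Longrightarrow> qmin \<le> q x"
    and q_le: "\<And>x. x \<in> {0..1} \<Longrightarrow> q x \<le> qmax"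
    and q_lip: "\<And>x y. x \<in> {0..1} \<Longrightarrow> y \<in> {0..1} \<Longrightarrow> \<bar>q x - q y\<bar> \<le> Cq * \<bar>x - y\<bar>"
    and Cq: "0 \<le> Cq"
    and A: "\<And>x. x \<in> {0..1} \<Longrightarrow> \<bar>A x\<bar> \<le> CA"
    and rho: "\<And>n u. kernel_window n K L (h n) u \<Longrightarrow> \<bar>kernel_window.rho n K (h n) u - 1\<bar> \<le> 3 * L / (real n * h n)"
  shows "\<exists>C. \<forall>\<^sub>F n in sequentially. \<forall>u\<in>{h n..1 - h n}.
     (\<exists>l d. quantile_window n V l d K L (h n) u Q q qmin qmax Cq) \<and>
     \<bar>sqrt (real n * h n) * quantile_window.remainder n V K (h n) u Q q (A u)\<bar> \<le> C * rate n (h n)"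
proof -
  have CA: "CA \<ge> 0" using A[of 0] by auto
  have qmax: "qmax > 0" using q_ge[of 0] q_le[of 0] qmin by auto
  define c where "c = kap * \<delta> / 2"
  have c: "c > 0" using kap by (simp add: c_def)
  define Cx where "Cx = 14 * sqrt (C0 + 1) + 15"
  define C1 where "C1 = 2 * qmax * (1 + CA) / (qmin * kap) + 2 * CA + 146 * CA * L"
  define C2 where "C2 = qmax / (qmin * c) * (C0 + 1)
     + CA / c * ((216 * L)\<^sup>2 + (1 + 216 * L) * (4 * L * Cx + 51 * L)) + CA * Cq / (qmin * c) * (1 + (C0 + 1))"
  have C12: "C1 \<ge> 0" "C2 \<ge> 0"
    unfolding C1_def C2_def Cx_def using qmax qmin kap c CA L C0 Cq by (auto intro!: add_nonneg_nonneg mult_nonneg_nonneg)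
  have ev1: "\<forall>\<^sub>F n in sequentially. 1 \<le> ln (ln (real n))"  by real_asymp
  have ev2: "\<forall>\<^sub>F n in sequentially. ln (real n) \<le> real n powr (1/4)" by real_asymp
  have ev3: "\<forall>\<^sub>F n in sequentially. ln (real n) \<le> real n powr (1/16)" by real_asymp
  \<comment> \<open>The factors 65/\<delta> here and 32/\<delta> below are the thresholds of the two
    lower bounds for \<open>P\<close>.\<close>
  have ev4: "\<forall>\<^sub>F n in sequentially. 65 / \<delta> * ln (real n) \<le> real n powr (1/16)" by real_asymp
  have ev5: "\<forall>\<^sub>F n in sequentially. 1 \<le> real n * h n" using nh_lim by (simp add: filterlim_at_top)
  have ev6: "\<forall>\<^sub>F n in sequentially. 32 / \<delta> \<le> real n * h n" using nh_lim by (simp add: filterlim_at_top)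
  have ev7: "\<forall>\<^sub>F n in sequentially. 1 \<le> ln (real n)"  by real_asymp
  have "\<forall>\<^sub>F n in sequentially. \<forall>u\<in>{h n..1 - h n}.
     (\<exists>l d. quantile_window n V l d K L (h n) u Q q qmin qmax Cq) \<and>
     \<bar>sqrt (real n * h n) * quantile_window.remainder n V K (h n) u Q q (A u)\<bar> \<le> (C1 + C2) * rate n (h n)"
    using disc osc clump ev1 ev2 ev3 ev4 ev5 ev6 ev7 eventually_gt_at_top[of 0]
  proof eventually_elim
    case (elim n)
    interpret rate_bounds n "h n"
      using elim bandwidth_pos by unfold_locales auto
    have rate0: "rate n (h n) \<ge> 0" using rate_ge(2) bandwidth_pos[of n] by (smt (verit) real_sqrt_gt_zero)
    define d where "d = C0 * sqrt (real n * ln (ln (real n)))"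
    define sw where "sw = sqrt (real n * h n)"
    have sw: "sw \<ge> 0" using bandwidth_pos[of n] by (simp add: sw_def)
    show ?case
    proof
      fix u assume u: "u \<in> {h n..1 - h n}"
      interpret OS: ordered_sample n V using V elim by unfold_locales auto
      interpret W: quantile_window n V "ln (real n)" d K L "h n" u Q q qmin qmax Cq
      proof unfold_locales
        show "0 \<le> d" unfolding d_def using elim C0 by simp
        show "\<bar>OS.N x - real n * x\<bar> \<le> d" if "0 \<le> x" "x \<le> 1" for x
          using elim(1) that unfolding OS.N_def d_def by simp
        show "\<bar>pcount V {..<n} s t - real n * (t - s)\<bar> \<le> 14 * (sqrt (real n * (t - s) * ln (real n)) + ln (real n))"
          if "0 \<le> s" "s \<le> t" "t \<le> 1" for s t using elim(2) that by simp
      qed (use elim u L K_lip K_nonneg K_supp bandwidth_pos Q_deriv qmin q_ge q_le q_lip Cq in auto)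
      have uu: "u \<in> {0..1}" using u bandwidth_pos[of n] by auto
      have a: "\<bar>A u\<bar> \<le> CA" using A[OF uu] .
      have "sw * \<bar>W.remainder (A u)\<bar> \<le> (C1 + C2) * rate n (h n)"
      proof (cases "real n * h n \<le> real n powr (1/16)")
        case True
        define \<sigma> where "\<sigma> = real n powr (-17/16)"
        have \<sigma>: "\<sigma> > 0" using elim by (simp add: \<sigma>_def)
        have "kap * \<sigma> / (2 * h n) \<le> W.P"
        proof (rule W.P_lower_no_clumps[OF kap \<sigma>])
          show "pcount V {..<n} s t < 64" if "0 \<le> s" "s \<le> t" "t \<le> 1" "t - s \<le> \<sigma>" for s t
            using elim(3) that by (simp add: \<sigma>_def)
          show "32 \<le> real n * h n * \<delta>" using elim(9) kap by (simp add: field_simps)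
        qed
        then have "\<bar>W.remainder (A u)\<bar> \<le> qmax * (1 + CA) / (qmin * (kap * \<sigma> / (2 * h n))) + CA * (2 + 146 * L * ln (real n))"
          using kap \<sigma> bandwidth_pos[of n] by (intro W.remainder_crude a) auto
        also have "\<dots> = 2 * qmax * (1 + CA) / (qmin * kap) * (h n * real n powr (17/16)) + 2 * CA + 146 * CA * L * ln (real n)"
        proof -
          have p: "real n powr (17/16) = 1 / \<sigma>" unfolding \<sigma>_def using powr_minus_divide[of "real n" "-17/16"] by simp
          show ?thesis unfolding p using qmin kap(1) \<sigma> by (simp add: field_simps)
        qed
        finally have "sw * \<bar>W.remainder (A u)\<bar> \<le> sw * (2 * qmax * (1 + CA) / (qmin * kap) * (h n * real n powr (17/16)) + 2 * CA + 146 * CA * L * ln (real n))"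
          using sw by (rule mult_left_mono)
        also have "\<dots> \<le> C1 * rate n (h n)" unfolding C1_def sw_def
          using True elim qmax qmin kap CA L by (intro crude_term) auto
        finally show ?thesis using C12 rate0 by (simp add: distrib_right add_increasing2)
      next
        case False
        define w where "w = real n * h n"
        have big: "real n powr (1/16) \<le> w" using False by (simp add: w_def)
        have lw: "ln (real n) \<le> w" using big elim by linarith
        have w: "w > 0" using elim by (simp add: w_def)
        have "65 / \<delta> * ln (real n) \<le> w" using big elim by linarith
        then have "65 * ln (real n) \<le> w * \<delta>" using kap by (simp add: field_simps)
        then have P: "c \<le> W.P" unfolding c_def using kap by (intro W.P_lower_regular) (auto simp: w_def)
        have rho': "\<bar>W.rho - 1\<bar> \<le> 3 * L / (real n * h n)" by (rule rho) unfold_locales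
        define G where "G = 216 * L * sqrt (ln (real n) / w)"
        define BK where "BK = (14 * (sqrt ((d + 1) * ln (real n)) + ln (real n)) + 1) / real n"
        define E where "E = 4 * L / h n * BK + 51 * L / w"
        have g: "\<bar>W.kde - 1\<bar> \<le> G" unfolding G_def w_def using lw rho' by (intro W.kde_deviation) (auto simp: w_def)
        have e: "\<bar>W.P - 1 + (W.kde - 1)\<bar> \<le> E" unfolding E_def BK_def w_def
          using lw rho' by (intro W.linearization_error) (auto simp: w_def)
        have E0: "E \<ge> 0" using e by linarith
        have "sqrt (ln (real n) / w) \<le> 1" using lw w by simp
        then have G1: "G \<le> 216 * L" unfolding G_def using L by simp
        have G2: "G\<^sup>2 = (216 * L)\<^sup>2 * (ln (real n) / w)"
          unfolding G_def power_mult_distrib using w elim(10) by simp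
        have b1: "sw * ((d + 1) / real n) \<le> (C0 + 1) * rate n (h n)"
          unfolding sw_def by (rule discrepancy_term[OF C0 d_def])
        have b2: "sw * (1 / h n * BK) \<le> Cx * rate n (h n)"
          unfolding sw_def BK_def Cx_def by (rule Bahadur_Kiefer_term[OF C0 d_def])
        have b3: "sw * (ln (real n) / w) \<le> rate n (h n)" unfolding sw_def w_def by (rule log_term)
        have b4: "sw * (1 / w) \<le> rate n (h n)" unfolding sw_def w_def by (rule one_term)
        have b5: "sw * h n \<le> rate n (h n)" unfolding sw_def by (rule bandwidth_term)
        have "sw * E = 4 * L * (sw * (1 / h n * BK)) + 51 * L * (sw * (1 / w))"
          unfolding E_def by (simp add: algebra_simps)
        also have "\<dots> \<le> 4 * L * (Cx * rate n (h n)) + 51 * L * rate n (h n)"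
          using b2 b4 L by (intro add_mono mult_left_mono) auto
        finally have bE: "sw * E \<le> (4 * L * Cx + 51 * L) * rate n (h n)" by (simp add: algebra_simps)
        have "\<bar>W.remainder (A u)\<bar> \<le> qmax * ((d + 1) / real n) / (qmin * c)
            + CA * ((G\<^sup>2 + E * (1 + G)) / c + Cq * (h n + (d + 1) / real n) / (qmin * c))"
          by (rule W.remainder_regular[OF a c P e g])
        also have "\<dots> \<le> qmax * ((d + 1) / real n) / (qmin * c)
            + CA * (((216 * L)\<^sup>2 * (ln (real n) / w) + E * (1 + 216 * L)) / c + Cq * (h n + (d + 1) / real n) / (qmin * c))"
          unfolding G2 using G1 E0 c CA by (intro add_left_mono mult_left_mono add_right_mono divide_right_mono) auto
        finally have "sw * \<bar>W.remainder (A u)\<bar> \<le> sw * (qmax * ((d + 1) / real n) / (qmin * c)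
            + CA * (((216 * L)\<^sup>2 * (ln (real n) / w) + E * (1 + 216 * L)) / c + Cq * (h n + (d + 1) / real n) / (qmin * c)))"
          using sw by (rule mult_left_mono)
        also have "\<dots> = qmax / (qmin * c) * (sw * ((d + 1) / real n))
            + CA / c * ((216 * L)\<^sup>2 * (sw * (ln (real n) / w)) + (1 + 216 * L) * (sw * E))
            + CA * Cq / (qmin * c) * (sw * h n + sw * ((d + 1) / real n))"
        proof -
          have dist: "sw * (y1 / (qmin * c) + CA * ((y2 + E * y3) / c + Cq * (h n + y4) / (qmin * c)))
            = sw * y1 / (qmin * c) + CA / c * (sw * y2 + y3 * (sw * E)) + CA * Cq / (qmin * c) * (sw * h n + sw * y4)" for y1 y2 y3 y4
            using c qmin by (simp add: field_simps)
          show ?thesis unfolding dist by (simp add: mult_ac)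
        qed
        also have "\<dots> \<le> qmax / (qmin * c) * ((C0 + 1) * rate n (h n))
            + CA / c * ((216 * L)\<^sup>2 * rate n (h n) + (1 + 216 * L) * ((4 * L * Cx + 51 * L) * rate n (h n)))
            + CA * Cq / (qmin * c) * (rate n (h n) + (C0 + 1) * rate n (h n))"
          using b1 b3 bE b5 qmax qmin c CA L Cq by (intro add_mono mult_left_mono) auto
        also have "\<dots> = C2 * rate n (h n)" unfolding C2_def by (simp add: algebra_simps add_divide_distrib)
        finally show ?thesis using C12 rate0 by (simp add: distrib_right add_increasing)
      qed
      then have "\<bar>sqrt (real n * h n) * W.remainder (A u)\<bar> \<le> (C1 + C2) * rate n (h n)"
        using sw by (simp add: sw_def abs_mult)
      then show "(\<exists>l d. quantile_window n V l d K L (h n) u Q q qmin qmax Cq) \<and>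
          \<bar>sqrt (real n * h n) * W.remainder (A u)\<bar> \<le> (C1 + C2) * rate n (h n)"
        using W.quantile_window_axioms by blast
    qed
  qed
  then show ?thesis by blast
qed

section \<open>Reduction to uniform samples\<close>

lemma sort_map_mono_on:
  assumes "mono_on (set xs) f"
  shows "sort (map f xs) = map f (sort xs)"
proof (rule properties_for_sort)
  show "sorted (map f (sort xs))"
  proof (rule sorted_iff_nth_mono[THEN iffD2], intro allI impI)
    fix i j assume ij: "i \<le> j" "j < length (map f (sort xs))"
    then have "sort xs ! i \<in> set (sort xs)" "sort xs ! j \<in> set (sort xs)" by (intro nth_mem; simp)+
    moreover have "sort xs ! i \<le> sort xs ! j" using ij by (intro sorted_nth_mono) auto
    ultimately show "map f (sort xs) ! i \<le> map f (sort xs) ! j"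
      using ij mono_onD[OF assms, of "sort xs ! i" "sort xs ! j"] by simp
  qed
qed simp

lemma order_stat_map_mono_on:
  assumes "mono_on (set xs) f" "1 \<le> i" "i \<le> length xs"
  shows "order_stat (map f xs) i = f (order_stat xs i)"
  using assms by (simp add: order_stat_def sort_map_mono_on)

lemma (in kernel_window) kernel_measurable: "K \<in> borel_measurable borel"
proof -
  have "L-lipschitz_on UNIV K" using K_lip L_pos by (intro lipschitz_onI) (auto simp: dist_real_def)
  then show ?thesis by (intro borel_measurable_continuous_onI lipschitz_on_continuous_on)
qed

context iid_uniform
begin

lemma AE_U_range: "AE \<omega> in M. 0 < U i \<omega> \<and> U i \<omega> \<le> 1"
proof -
  have "AE \<omega> in M. \<not> U i \<omega> \<le> 0" using unif[of 0 i] by (subst prob_Collect_eq_0[symmetric]) auto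
  moreover have "AE \<omega> in M. U i \<omega> \<le> 1" using unif[of 1 i] by (subst prob_Collect_eq_1[symmetric]) auto
  ultimately show ?thesis by eventually_elim auto
qed

text \<open>For u in [h, 1 - h] the whole kernel window lies where the uniform density is 1, so
  there is no boundary bias and the centring in \<open>Gnh\<close> is exactly 1.\<close>

lemma expectation_kernel:
  assumes "kernel_window n K L h u" and K1: "(\<integral>x. K x \<partial>lborel) = 1"
  shows "expectation (\<lambda>\<omega>. Kh K h (u - U i \<omega>)) = 1"
proof -
  interpret kernel_window n K L h u by fact
  have [measurable]: "K \<in> borel_measurable borel" by (rule kernel_measurable)
  have meas: "(\<lambda>x. Kh K h (u - x)) \<in> borel_measurable borel" unfolding Kh_def by measurable
  have "distributed M lborel (U i) (\<lambda>x. indicator {0..1} x / measure lborel {0..1::real})"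
    by (subst uniform_distributed_iff) (use unif in auto)
  then have "distributed M lborel (U i) (\<lambda>x. ennreal (indicator {0..1} x))" by simp
  then have "expectation (\<lambda>\<omega>. Kh K h (u - U i \<omega>)) = (\<integral>x. indicator {0..1} x * Kh K h (u - x) \<partial>lborel)"
    by (intro distributed_integral[symmetric]) (use meas in auto)
  also have "\<dots> = (\<integral>x. K (u / h + (- 1 / h) * x) / h \<partial>lborel)"
  proof (intro Bochner_Integration.integral_cong refl)
    fix x
    have "Kh K h (u - x) = 0" if "x \<notin> {0..1}" using that u_ge u_le h_pos by (intro Kh_supp) auto
    then have "indicator {0..1} x * Kh K h (u - x) = Kh K h (u - x)" by (auto simp: indicator_def)
    also have "\<dots> = K (u / h + (- 1 / h) * x) / h" by (simp add: Kh_def diff_divide_distrib)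
    finally show "indicator {0..1} x * Kh K h (u - x) = K (u / h + (- 1 / h) * x) / h" .
  qed
  also have "\<dots> = (\<integral>x. K (u / h + (- 1 / h) * x) \<partial>lborel) / h" by simp
  also have "\<dots> = (\<integral>x. K x \<partial>lborel)"
    using lborel_integral_real_affine[of "- 1 / h" K "u / h"] h_pos by simp
  finally show ?thesis using K1 by simp
qed

text \<open>\<open>rho\<close> is the mean of the discretized kernel and 1 the mean of the kernel
  itself, so integrating the pointwise discretization error over a window of length at most 3 h
  suffices.\<close>

lemma rho_close:
  assumes "kernel_window n K L h u" and K1: "(\<integral>x. K x \<partial>lborel) = 1"
  shows "\<bar>kernel_window.rho n K h u - 1\<bar> \<le> 3 * L / (real n * h)"
proof -
  interpret kernel_window n K L h u by fact
  have [measurable]: "K \<in> borel_measurable borel" by (rule kernel_measurable)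
  define D where "D x = (\<Sum>j=1..n. k (j - 1) * indicator {real (j - 1) / real n<..real j / real n} x)" for x :: real
  define c where "c = L / (real n * h\<^sup>2)"
  have c: "c \<ge> 0" using L_pos by (simp add: c_def)
  have [measurable]: "(\<lambda>\<omega>. Kh K h (u - U 0 \<omega>)) \<in> borel_measurable M" unfolding Kh_def by measurable
  have iI: "integrable M (\<lambda>\<omega>. indicator {a<..b} (U 0 \<omega>) :: real)" for a b
    by (intro integrable_const_bound[where B=1]) (auto simp: indicator_def)
  have iD: "integrable M (\<lambda>\<omega>. D (U 0 \<omega>))" unfolding D_def
    by (intro Bochner_Integration.integrable_sum integrable_mult_right iI)
  have iK: "integrable M (\<lambda>\<omega>. Kh K h (u - U 0 \<omega>))"
  proof (rule ccontr)
    \<comment> \<open>The integral of a non-integrable function is 0 by convention, whereas this one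
      is already known to be 1.\<close>
    assume "\<not> ?thesis"
    then have "expectation (\<lambda>\<omega>. Kh K h (u - U 0 \<omega>)) = 0" by (rule not_integrable_integral_eq)
    then show False using expectation_kernel[OF assms, of 0] by simp
  qed
  have "expectation (\<lambda>\<omega>. D (U 0 \<omega>)) = (\<Sum>j=1..n. k (j - 1) * expectation (\<lambda>\<omega>. indicator {real (j - 1) / real n<..real j / real n} (U 0 \<omega>)))"
    unfolding D_def by (subst Bochner_Integration.integral_sum) (auto intro: iI)
  also have "\<dots> = rho" unfolding rho_def
  proof (rule sum.cong)
    fix j assume j: "j \<in> {1..n}"
    have "expectation (\<lambda>\<omega>. indicator {real (j - 1) / real n<..real j / real n} (U 0 \<omega>)) = real j / real n - real (j - 1) / real n"
      using j by (intro expectation_indicator) (auto simp: divide_right_mono)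
    also have "\<dots> = 1 / real n" using j by (simp add: of_nat_diff diff_divide_distrib)
    finally show "k (j - 1) * expectation (\<lambda>\<omega>. indicator {real (j - 1) / real n<..real j / real n} (U 0 \<omega>)) = k (j - 1) / real n"
      by simp
  qed simp
  finally have ED: "expectation (\<lambda>\<omega>. D (U 0 \<omega>)) = rho" .
  have "1 - rho = expectation (\<lambda>\<omega>. Kh K h (u - U 0 \<omega>) - D (U 0 \<omega>))"
    using iK iD ED expectation_kernel[OF assms, of 0] by simp
  also have "\<bar>\<dots>\<bar> \<le> expectation (\<lambda>\<omega>. c * indicator {u - h<..upper_end} (U 0 \<omega>))"
  proof (rule integral_abs_bound[THEN order_trans], rule integral_mono_AE)
    show "integrable M (\<lambda>\<omega>. \<bar>Kh K h (u - U 0 \<omega>) - D (U 0 \<omega>)\<bar>)" using iK iD by auto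
    show "integrable M (\<lambda>\<omega>. c * indicator {u - h<..upper_end} (U 0 \<omega>))" by (intro integrable_mult_right iI)
    show "AE \<omega> in M. \<bar>Kh K h (u - U 0 \<omega>) - D (U 0 \<omega>)\<bar> \<le> c * indicator {u - h<..upper_end} (U 0 \<omega>)"
      using AE_U_range[of 0] by eventually_elim (auto simp: D_def c_def intro!: kernel_discretization[simplified])
  qed
  also have "\<dots> = c * (upper_end - (u - h))"
    using upper_end u_ge iI by (simp add: expectation_indicator)
  also have "\<dots> \<le> c * (3 * h)" using upper_end c by (intro mult_left_mono) auto
  also have "\<dots> = 3 * L / (real n * h)" unfolding c_def using h_pos by (simp add: power2_eq_square)
  finally show ?thesis by (simp add: abs_minus_commute)
qed

end

section \<open>The probability integral transform of the bids\<close>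

locale quantile_model = prob_space M for M :: "'a measure" +
  fixes b :: "nat \<Rightarrow> 'a \<Rightarrow> real" and F Q q :: "real \<Rightarrow> real"
  assumes indep_b: "indep_vars (\<lambda>_. borel) b UNIV"
    and ident_b: "\<And>i. distr M borel (b i) = distr M borel (b 0)"
    and F_def: "F = cdf (distr M borel (b 0))"
    and Q_inv: "\<And>u. u \<in> {0..1} \<Longrightarrow> F (Q u) = u"
    and Q_deriv: "\<And>u. u \<in> {0..1} \<Longrightarrow> (Q has_real_derivative q u) (at u within {0..1})"
begin

lemma meas_b [measurable]: "b i \<in> borel_measurable M"
  using indep_b by (auto simp: indep_vars_def)

lemma prob_b_le: "prob {\<omega> \<in> space M. b i \<omega> \<le> x} = F x"
proof -
  have "F x = measure (distr M borel (b i)) {..x}" unfolding F_def cdf_def ident_b[of i] ..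
  also have "\<dots> = prob (b i -` {..x} \<inter> space M)" by (rule measure_distr) auto
  also have "b i -` {..x} \<inter> space M = {\<omega> \<in> space M. b i \<omega> \<le> x}" by auto
  finally show ?thesis by simp
qed

lemma F_mono: "mono F"
proof (rule monoI)
  fix x y :: real assume "x \<le> y"
  then have "prob {\<omega> \<in> space M. b 0 \<omega> \<le> x} \<le> prob {\<omega> \<in> space M. b 0 \<omega> \<le> y}"
    by (intro finite_measure_mono) auto
  then show "F x \<le> F y" unfolding prob_b_le .
qed

lemma Q_strict_mono:
  assumes "s \<in> {0..1}" "t \<in> {0..1}" "s < t"
  shows "Q s < Q t"
proof (rule ccontr)
  assume "\<not> Q s < Q t"
  then have "F (Q t) \<le> F (Q s)" by (intro monoD[OF F_mono]) simp
  then show False using assms by (simp add: Q_inv)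
qed

lemma Q_mono: "s \<in> {0..1} \<Longrightarrow> t \<in> {0..1} \<Longrightarrow> s \<le> t \<Longrightarrow> Q s \<le> Q t"
  using Q_strict_mono[of s t] by (cases "s = t") auto

lemma Q_surj:
  assumes "Q 0 \<le> x" "x \<le> Q 1"
  obtains t where "t \<in> {0..1}" "x = Q t"
proof -
  have "continuous_on {0..1} Q" using Q_deriv by (intro DERIV_continuous_on) auto
  then show ?thesis using IVT'[of Q 0 x 1] assms that by auto
qed

text \<open>Q is only given as a right inverse of F; being continuous, it takes every value between
  Q 0 and Q 1, so there it is a left inverse as well. Strictness at Q 0 yields F x > 0, as
  \<open>ordered_sample\<close> demands.\<close>

lemma F_range:
  assumes "Q 0 < x" "x \<le> Q 1"
  shows "0 < F x" "F x \<le> 1" "Q (F x) = x"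
proof -
  obtain t where t: "t \<in> {0..1}" "x = Q t" using Q_surj[of x] assms by auto
  have "t \<noteq> 0" using t assms by auto
  then show "0 < F x" "F x \<le> 1" "Q (F x) = x" using t Q_inv by auto
qed

lemma AE_b_range: "AE \<omega> in M. Q 0 < b i \<omega> \<and> b i \<omega> \<le> Q 1"
proof -
  have "AE \<omega> in M. \<not> b i \<omega> \<le> Q 0" using prob_b_le[of i "Q 0"] Q_inv by (subst prob_Collect_eq_0[symmetric]) auto
  moreover have "AE \<omega> in M. b i \<omega> \<le> Q 1" using prob_b_le[of i "Q 1"] Q_inv by (subst prob_Collect_eq_1[symmetric]) auto
  ultimately show ?thesis by eventually_elim auto
qed

lemma meas_F [measurable]: "F \<in> borel_measurable borel"
  using F_mono by (rule borel_measurable_mono)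

lemma iid_uniform_F: "iid_uniform M (\<lambda>i \<omega>. F (b i \<omega>))"
proof unfold_locales
  show "indep_vars (\<lambda>_. borel) (\<lambda>i \<omega>. F (b i \<omega>)) UNIV"
    by (rule indep_vars_compose2[OF indep_b]) auto
  fix i t assume t: "0 \<le> t" "t \<le> (1::real)"
  have "prob {\<omega> \<in> space M. F (b i \<omega>) \<le> t} = prob {\<omega> \<in> space M. b i \<omega> \<le> Q t}"
  proof (rule finite_measure_eq_AE)
    show "AE \<omega> in M. \<omega> \<in> {\<omega> \<in> space M. F (b i \<omega>) \<le> t} \<longleftrightarrow> \<omega> \<in> {\<omega> \<in> space M. b i \<omega> \<le> Q t}"
      using AE_b_range[of i]
    proof eventually_elim
      case (elim \<omega>)
      note r = F_range[of "b i \<omega>"]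
      have "F (b i \<omega>) \<le> t \<longleftrightarrow> b i \<omega> \<le> Q t"
        using Q_mono[of "F (b i \<omega>)" t] monoD[OF F_mono, of "b i \<omega>" "Q t"] r elim t Q_inv[of t] by auto
      then show ?case by auto
    qed
  qed auto
  also have "\<dots> = t" using prob_b_le Q_inv t by auto
  finally show "prob {\<omega> \<in> space M. F (b i \<omega>) \<le> t} = t" .
qed

end

text \<open>Nothing is approximated here: a monotone Q commutes with sorting, so the ordered bids
  are \<open>Q (T i)\<close>, and the unit mean of the kernel terms turns \<open>Gnh\<close> into a
  multiple of \<open>kde - 1\<close>.\<close>

lemma (in quantile_window) expansion_eq_remainder:
  assumes mono: "mono_on {0..1} Q"
    and EK: "\<And>i. (\<integral>\<omega>'. Kh K h (u - F (b i \<omega>')) \<partial>M) = 1"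
    and b: "\<And>i. b i \<omega> = Q (V i)" "\<And>i. F (b i \<omega>) = V i"
  shows "sqrt (real n * h) * (vhat p Mp K h (map (\<lambda>i. b i \<omega>) [0..<n]) u - (Q u + Afun p Mp u * q u))
        / qhat K h (map (\<lambda>i. b i \<omega>) [0..<n]) u - (- Afun p Mp u * Gnh M K F b h n u \<omega>)
      = sqrt (real n * h) * remainder (Afun p Mp u)"
proof -
  define xs where "xs = map V [0..<n]"
  have eq: "map (\<lambda>i. b i \<omega>) [0..<n] = map Q xs" by (simp add: xs_def b)
  have "set xs \<subseteq> {0..1}" using V_range by (auto simp: xs_def less_imp_le)
  then have m: "mono_on (set xs) Q" using mono by (rule mono_on_subset[rotated])
  have os: "order_stat (map Q xs) i = Q (T i)" if "1 \<le> i" "i \<le> n" for i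
    using order_stat_map_mono_on[OF m, of i] that by (simp add: T_def xs_def)
  have len: "length (map Q xs) = n" by (simp add: xs_def)
  have "u < 1" using u_le h_pos by linarith
  then have "Qhat (map Q xs) u = Q (T ui)"
    unfolding Qhat_def len using os[OF ui(1,2)] by (simp add: ui_def)
  moreover have "qhat K h (map Q xs) u = qh"
    unfolding qhat_def qh_def len k_def
  proof (rule sum.cong)
    fix j assume "j \<in> {1..n - 1}"
    then have "order_stat (map Q xs) j = Q (T j)" "order_stat (map Q xs) (j + 1) = Q (T (j + 1))"
      using n_pos by (auto intro!: os)
    then show "Kh K h (u - real j / real n) * (order_stat (map Q xs) (j + 1) - order_stat (map Q xs) j)
       = Kh K h (u - real j / real n) * (Q (T (j + 1)) - Q (T j))" by simp
  qed simp
  ultimately have v: "vhat p Mp K h (map (\<lambda>i. b i \<omega>) [0..<n]) u = Q (T ui) + Afun p Mp u * qh"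
    and qq: "qhat K h (map (\<lambda>i. b i \<omega>) [0..<n]) u = qh" unfolding eq vhat_def by auto
  have G: "Gnh M K F b h n u \<omega> = sqrt (real n * h) * (kde - 1)"
    using n_pos unfolding Gnh_def kde_def EK b(2) by (simp add: sum_subtractf diff_divide_distrib right_diff_distrib)
  show ?thesis unfolding v qq G remainder_def by (simp add: distrib_left mult_ac)
qed

theorem mainTheorem2:
  fixes M :: "'a measure" and b :: "nat \<Rightarrow> 'a \<Rightarrow> real"
    and F Q q q' :: "real \<Rightarrow> real"
    and p :: "nat \<Rightarrow> real" and Mp :: nat
    and K :: "real \<Rightarrow> real" and h :: "nat \<Rightarrow> real"
  assumes prob: "prob_space M"
    and indep: "prob_space.indep_vars M (\<lambda>_. borel) b UNIV"
    and ident: "\<And>i. distr M borel (b i) = distr M borel (b 0)"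
    and F_def: "F = cdf (distr M borel (b 0))"
    and F_cont: "\<And>x. isCont F x"
    and Q_inv: "\<And>u. u \<in> {0..1} \<Longrightarrow> F (Q u) = u"
    and Q_deriv: "\<And>u. u \<in> {0..1} \<Longrightarrow> (Q has_real_derivative q u) (at u within {0..1})"
    and q_deriv: "\<And>u. u \<in> {0..1} \<Longrightarrow> (q has_real_derivative q' u) (at u within {0..1})"
    and q'_cont: "continuous_on {0..1} q'"
    and q_pos: "\<And>u. u \<in> {0..1} \<Longrightarrow> q u > 0"
    and Mp_ge: "Mp \<ge> 2"
    and p_nonneg: "\<And>m. m \<in> {1..Mp} \<Longrightarrow> p m \<ge> 0"
    and A1'_nz: "\<And>u. u \<in> {0..1} \<Longrightarrow> A1' p Mp u \<noteq> 0"
    and K_nonneg: "\<And>x. K x \<ge> 0"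
    and K_int: "integrable lborel K"
    and K_int1: "(\<integral>x. K x \<partial>lborel) = 1"
    and K_sq: "integrable lborel (\<lambda>x. (K x)\<^sup>2)"
    and K_lip: "\<exists>L. lipschitz_on L UNIV K"
    and K_supp: "\<And>x. \<bar>x\<bar> > 1 \<Longrightarrow> K x = 0"
    and h_pos: "\<And>n. h n > 0"
    and h_lim: "h \<longlonglongrightarrow> 0"
    and nh_lim: "filterlim (\<lambda>n. real n * h n) at_top sequentially"
  shows "AE \<omega> in M. \<exists>C. \<forall>\<^sub>F n in sequentially. \<forall>u \<in> {h n..1 - h n}.
     \<bar>sqrt (real n * h n) * (vhat p Mp K (h n) (map (\<lambda>i. b i \<omega>) [0..<n]) u
          - (Q u + Afun p Mp u * q u))
        / qhat K (h n) (map (\<lambda>i. b i \<omega>) [0..<n]) u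
      - (- Afun p Mp u * Gnh M K F b (h n) n u \<omega>)\<bar>
     \<le> C * (sqrt (real n) * h n powr (3/2) + sqrt (h n)
            + h n powr (-1/2) * real n powr (-1/4) * ell n)"
proof -
  interpret prob_space M by fact
  interpret QM: quantile_model M b F Q q
    using indep ident F_def Q_inv Q_deriv by unfold_locales auto
  interpret IU: iid_uniform M "\<lambda>i \<omega>. F (b i \<omega>)" by (rule QM.iid_uniform_F)

  obtain L0 where L0: "L0-lipschitz_on UNIV K" using K_lip by blast
  define L where "L = L0 + 1"
  have L: "L > 0" using lipschitz_on_nonneg[OF L0] by (simp add: L_def)
  have KL: "\<bar>K x - K y\<bar> \<le> L * \<bar>x - y\<bar>" for x y
    using lipschitz_onD[OF L0, of x y] unfolding L_def dist_real_def by (simp add: distrib_right)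
  have K_supp': "K x = 0" if "\<bar>x\<bar> \<ge> 1" for x
  proof (rule ccontr)
    assume nz: "K x \<noteq> 0"
    \<comment> \<open>Closes the support at |x| = 1: moving outwards by e reaches a zero of K, yet
      over this distance K can drop by at most L e = K x / 2.\<close>
    define e where "e = K x / (2 * L)"
    have e: "e > 0" using nz K_nonneg[of x] L by (simp add: e_def less_le)
    define y where "y = (if x \<ge> 0 then x + e else x - e)"
    have "\<bar>y\<bar> > 1" using that e by (auto simp: y_def)
    then have "\<bar>K x\<bar> \<le> L * \<bar>x - y\<bar>" using KL[of x y] K_supp by simp
    also have "\<bar>x - y\<bar> = e" using e by (simp add: y_def)
    also have "L * e = K x / 2" using L by (simp add: e_def)
    finally show False using nz K_nonneg[of x] by auto
  qed
  obtain x0 where x0: "K x0 > 0"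
  proof -
    have "\<exists>x. K x \<noteq> 0"
    proof (rule ccontr)
      assume "\<not> ?thesis"
      then have "(\<integral>x. K x \<partial>lborel) = 0" by simp
      then show False using K_int1 by simp
    qed
    then show ?thesis using that K_nonneg by (metis less_le)
  qed
  define kap where "kap = K x0 / 2"
  \<comment> \<open>Within this distance of x0 the kernel loses at most half of \<open>K x0\<close>.
    The centre is any point where K is positive, as K may vanish at 0.\<close>
  define \<delta> where "\<delta> = K x0 / (2 * L)"
  have kap: "kap > 0" "\<delta> > 0" using x0 L by (auto simp: kap_def \<delta>_def)
  have bump: "kap \<le> K z" if "\<bar>z - x0\<bar> \<le> \<delta>" for z
  proof -
    have "\<bar>K x0 - K z\<bar> \<le> L * \<bar>z - x0\<bar>" using KL[of x0 z] by (simp add: abs_minus_commute)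
    also have "\<dots> \<le> L * \<delta>" using that L by (intro mult_left_mono) auto
    also have "\<dots> = K x0 / 2" using L by (simp add: \<delta>_def)
    finally show ?thesis unfolding kap_def by linarith
  qed

  have q_cont: "continuous_on {0..1} q" using q_deriv by (intro DERIV_continuous_on) auto
  obtain umin where umin: "umin \<in> {0..1}" "\<And>x. x \<in> {0..1} \<Longrightarrow> q umin \<le> q x"
    using continuous_attains_inf[OF compact_Icc _ q_cont] by auto
  obtain umax where umax: "umax \<in> {0..1}" "\<And>x. x \<in> {0..1} \<Longrightarrow> q x \<le> q umax"
    using continuous_attains_sup[OF compact_Icc _ q_cont] by auto
  obtain Cq where "\<forall>y\<in>q' ` {0..1}. norm y \<le> Cq"
    using compact_imp_bounded[OF compact_continuous_image[OF q'_cont compact_Icc]]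
    unfolding bounded_iff by blast
  then have Cq: "\<bar>q' x\<bar> \<le> Cq" if "x \<in> {0..1}" for x using that by auto
  have Cq0: "Cq \<ge> 0" using Cq[of 0] by auto
  have q_lip: "\<bar>q x - q y\<bar> \<le> Cq * \<bar>x - y\<bar>" if "x \<in> {0..1}" "y \<in> {0..1}" for x y
    using field_differentiable_bound[of "{0..1}" q q' Cq x y] q_deriv Cq that by simp

  have cA1: "continuous_on {0..1} (A1 p Mp)" "continuous_on {0..1} (A1' p Mp)"
    unfolding A1_def[abs_def] A1'_def[abs_def] by (intro continuous_intros)+
  have "continuous_on {0..1} (Afun p Mp)"
    unfolding Afun_def[abs_def] using A1'_nz by (intro continuous_intros cA1) auto
  then have "bounded (Afun p Mp ` {0..1})"
    by (rule compact_imp_bounded[OF compact_continuous_image[OF _ compact_Icc]])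
  then obtain CA where "\<forall>y\<in>Afun p Mp ` {0..1}. norm y \<le> CA" unfolding bounded_iff by blast
  then have CA: "\<bar>Afun p Mp x\<bar> \<le> CA" if "x \<in> {0..1}" for x using that by auto

  obtain C0 where C0: "C0 > 0" "AE \<omega> in M. \<forall>\<^sub>F n in sequentially. \<forall>x\<in>{0..1}.
     \<bar>pcount (\<lambda>i. F (b i \<omega>)) {..<n} 0 x - real n * x\<bar> \<le> C0 * sqrt (real n * ln (ln (real n)))"
    using IU.AE_discrepancy by blast
  have "AE \<omega> in M. \<forall>i. Q 0 < b i \<omega> \<and> b i \<omega> \<le> Q 1"
    unfolding AE_all_countable using QM.AE_b_range by blast
  with C0(2) IU.AE_oscillation IU.AE_no_clumps show ?thesis
  proof eventually_elim
    case (elim \<omega>)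
    define V where "V i = F (b i \<omega>)" for i
    have V_eq: "V = (\<lambda>i. F (b i \<omega>))" by (simp add: V_def fun_eq_iff)
    have V: "0 < V i" "V i \<le> 1" "b i \<omega> = Q (V i)" for i
      using QM.F_range[of "b i \<omega>"] elim(4) by (auto simp: V_def)
    have "\<exists>C. \<forall>\<^sub>F n in sequentially. \<forall>u\<in>{h n..1 - h n}.
       (\<exists>l d. quantile_window n V l d K L (h n) u Q q (q umin) (q umax) Cq) \<and>
       \<bar>sqrt (real n * h n) * quantile_window.remainder n V K (h n) u Q q (Afun p Mp u)\<bar> \<le> C * rate n (h n)"
    proof (rule deterministic_expansion[where L=L and kap=kap and \<delta>=\<delta> and ?x0.0=x0 and ?C0.0=C0
          and qmin="q umin" and qmax="q umax" and Cq=Cq and CA=CA])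
      show "\<bar>kernel_window.rho n K (h n) u - 1\<bar> \<le> 3 * L / (real n * h n)" if "kernel_window n K L (h n) u" for n u
        using IU.rho_close[OF that K_int1] .
      show "\<And>i. 0 < V i" "\<And>i. V i \<le> 1" by (rule V)+
      show "0 \<le> C0" using C0(1) by simp
      show "\<bar>K x - K y\<bar> \<le> L * \<bar>x - y\<bar>" for x y by (rule KL)
      show "0 \<le> K x" for x by (rule K_nonneg)
      show "K x = 0" if "1 \<le> \<bar>x\<bar>" for x using that by (rule K_supp')
      show "kap \<le> K z" if "\<bar>z - x0\<bar> \<le> \<delta>" for z using that by (rule bump)
      show "0 < h n" for n by (rule h_pos)
      show "(Q has_real_derivative q x) (at x within {0..1})" if "x \<in> {0..1}" for x using that by (rule Q_deriv)
      show "0 < q umin" using umin(1) by (rule q_pos)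
      show "q umin \<le> q x" "q x \<le> q umax" if "x \<in> {0..1}" for x using that umin(2) umax(2) by blast+
      show "\<bar>q x - q y\<bar> \<le> Cq * \<bar>x - y\<bar>" if "x \<in> {0..1}" "y \<in> {0..1}" for x y using that by (rule q_lip)
      show "\<bar>Afun p Mp x\<bar> \<le> CA" if "x \<in> {0..1}" for x using that by (rule CA)
    qed (fact elim(1-3)[folded V_eq] L kap nh_lim Cq0)+
    then obtain C where C: "\<forall>\<^sub>F n in sequentially. \<forall>u\<in>{h n..1 - h n}.
       (\<exists>l d. quantile_window n V l d K L (h n) u Q q (q umin) (q umax) Cq) \<and>
       \<bar>sqrt (real n * h n) * quantile_window.remainder n V K (h n) u Q q (Afun p Mp u)\<bar> \<le> C * rate n (h n)" by blast
    have mono: "mono_on {0..1} Q" using QM.Q_mono by (intro mono_onI) auto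
    show ?case
    proof (intro exI, use C in eventually_elim, intro ballI)
      fix n u assume good: "\<forall>u\<in>{h n..1 - h n}.
       (\<exists>l d. quantile_window n V l d K L (h n) u Q q (q umin) (q umax) Cq) \<and>
       \<bar>sqrt (real n * h n) * quantile_window.remainder n V K (h n) u Q q (Afun p Mp u)\<bar> \<le> C * rate n (h n)"
        and u: "u \<in> {h n..1 - h n}"
      then obtain l d where "quantile_window n V l d K L (h n) u Q q (q umin) (q umax) Cq" by blast
      then interpret W: quantile_window n V l d K L "h n" u Q q "q umin" "q umax" Cq .
      have "kernel_window n K L (h n) u" by unfold_locales
      note EK = IU.expectation_kernel[OF this K_int1]
      show "\<bar>sqrt (real n * h n) * (vhat p Mp K (h n) (map (\<lambda>i. b i \<omega>) [0..<n]) u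
          - (Q u + Afun p Mp u * q u))
        / qhat K (h n) (map (\<lambda>i. b i \<omega>) [0..<n]) u
      - (- Afun p Mp u * Gnh M K F b (h n) n u \<omega>)\<bar>
     \<le> C * (sqrt (real n) * h n powr (3/2) + sqrt (h n)
            + h n powr (-1/2) * real n powr (-1/4) * ell n)"
        using good u unfolding W.expansion_eq_remainder[OF mono EK V(3) V_def[symmetric]] rate_def by blast
    qed
  qed
qed

end
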